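(* Let $K$ be a definably complete Baire structure, $n\ge 1$, $U\subseteq K^n$ a definable, definably connected open set, and $M\subseteq C^\infty(U,K)$ a Noetherian differential ring. Let $k,m\in\mathbb N$ with $k\le n$. Let $H=(h_1,\dots,h_{n-k})\in M^{n-k}$ with $V:=V^{\mathrm{reg}}(H)\neq\emptyset$, let $F=(F_1,\dots,F_m)\in M^m$ and $f:=F\restriction V:V\to K^m$. Let $\Delta_f\subseteq V$ be the set of singular points of $f$ and $\Sigma_f:=f(\Delta_f)$ the set of singular values of $f$. Then $\Sigma_f$ is definably meager in $K^m$.
   Context: "Definable" means definable in $K$ with parameters from $K$. $K$ carries the order topology, $K^n$ the product topology. An expansion $K$ of an ordered field is definably complete if every definable subset of $K$ has a supremum in $K\cup\{\pm\infty\}$. Let $X\subseteq Y\subseteq K^n$ with $Y$ definable. $X$ is nowhere dense in $Y$ if its closure in $Y$ has empty interior in $Y$; $X$ is definably meager in $Y$ if there is a definable family $(A(t))_{t\in K}$ of nowhere dense subsets of $Y$, increasing in $t$, with $X\subseteq\bigcup_{t}A(t)$; $Y$ is definably Baire if no non-empty definable open subset of $Y$ is definably meager in $Y$. A definably complete Baire structure is a definably complete expansion $K$ of an ordered field such that $K$ is definably Baire. A definable set is definably connected if it is not the union of two definable non-empty disjoint relatively open subsets. $C^\infty(U,K)$ is the ring of definable $C^\infty$ functions $U\to K$. A Noetherian differential ring is a subring $M\subseteq C^\infty(U,K)$ that is Noetherian, closed under the partial derivatives $\partial/\partial x_1,\dots,\partial/\partial x_n$, and contains $K[x_1,\dots,x_n]$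 (restricted to $U$). For $G=(g_1,\dots,g_l)\in M^l$, $V^{\mathrm{reg}}(G)$ is the set of regular zeroes of $G$: the $x\in U$ with $G(x)=0$ at which the Jacobian matrix of $G$ has rank $l$ (if $l=0$, $V^{\mathrm{reg}}(G)=U$). Thus $V$ is a $k$-dimensional definable embedded $C^\infty$ submanifold. A point $x\in V$ is singular for $f:V\to K^m$ if the differential $df_x:T_xV\to K^m$ is not surjective (rank less than $m$). *)

theory Defs
  imports
    "HOL-Library.Extended"
    "HOL-Analysis.Function_Topology"
    "HOL-Algebra.Subrings"
    "HOL-Algebra.Ring_Divisibility"
    "Jordan_Normal_Form.DL_Rank"
begin

section \<open>First-order definability with parameters\<close>

text \<open>
  The ordered field is the type \<open>'a :: {linordered_field, linorder_topology}\<close>; the class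
  \<open>linorder_topology\<close> fixes the topology to be the order topology. An expansion of it is given
  by interpretations of arbitrary further function symbols \<open>'f\<close> and relation symbols \<open>'r\<close>.
  A symbol used with \<open>k\<close> arguments plays the role of a \<open>k\<close>-ary symbol of its own. So no arities
  need to be declared: a symbol with a fixed arity is interpreted by a constant at all other
  argument lengths, which adds no definable sets.
\<close>

record ('f, 'r, 'a) expansion =
  fun_int :: "'f \<Rightarrow> 'a list \<Rightarrow> 'a"
  rel_int :: "'r \<Rightarrow> 'a list \<Rightarrow> bool"

text \<open>Parameters are constant symbols for all elements of the field; they include 0 and 1.\<close>

datatype ('f, 'a) fo_term =
    TVar nat
  | TPar 'a
  | TNeg "('f, 'a) fo_term"
  | TAdd "('f, 'a) fo_term" "('f, 'a) fo_term"
  | TMul "('f, 'a) fo_term" "('f, 'a) fo_term"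
  | TFun 'f "('f, 'a) fo_term list"

datatype ('f, 'r, 'a) fo_form =
    FEq "('f, 'a) fo_term" "('f, 'a) fo_term"
  | FLess "('f, 'a) fo_term" "('f, 'a) fo_term"
  | FRel 'r "('f, 'a) fo_term list"
  | FNot "('f, 'r, 'a) fo_form"
  | FAnd "('f, 'r, 'a) fo_form" "('f, 'r, 'a) fo_form"
  | FEx nat "('f, 'r, 'a) fo_form"

primrec tvars :: "('f, 'a) fo_term \<Rightarrow> nat set" where
  "tvars (TVar i) = {i}"
| "tvars (TPar c) = {}"
| "tvars (TNeg s) = tvars s"
| "tvars (TAdd s t) = tvars s \<union> tvars t"
| "tvars (TMul s t) = tvars s \<union> tvars t"
| "tvars (TFun f ts) = \<Union> (set (map tvars ts))"

primrec fvars :: "('f, 'r, 'a) fo_form \<Rightarrow> nat set" where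
  "fvars (FEq s t) = tvars s \<union> tvars t"
| "fvars (FLess s t) = tvars s \<union> tvars t"
| "fvars (FRel r ts) = \<Union> (set (map tvars ts))"
| "fvars (FNot p) = fvars p"
| "fvars (FAnd p q) = fvars p \<union> fvars q"
| "fvars (FEx i p) = fvars p - {i}"

primrec tval ::
  "('f, 'r, 'a::linordered_field) expansion \<Rightarrow> (nat \<Rightarrow> 'a) \<Rightarrow> ('f, 'a) fo_term \<Rightarrow> 'a" where
  "tval S e (TVar i) = e i"
| "tval S e (TPar c) = c"
| "tval S e (TNeg s) = - tval S e s"
| "tval S e (TAdd s t) = tval S e s + tval S e t"
| "tval S e (TMul s t) = tval S e s * tval S e t"
| "tval S e (TFun f ts) = fun_int S f (map (tval S e) ts)"

primrec sat ::
  "('f, 'r, 'a::linordered_field) expansion \<Rightarrow> (nat \<Rightarrow> 'a) \<Rightarrow> ('f, 'r, 'a) fo_form \<Rightarrow> bool" where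
  "sat S e (FEq s t) \<longleftrightarrow> tval S e s = tval S e t"
| "sat S e (FLess s t) \<longleftrightarrow> tval S e s < tval S e t"
| "sat S e (FRel r ts) \<longleftrightarrow> rel_int S r (map (tval S e) ts)"
| "sat S e (FNot p) \<longleftrightarrow> \<not> sat S e p"
| "sat S e (FAnd p q) \<longleftrightarrow> sat S e p \<and> sat S e q"
| "sat S e (FEx i p) \<longleftrightarrow> (\<exists>a. sat S (e(i := a)) p)"

text \<open>
  The affine space of dimension \<open>n\<close> consists of the functions on \<open>{..<n}\<close> (extended by
  \<open>undefined\<close>), so that \<open>x(n := t)\<close> appends a coordinate \<open>t\<close> to a point \<open>x\<close>.
\<close>

abbreviation kspace :: "nat \<Rightarrow> (nat \<Rightarrow> 'a) set" where
  "kspace n \<equiv> {..<n} \<rightarrow>\<^sub>E UNIV"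

definition ptop :: "nat \<Rightarrow> (nat \<Rightarrow> 'a::topological_space) topology" where
  "ptop n = product_topology (\<lambda>_. euclidean) {..<n}"

definition definable ::
  "('f, 'r, 'a::linordered_field) expansion \<Rightarrow> nat \<Rightarrow> (nat \<Rightarrow> 'a) set \<Rightarrow> bool" where
  "definable S n X \<longleftrightarrow> (\<exists>p. fvars p \<subseteq> {..<n} \<and> X = {x \<in> kspace n. sat S x p})"

definition definable_family ::
  "('f, 'r, 'a::linordered_field) expansion \<Rightarrow> nat \<Rightarrow> ('a \<Rightarrow> (nat \<Rightarrow> 'a) set) \<Rightarrow> bool" where
  "definable_family S n A \<longleftrightarrow>
     (\<forall>t. A t \<subseteq> kspace n) \<and> definable S (Suc n) {x(n := t) | x t. x \<in> A t}"

definition definable_fun ::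
  "('f, 'r, 'a::linordered_field) expansion \<Rightarrow> nat \<Rightarrow> (nat \<Rightarrow> 'a) set \<Rightarrow> ((nat \<Rightarrow> 'a) \<Rightarrow> 'a) \<Rightarrow> bool" where
  "definable_fun S n U f \<longleftrightarrow> U \<subseteq> kspace n \<and> definable S (Suc n) {x(n := f x) | x. x \<in> U}"


section \<open>Definably complete Baire structures\<close>

text \<open>Subsets of the field are identified with subsets of \<open>kspace 1\<close> via the coordinate \<open>x 0\<close>.\<close>

definition definably_complete :: "('f, 'r, 'a::linordered_field) expansion \<Rightarrow> bool" where
  "definably_complete S \<longleftrightarrow>
     (\<forall>X. definable S 1 X \<longrightarrow>
        (\<exists>s::'a extended. (\<forall>x\<in>X. Fin (x 0) \<le> s) \<and>
            (\<forall>u. (\<forall>x\<in>X. Fin (x 0) \<le> u) \<longrightarrow> s \<le> u)))"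

definition nowhere_dense_in ::
  "nat \<Rightarrow> (nat \<Rightarrow> 'a::topological_space) set \<Rightarrow> (nat \<Rightarrow> 'a) set \<Rightarrow> bool" where
  "nowhere_dense_in n Y X \<longleftrightarrow> X \<subseteq> Y \<and>
     subtopology (ptop n) Y interior_of (subtopology (ptop n) Y closure_of X) = {}"

definition definably_meager ::
  "('f, 'r, 'a::{linordered_field, linorder_topology}) expansion \<Rightarrow> nat \<Rightarrow>
     (nat \<Rightarrow> 'a) set \<Rightarrow> (nat \<Rightarrow> 'a) set \<Rightarrow> bool" where
  "definably_meager S n Y X \<longleftrightarrow>
     (\<exists>A. definable_family S n A \<and> (\<forall>t. nowhere_dense_in n Y (A t)) \<and>
          (\<forall>s t. s \<le> t \<longrightarrow> A s \<subseteq> A t) \<and> X \<subseteq> (\<Union>t. A t))"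

definition definably_Baire ::
  "('f, 'r, 'a::{linordered_field, linorder_topology}) expansion \<Rightarrow> nat \<Rightarrow> (nat \<Rightarrow> 'a) set \<Rightarrow> bool" where
  "definably_Baire S n Y \<longleftrightarrow>
     \<not> (\<exists>W. W \<noteq> {} \<and> definable S n W \<and> openin (subtopology (ptop n) Y) W \<and>
            definably_meager S n Y W)"

definition definably_complete_Baire ::
  "('f, 'r, 'a::{linordered_field, linorder_topology}) expansion \<Rightarrow> bool" where
  "definably_complete_Baire S \<longleftrightarrow> definably_complete S \<and> definably_Baire S 1 (kspace 1)"

definition definably_connected ::
  "('f, 'r, 'a::{linordered_field, linorder_topology}) expansion \<Rightarrow> nat \<Rightarrow> (nat \<Rightarrow> 'a) set \<Rightarrow> bool" where
  "definably_connected S n X \<longleftrightarrow>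
     \<not> (\<exists>A B. definable S n A \<and> definable S n B \<and> A \<noteq> {} \<and> B \<noteq> {} \<and> A \<inter> B = {} \<and> A \<union> B = X \<and>
            openin (subtopology (ptop n) X) A \<and> openin (subtopology (ptop n) X) B)"


section \<open>Smooth definable functions\<close>

definition has_partial ::
  "((nat \<Rightarrow> 'a) \<Rightarrow> 'a) \<Rightarrow> nat \<Rightarrow> (nat \<Rightarrow> 'a) \<Rightarrow> 'a::{linordered_field, linorder_topology} \<Rightarrow> bool" where
  "has_partial f i x D \<longleftrightarrow> ((\<lambda>h. (f (x(i := x i + h)) - f x) / h) \<longlongrightarrow> D) (at 0)"

definition partial ::
  "(nat \<Rightarrow> 'a) set \<Rightarrow> nat \<Rightarrow> ((nat \<Rightarrow> 'a) \<Rightarrow> 'a) \<Rightarrow> (nat \<Rightarrow> 'a) \<Rightarrow> 'a::{linordered_field, linorder_topology}" where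
  "partial U i f = (\<lambda>x\<in>U. THE D. has_partial f i x D)"

text \<open>
  \<open>smooth_upto n U p f\<close>: all iterated partial derivatives of order at most \<open>p\<close> exist and are
  continuous on the open set \<open>U\<close>.
\<close>

primrec smooth_upto ::
  "nat \<Rightarrow> (nat \<Rightarrow> 'a::{linordered_field, linorder_topology}) set \<Rightarrow> nat \<Rightarrow> ((nat \<Rightarrow> 'a) \<Rightarrow> 'a) \<Rightarrow> bool" where
  "smooth_upto n U 0 f \<longleftrightarrow> continuous_map (subtopology (ptop n) U) euclidean f"
| "smooth_upto n U (Suc p) f \<longleftrightarrow>
     continuous_map (subtopology (ptop n) U) euclidean f \<and>
     (\<forall>i<n. (\<forall>x\<in>U. \<exists>D. has_partial f i x D) \<and> smooth_upto n U p (partial U i f))"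

text \<open>Functions on \<open>U\<close> are represented by their unique extension that is \<open>undefined\<close> outside.\<close>

definition smooth_definable ::
  "('f, 'r, 'a::{linordered_field, linorder_topology}) expansion \<Rightarrow> nat \<Rightarrow> (nat \<Rightarrow> 'a) set \<Rightarrow>
     ((nat \<Rightarrow> 'a) \<Rightarrow> 'a) set" where
  "smooth_definable S n U =
     {f \<in> extensional U. definable_fun S n U f \<and> (\<forall>p. smooth_upto n U p f)}"

definition smooth_ring ::
  "('f, 'r, 'a::{linordered_field, linorder_topology}) expansion \<Rightarrow> nat \<Rightarrow> (nat \<Rightarrow> 'a) set \<Rightarrow>
     ((nat \<Rightarrow> 'a) \<Rightarrow> 'a) ring" where
  "smooth_ring S n U =
     \<lparr>carrier = smooth_definable S n U,
      monoid.mult = (\<lambda>f g. \<lambda>x\<in>U. f x * g x), one = (\<lambda>x\<in>U. 1),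
      zero = (\<lambda>x\<in>U. 0), add = (\<lambda>f g. \<lambda>x\<in>U. f x + g x)\<rparr>"

inductive_set polynomial_functions :: "nat \<Rightarrow> (nat \<Rightarrow> 'a::comm_ring_1) set \<Rightarrow> ((nat \<Rightarrow> 'a) \<Rightarrow> 'a) set"
  for n :: nat and U :: "(nat \<Rightarrow> 'a) set" where
  const: "(\<lambda>x\<in>U. c) \<in> polynomial_functions n U"
| coord: "i < n \<Longrightarrow> (\<lambda>x\<in>U. x i) \<in> polynomial_functions n U"
| add: "f \<in> polynomial_functions n U \<Longrightarrow> g \<in> polynomial_functions n U \<Longrightarrow>
    (\<lambda>x\<in>U. f x + g x) \<in> polynomial_functions n U"
| mult: "f \<in> polynomial_functions n U \<Longrightarrow> g \<in> polynomial_functions n U \<Longrightarrow>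
    (\<lambda>x\<in>U. f x * g x) \<in> polynomial_functions n U"

definition noetherian_differential_ring ::
  "('f, 'r, 'a::{linordered_field, linorder_topology}) expansion \<Rightarrow> nat \<Rightarrow> (nat \<Rightarrow> 'a) set \<Rightarrow>
     ((nat \<Rightarrow> 'a) \<Rightarrow> 'a) set \<Rightarrow> bool" where
  "noetherian_differential_ring S n U M \<longleftrightarrow>
     subring M (smooth_ring S n U) \<and>
     noetherian_ring ((smooth_ring S n U)\<lparr>carrier := M\<rparr>) \<and>
     (\<forall>f\<in>M. \<forall>i<n. partial U i f \<in> M) \<and>
     polynomial_functions n U \<subseteq> M"


section \<open>Regular zeroes and singular points\<close>

definition jacobian ::
  "nat \<Rightarrow> (nat \<Rightarrow> 'a::{linordered_field, linorder_topology}) set \<Rightarrow> nat \<Rightarrow>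
     (nat \<Rightarrow> (nat \<Rightarrow> 'a) \<Rightarrow> 'a) \<Rightarrow> (nat \<Rightarrow> 'a) \<Rightarrow> 'a mat" where
  "jacobian n U l G x = mat l n (\<lambda>(i, j). partial U j (G i) x)"

text \<open>In \<open>vec_space.rank l A\<close> the number \<open>l\<close> is the number of rows of \<open>A\<close>.\<close>

definition regular_zeroes ::
  "nat \<Rightarrow> (nat \<Rightarrow> 'a::{linordered_field, linorder_topology}) set \<Rightarrow> nat \<Rightarrow>
     (nat \<Rightarrow> (nat \<Rightarrow> 'a) \<Rightarrow> 'a) \<Rightarrow> (nat \<Rightarrow> 'a) set" where
  "regular_zeroes n U l G =
     {x \<in> U. (\<forall>i<l. G i x = 0) \<and> vec_space.rank l (jacobian n U l G x) = l}"

text \<open>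
  The tangent space at \<open>x\<close> of the manifold of regular zeroes of \<open>(G 0, \<dots>, G (l-1))\<close>: the kernel
  of the differential of the defining equations.
\<close>

definition tangent_space ::
  "nat \<Rightarrow> (nat \<Rightarrow> 'a::{linordered_field, linorder_topology}) set \<Rightarrow> nat \<Rightarrow>
     (nat \<Rightarrow> (nat \<Rightarrow> 'a) \<Rightarrow> 'a) \<Rightarrow> (nat \<Rightarrow> 'a) \<Rightarrow> 'a vec set" where
  "tangent_space n U l G x = {v \<in> carrier_vec n. jacobian n U l G x *\<^sub>v v = 0\<^sub>v l}"

text \<open>
  The differential at \<open>x\<close> of the restriction of \<open>F\<close> to the manifold is the restriction to the
  tangent space of the differential of \<open>F\<close>.
\<close>

definition singular_points ::
  "nat \<Rightarrow> (nat \<Rightarrow> 'a::{linordered_field, linorder_topology}) set \<Rightarrow> nat \<Rightarrow>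
     (nat \<Rightarrow> (nat \<Rightarrow> 'a) \<Rightarrow> 'a) \<Rightarrow> nat \<Rightarrow> (nat \<Rightarrow> (nat \<Rightarrow> 'a) \<Rightarrow> 'a) \<Rightarrow> (nat \<Rightarrow> 'a) set" where
  "singular_points n U l H m F =
     {x \<in> regular_zeroes n U l H.
        (\<lambda>v. jacobian n U m F x *\<^sub>v v) ` tangent_space n U l H x \<noteq> carrier_vec m}"

definition singular_values ::
  "nat \<Rightarrow> (nat \<Rightarrow> 'a::{linordered_field, linorder_topology}) set \<Rightarrow> nat \<Rightarrow>
     (nat \<Rightarrow> (nat \<Rightarrow> 'a) \<Rightarrow> 'a) \<Rightarrow> nat \<Rightarrow> (nat \<Rightarrow> (nat \<Rightarrow> 'a) \<Rightarrow> 'a) \<Rightarrow> (nat \<Rightarrow> 'a) set" where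
  "singular_values n U l H m F = (\<lambda>x. \<lambda>i\<in>{..<m}. F i x) ` singular_points n U l H m F"

end

theory Submission
  imports Defs
begin

text \<open>
  Let \<open>I\<close> range over the ideals of \<open>M\<close> containing the equations \<open>H\<close>. By Noetherian induction on \<open>I\<close>
  the singular points in the zero set of \<open>I\<close> have a definably meager image. A maximal
  counterexample \<open>I\<close> is prime. Fraction-free Gaussian elimination on the differentials, first of
  elements of \<open>I\<close> and then of the \<open>F i\<close>, with all pivots outside \<open>I\<close>, produces vector fields \<open>D j\<close>
  with coefficients in \<open>M\<close> that map \<open>I\<close> and all \<open>F i\<close> into \<open>I\<close>, and a product \<open>\<delta>\<close> of the pivots which is
  not in \<open>I\<close>. The part of the zero set where \<open>\<delta> = 0\<close> is handled by the ideal generated by \<open>I\<close> and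
  \<open>\<delta>\<close>. Where \<open>\<delta>\<close> does not vanish, either all \<open>F i\<close> are pivots and the map is a submersion, or some
  \<open>F i0\<close> is locally constant where the other \<open>F i\<close> are fixed: the derivatives of the generators of \<open>I\<close>
  along a curve tangent to the \<open>D j\<close> satisfy a homogeneous linear system, so the curve stays in the
  zero set of \<open>I\<close>, and there \<open>D j (F i0) = 0\<close>. Hence the image of a definably compact
  subset contains no box, since on it \<open>F i0\<close> would take a continuum of values over fixed values of
  the other coordinates.
\<close>

section \<open>Definability calculus\<close>

text \<open>Over \<open>K\<close> neither differential equations nor convergent iterations are
  available; the only source of new points is the supremum of a definable set. Two devices replace
  limits: an infimum of nonnegative values that can always be cut by a fixed factor must be 0, and a
  shrinking definable family of nonempty bounded sets has a cluster point. Therefore the fields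
  \<open>D j\<close> are never integrated: a curve is cut out by keeping all pivots constant, and
  the \<open>D j\<close> enter because they span the common kernel of the differentials of the
  pivots. A maximal counterexample is prime since \<open>a * b\<close> in \<open>I\<close> covers
  the zero set of \<open>I\<close> by the zero sets of two larger ideals; primeness in turn keeps
  the product \<open>\<delta>\<close> outside \<open>I\<close>. Pivots from \<open>I\<close> are
  exhausted first because this forces the remaining fields to preserve \<open>I\<close>; a pivot
  taken from \<open>F\<close> afterwards does not destroy this. Noetherianity is used twice, for the
  induction and for a finite set of generators, without which the linear system along a curve could
  be infinite with unbounded coefficients.\<close>

lemma tval_cong: "(\<And>i. i \<in> tvars t \<Longrightarrow> e i = e' i) \<Longrightarrow> tval S e t = tval S e' t"
proof (induction t)
  case (TFun f ts)
  then have "map (tval S e) ts = map (tval S e') ts" by auto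
  then show ?case by (simp only: tval.simps)
qed auto

lemma sat_cong: "(\<And>i. i \<in> fvars p \<Longrightarrow> e i = e' i) \<Longrightarrow> sat S e p \<longleftrightarrow> sat S e' p"
proof (induction p arbitrary: e e')
  case (FEq s t) then show ?case using tval_cong[of s e e' S] tval_cong[of t e e' S] by simp
next
  case (FLess s t) then show ?case using tval_cong[of s e e' S] tval_cong[of t e e' S] by simp
next
  case (FRel r ts)
  then have "map (tval S e) ts = map (tval S e') ts" by (intro map_cong refl tval_cong) auto
  then show ?case by (simp only: sat.simps)
next
  case (FNot p)
  have "sat S e p = sat S e' p" by (rule FNot.IH) (simp add: FNot.prems)
  then show ?case by simp
next
  case (FAnd p q)
  have "sat S e p = sat S e' p" by (rule FAnd.IH) (simp add: FAnd.prems)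
  moreover have "sat S e q = sat S e' q" by (rule FAnd.IH) (simp add: FAnd.prems)
  ultimately show ?case by simp
next
  case (FEx j p)
  have "sat S (e(j := a)) p = sat S (e'(j := a)) p" for a
    by (rule FEx.IH) (simp add: FEx.prems)
  then show ?case by simp
qed

lemma finite_tvars: "finite (tvars t)"
  by (induction t) auto

lemma finite_fvars: "finite (fvars p)"
  by (induction p) (auto simp: finite_tvars)

section \<open>Renaming of variables\<close>

primrec rename_term :: "(nat \<Rightarrow> nat) \<Rightarrow> ('f, 'a) fo_term \<Rightarrow> ('f, 'a) fo_term" where
  "rename_term r (TVar i) = TVar (r i)"
| "rename_term r (TPar c) = TPar c"
| "rename_term r (TNeg s) = TNeg (rename_term r s)"
| "rename_term r (TAdd s t) = TAdd (rename_term r s) (rename_term r t)"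
| "rename_term r (TMul s t) = TMul (rename_term r s) (rename_term r t)"
| "rename_term r (TFun f ts) = TFun f (map (rename_term r) ts)"

lemma tval_rename_term: "tval S e (rename_term r t) = tval S (\<lambda>i. e (r i)) t"
proof (induction t)
  case (TFun f ts)
  then have "map (tval S e) (map (rename_term r) ts) = map (tval S (\<lambda>i. e (r i))) ts" by simp
  then show ?case by (simp only: tval.simps rename_term.simps)
qed auto

text \<open>The renamed formula is only asserted to exist: \<open>r\<close> is arbitrary, so a free
  variable may be sent to the bound one, and every quantifier first receives a fresh
  variable.\<close>

lemma sat_rename: "\<exists>q. \<forall>e. sat S e q \<longleftrightarrow> sat S (\<lambda>i. e (r i)) p"
proof (induction p arbitrary: r)
  case (FEq s t) show ?case
    by (rule exI[of _ "FEq (rename_term r s) (rename_term r t)"]) (simp add: tval_rename_term)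
next
  case (FLess s t) show ?case
    by (rule exI[of _ "FLess (rename_term r s) (rename_term r t)"]) (simp add: tval_rename_term)
next
  case (FRel R ts)
  have "map (tval S e) (map (rename_term r) ts) = map (tval S (\<lambda>i. e (r i))) ts" for e
    by (simp add: tval_rename_term)
  then show ?case by (intro exI[of _ "FRel R (map (rename_term r) ts)"]) (simp only: sat.simps simp_thms)
next
  case (FNot p)
  from FNot.IH[of r] obtain q where q: "\<forall>e. sat S e q \<longleftrightarrow> sat S (\<lambda>i. e (r i)) p" ..
  show ?case by (intro exI[of _ "FNot q"]) (simp add: q)
next
  case (FAnd p1 p2)
  from FAnd.IH(1)[of r] obtain q1 where 1: "\<forall>e. sat S e q1 \<longleftrightarrow> sat S (\<lambda>i. e (r i)) p1" ..
  from FAnd.IH(2)[of r] obtain q2 where 2: "\<forall>e. sat S e q2 \<longleftrightarrow> sat S (\<lambda>i. e (r i)) p2" ..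
  show ?case by (intro exI[of _ "FAnd q1 q2"]) (simp add: 1 2)
next
  case (FEx j p)
  obtain k where k: "k \<notin> r ` fvars p"
    using ex_new_if_finite[OF infinite_UNIV_nat] finite_fvars by (metis finite_imageI)
  from FEx.IH[of "r(j := k)"]
  obtain q where q: "\<forall>e. sat S e q \<longleftrightarrow> sat S (\<lambda>i. e ((r(j := k)) i)) p" ..
  have "sat S (e(k := a)) q \<longleftrightarrow> sat S ((\<lambda>i. e (r i))(j := a)) p" for e a
    unfolding q[rule_format] by (rule sat_cong) (use k in auto)
  then show ?case by (intro exI[of _ "FEx k q"]) (simp del: fun_upd_apply)
qed

text \<open>Predicates on assignments take the place of formulas, so that closure under the logical
  operations can be stated as introduction rules and a concrete set is treated by
  \<open>intro definability\<close>. Bound variables follow de Bruijn: a binder makes its value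
  variable 0 and shifts all others up by one.\<close>

definition definable_pred ::
  "('f, 'r, 'a::linordered_field) expansion \<Rightarrow> ((nat \<Rightarrow> 'a) \<Rightarrow> bool) \<Rightarrow> bool" where
  "definable_pred S P \<longleftrightarrow> (\<exists>p. \<forall>e. sat S e p \<longleftrightarrow> P e)"

text \<open>Graph form: variable 0 holds the value and the arguments are shifted. It admits
  functions given by first-order conditions and not only by terms of the language.\<close>

definition definable_term ::
  "('f, 'r, 'a::linordered_field) expansion \<Rightarrow> ((nat \<Rightarrow> 'a) \<Rightarrow> 'a) \<Rightarrow> bool" where
  "definable_term S f \<longleftrightarrow> definable_pred S (\<lambda>e. e 0 = f (\<lambda>i. e (Suc i)))"

named_theorems definability

lemma definable_pred_rename:
  assumes "definable_pred S P" shows "definable_pred S (\<lambda>e. P (\<lambda>i. e (r i)))"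
proof -
  from assms obtain p where p: "\<forall>e. sat S e p \<longleftrightarrow> P e" by (auto simp: definable_pred_def)
  from sat_rename[of S r p] p show ?thesis by (auto simp: definable_pred_def)
qed

text \<open>Bounding the variables that matter makes fresh variables available, both for a
  quantifier and for the finite block behind a substitution.\<close>

lemma definable_pred_finite_support:
  assumes "definable_pred S P"
  obtains N where "\<And>e e'. (\<And>i. i < N \<Longrightarrow> e i = e' i) \<Longrightarrow> P e = P e'"
proof -
  from assms obtain p where p: "\<And>e. P e \<longleftrightarrow> sat S e p" by (auto simp: definable_pred_def)
  obtain N where "\<And>i. i \<in> fvars p \<Longrightarrow> i < N"
    using finite_fvars[of p] by (metis finite_nat_set_iff_bounded)
  then show ?thesis by (intro that[of N]) (simp only: p, rule sat_cong, blast)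
qed

lemma definable_pred_not [definability]:
  assumes "definable_pred S P" shows "definable_pred S (\<lambda>e. \<not> P e)"
proof -
  from assms obtain p where "\<forall>e. sat S e p \<longleftrightarrow> P e" by (auto simp: definable_pred_def)
  then show ?thesis unfolding definable_pred_def by (intro exI[of _ "FNot p"]) simp
qed

lemma definable_pred_conj [definability]:
  assumes "definable_pred S P" "definable_pred S Q"
  shows "definable_pred S (\<lambda>e. P e \<and> Q e)"
proof -
  from assms obtain p q where "\<forall>e. sat S e p \<longleftrightarrow> P e" "\<forall>e. sat S e q \<longleftrightarrow> Q e"
    by (auto simp: definable_pred_def)
  then show ?thesis unfolding definable_pred_def by (intro exI[of _ "FAnd p q"]) simp
qed

lemma definable_pred_disj [definability]:
  assumes "definable_pred S P" "definable_pred S Q"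
  shows "definable_pred S (\<lambda>e. P e \<or> Q e)"
proof -
  have "definable_pred S (\<lambda>e. \<not> (\<not> P e \<and> \<not> Q e))" by (intro definability assms)
  then show ?thesis by simp
qed

lemma definable_pred_imp [definability]:
  assumes "definable_pred S P" "definable_pred S Q"
  shows "definable_pred S (\<lambda>e. P e \<longrightarrow> Q e)"
proof -
  have "definable_pred S (\<lambda>e. \<not> P e \<or> Q e)" by (intro definability assms)
  then show ?thesis by simp
qed

lemma definable_pred_const [definability]: "definable_pred S (\<lambda>e. b)"
proof -
  have *: "definable_pred S (\<lambda>e. True)"
    unfolding definable_pred_def by (intro exI[of _ "FEq (TVar 0) (TVar 0)"]) simp
  show ?thesis
  proof (cases b)
    case True then show ?thesis using * by simp
  next
    case False then show ?thesis using definable_pred_not[OF *] by simp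
  qed
qed

lemma definable_pred_ex_case_nat:
  assumes "definable_pred S P"
  shows "definable_pred S (\<lambda>e. \<exists>a. P (case_nat a e))"
proof -
  obtain N where N: "\<And>e e'. (\<And>i. i < N \<Longrightarrow> e i = e' i) \<Longrightarrow> P e = P e'"
    using definable_pred_finite_support[OF assms] by blast
  \<comment> \<open>Variable 0 is read from the place \<open>N\<close> beyond the support and the
    others move down by one; overwriting place \<open>N\<close> then changes no other value on which
    \<open>P\<close> depends.\<close>
  have "definable_pred S (\<lambda>e. P (\<lambda>i. e (case_nat N id i)))"
    by (rule definable_pred_rename[OF assms])
  then obtain p where p: "\<forall>e. sat S e p \<longleftrightarrow> P (\<lambda>i. e (case_nat N id i))"
    by (auto simp: definable_pred_def)
  have "P (\<lambda>i. (e(N := a)) (case_nat N id i)) \<longleftrightarrow> P (case_nat a e)" for e a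
    by (rule N) (auto split: nat.split)
  then show ?thesis
    unfolding definable_pred_def using p by (intro exI[of _ "FEx N p"]) auto
qed

text \<open>The bound value and the assignment are separate arguments of \<open>Q\<close>, so that
  resolution can match an arbitrary body under a binder.\<close>

lemma definable_pred_ex [definability]:
  assumes "definable_pred S (\<lambda>e. Q (e 0) (\<lambda>i. e (Suc i)))"
  shows "definable_pred S (\<lambda>e. \<exists>a. Q a e)"
  using definable_pred_ex_case_nat[OF assms] by simp

lemma definable_pred_all [definability]:
  assumes "definable_pred S (\<lambda>e. Q (e 0) (\<lambda>i. e (Suc i)))"
  shows "definable_pred S (\<lambda>e. \<forall>a. Q a e)"
proof -
  have "definable_pred S (\<lambda>e. \<not> (\<exists>a. \<not> Q a e))" by (intro definability assms)
  then show ?thesis by simp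
qed

lemma definable_pred_ball_finite [definability]:
  assumes "finite A" "\<And>i. i \<in> A \<Longrightarrow> definable_pred S (P i)"
  shows "definable_pred S (\<lambda>e. \<forall>i\<in>A. P i e)"
  using assms by (induction A) (auto intro: definability)

lemma definable_pred_all_less [definability]:
  fixes n :: nat
  assumes "\<And>i. i < n \<Longrightarrow> definable_pred S (P i)"
  shows "definable_pred S (\<lambda>e. \<forall>i<n. P i e)"
proof -
  have "definable_pred S (\<lambda>e. \<forall>i\<in>{..<n}. P i e)"
    by (rule definable_pred_ball_finite) (auto intro: assms)
  then show ?thesis by (simp only: Ball_def lessThan_iff)
qed

text \<open>The length \<open>N\<close> of the quantifier block is a parameter here; this gives
  quantification over points of \<open>kspace n\<close> and simultaneous substitution.\<close>

lemma definable_pred_ex_vector: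
  assumes "definable_pred S P"
  shows "definable_pred S (\<lambda>e. \<exists>y. P (\<lambda>i. if i < N then y i else e (i - N)))"
  using assms
proof (induction N arbitrary: P)
  case 0 then show ?case by simp
next
  case (Suc N)
  define R where "R = (\<lambda>e. \<exists>y. P (\<lambda>i. if i < N then y i else e (i - N)))"
  have "definable_pred S R" unfolding R_def by (rule Suc.IH[OF Suc.prems])
  from definable_pred_ex_case_nat[OF this]
  have D: "definable_pred S (\<lambda>e. \<exists>a. R (case_nat a e))" .
  have "(\<exists>a. R (case_nat a e)) \<longleftrightarrow>
    (\<exists>y. P (\<lambda>i. if i < Suc N then y i else e (i - Suc N)))" for e
  proof -
    have eq: "(\<lambda>i. if i < N then y i else case_nat a e (i - N)) =
      (\<lambda>i. if i < Suc N then (y(N := a)) i else e (i - Suc N))" for y a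
    proof
      fix i
      consider "i < N" | "i = N" | k where "i = Suc N + k"
        by (metis Suc_leI le_Suc_ex linorder_neqE_nat)
      then show "(if i < N then y i else case_nat a e (i - N)) =
        (if i < Suc N then (y(N := a)) i else e (i - Suc N))"
        by cases (simp_all add: Suc_diff_le)
    qed
    have "R (case_nat a e) \<longleftrightarrow> (\<exists>y. P (\<lambda>i. if i < Suc N then (y(N := a)) i else e (i - Suc N)))" for a
      unfolding R_def eq ..
    then have "(\<exists>a. R (case_nat a e)) \<longleftrightarrow>
      (\<exists>a y. P (\<lambda>i. if i < Suc N then (y(N := a)) i else e (i - Suc N)))" by (simp only:)
    also have "\<dots> \<longleftrightarrow> (\<exists>y. P (\<lambda>i. if i < Suc N then y i else e (i - Suc N)))" (is "?L = (\<exists>y. ?Q y)")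
    proof
      assume ?L
      then obtain a y where "?Q (y(N := a))" by (elim exE)
      then show "\<exists>y. ?Q y" by (rule exI[where x = "y(N := a)"])
    next
      assume "\<exists>y. ?Q y"
      then obtain y where "?Q y" ..
      then have "?Q (y(N := y N))" by (simp only: fun_upd_triv)
      then have "\<exists>z. ?Q (z(N := y N))" by (rule exI[where x = y])
      then show ?L by (rule exI[where x = "y N"])
    qed
    finally show ?thesis .
  qed
  then have "(\<lambda>e. \<exists>a. R (case_nat a e)) =
    (\<lambda>e. \<exists>y. P (\<lambda>i. if i < Suc N then y i else e (i - Suc N)))" by (intro ext)
  with D show ?case by (rule back_subst)
qed

text \<open>Substituting \<open>f\<close> amounts to quantifying over the finitely many values that
  \<open>P\<close> can see: there is a \<open>y\<close> with \<open>y k = f k e\<close> for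
  \<open>k < N\<close> at which \<open>P\<close> holds.\<close>

lemma definable_pred_subst:
  assumes "definable_pred S P" "\<And>i. definable_term S (f i)"
  shows "definable_pred S (\<lambda>e. P (\<lambda>i. f i e))"
proof -
  obtain N where N: "\<And>e e'. (\<And>i. i < N \<Longrightarrow> e i = e' i) \<Longrightarrow> P e = P e'"
    using definable_pred_finite_support[OF assms(1)] by blast
  have *: "definable_pred S (\<lambda>e. e k = f k (\<lambda>i. e (i + N)))" for k
    using definable_pred_rename[OF assms(2)[of k, unfolded definable_term_def],
        of "case_nat k (\<lambda>i. i + N)"] by simp
  have "definable_pred S (\<lambda>e. (\<forall>k<N. e k = f k (\<lambda>i. e (i + N))) \<and> P e)"
    by (intro definability assms *)
  from definable_pred_ex_vector[OF this, of N]
  have "definable_pred S (\<lambda>e. \<exists>y. (\<forall>k<N. y k = f k e) \<and> P (\<lambda>i. if i < N then y i else e (i - N)))"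
    by (simp cong: conj_cong)
  moreover have "(\<exists>y. (\<forall>k<N. y k = f k e) \<and> P (\<lambda>i. if i < N then y i else e (i - N)))
    \<longleftrightarrow> P (\<lambda>i. f i e)" for e
  proof
    assume "\<exists>y. (\<forall>k<N. y k = f k e) \<and> P (\<lambda>i. if i < N then y i else e (i - N))"
    then obtain y where y: "\<forall>k<N. y k = f k e" "P (\<lambda>i. if i < N then y i else e (i - N))" by blast
    with N[of "\<lambda>i. if i < N then y i else e (i - N)" "\<lambda>i. f i e"] show "P (\<lambda>i. f i e)" by simp
  next
    assume "P (\<lambda>i. f i e)"
    then have "P (\<lambda>i. if i < N then f i e else e (i - N))"
      by (rule N[THEN iffD1, rotated]) simp
    then show "\<exists>y. (\<forall>k<N. y k = f k e) \<and> P (\<lambda>i. if i < N then y i else e (i - N))"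
      by (intro exI[of _ "\<lambda>k. f k e"]) simp
  qed
  ultimately show ?thesis by (simp only:)
qed

section \<open>Closure properties of definable terms\<close>

lemma definable_term_var [definability]: "definable_term S (\<lambda>e. e i)"
  unfolding definable_term_def definable_pred_def
  by (intro exI[of _ "FEq (TVar 0) (TVar (Suc i))"]) simp

lemma definable_term_const [definability]: "definable_term S (\<lambda>e. c)"
  unfolding definable_term_def definable_pred_def
  by (intro exI[of _ "FEq (TVar 0) (TPar c)"]) simp

lemma definable_pred_subst_nth:
  assumes "definable_pred S P" "\<forall>f\<in>set fs. definable_term S f"
  shows "definable_pred S (\<lambda>e. P (\<lambda>i. if i < length fs then (fs ! i) e else undefined))"
proof (rule definable_pred_subst[OF assms(1)])
  fix i show "definable_term S (\<lambda>e. if i < length fs then (fs ! i) e else undefined)"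
    using assms(2) by (cases "i < length fs") (auto intro: definability)
qed

lemma definable_pred_eq [definability]:
  assumes "definable_term S f" "definable_term S g"
  shows "definable_pred S (\<lambda>e. f e = g e)"
proof -
  have "definable_pred S (\<lambda>e. e 0 = e 1)"
    unfolding definable_pred_def by (intro exI[of _ "FEq (TVar 0) (TVar 1)"]) simp
  from definable_pred_subst_nth[OF this, of "[f, g]"] assms show ?thesis by simp
qed

lemma definable_pred_less [definability]:
  assumes "definable_term S f" "definable_term S g"
  shows "definable_pred S (\<lambda>e. f e < g e)"
proof -
  have "definable_pred S (\<lambda>e. e 0 < e 1)"
    unfolding definable_pred_def by (intro exI[of _ "FLess (TVar 0) (TVar 1)"]) simp
  from definable_pred_subst_nth[OF this, of "[f, g]"] assms show ?thesis by simp
qed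

lemma definable_pred_le [definability]:
  assumes "definable_term S f" "definable_term S g"
  shows "definable_pred S (\<lambda>e. f e \<le> g e)"
proof -
  have "definable_pred S (\<lambda>e. \<not> g e < f e)" by (intro definability assms)
  then show ?thesis by (simp add: not_less)
qed

lemma definable_term_shift:
  "definable_term S f \<Longrightarrow> definable_term S (\<lambda>e. f (\<lambda>i. e (r i)))"
  unfolding definable_term_def
  by (drule definable_pred_rename[where r = "case_nat 0 (\<lambda>i. Suc (r i))"]) simp

lemma definable_term_add [definability]:
  assumes "definable_term S f" "definable_term S g"
  shows "definable_term S (\<lambda>e. f e + g e)"
proof -
  have "definable_pred S (\<lambda>e. e 0 = e 1 + e 2)" unfolding definable_pred_def
    by (intro exI[of _ "FEq (TVar 0) (TAdd (TVar 1) (TVar 2))"]) simp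
  from definable_pred_subst_nth[OF this,
      of "[\<lambda>e. e 0, \<lambda>e. f (\<lambda>i. e (Suc i)), \<lambda>e. g (\<lambda>i. e (Suc i))]"]
  show ?thesis using assms
    by (simp add: definable_term_def[of _ "\<lambda>e. f e + g e"] definable_term_shift definable_term_var)
qed

lemma definable_term_mult [definability]:
  assumes "definable_term S f" "definable_term S g"
  shows "definable_term S (\<lambda>e. f e * g e)"
proof -
  have "definable_pred S (\<lambda>e. e 0 = e 1 * e 2)" unfolding definable_pred_def
    by (intro exI[of _ "FEq (TVar 0) (TMul (TVar 1) (TVar 2))"]) simp
  from definable_pred_subst_nth[OF this,
      of "[\<lambda>e. e 0, \<lambda>e. f (\<lambda>i. e (Suc i)), \<lambda>e. g (\<lambda>i. e (Suc i))]"]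
  show ?thesis using assms
    by (simp add: definable_term_def[of _ "\<lambda>e. f e * g e"] definable_term_shift definable_term_var)
qed

lemma definable_term_uminus [definability]:
  assumes "definable_term S f" shows "definable_term S (\<lambda>e. - f e)"
  using definable_term_mult[OF definable_term_const[of S "-1"] assms] by simp

lemma definable_term_diff [definability]:
  assumes "definable_term S f" "definable_term S g"
  shows "definable_term S (\<lambda>e. f e - g e)"
  using definable_term_add[OF assms(1) definable_term_uminus[OF assms(2)]] by simp

lemma definable_term_if [definability]:
  assumes "definable_pred S P" "definable_term S f" "definable_term S g"
  shows "definable_term S (\<lambda>e. if P e then f e else g e)"
proof -
  have "definable_pred S (\<lambda>e. (P (\<lambda>i. e (Suc i)) \<and> e 0 = f (\<lambda>i. e (Suc i))) \<or>
      (\<not> P (\<lambda>i. e (Suc i)) \<and> e 0 = g (\<lambda>i. e (Suc i))))"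
    by (intro definability definable_pred_rename[OF assms(1)] definable_term_shift[OF assms(2)]
        definable_term_shift[OF assms(3)])
  then show ?thesis unfolding definable_term_def
    by (rule back_subst) (rule arg_cong[where f = "definable_pred S"], rule ext, auto)
qed

lemma definable_term_abs [definability]:
  assumes "definable_term S f" shows "definable_term S (\<lambda>e. \<bar>f e\<bar>)"
  unfolding abs_if by (intro definability assms)

lemma definable_term_sum [definability]:
  assumes "\<And>i. i \<in> A \<Longrightarrow> definable_term S (f i)"
  shows "definable_term S (\<lambda>e. \<Sum>i\<in>A. f i e)"
  using assms by (induction A rule: infinite_finite_induct) (auto intro: definability)

section \<open>Points of affine space and quantifiers over them\<close>

definition definable_point ::
  "('f, 'r, 'a::linordered_field) expansion \<Rightarrow> nat \<Rightarrow> ((nat \<Rightarrow> 'a) \<Rightarrow> nat \<Rightarrow> 'a) \<Rightarrow> bool" where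
  "definable_point S n X \<longleftrightarrow> (\<forall>e. X e \<in> kspace n) \<and> (\<forall>i<n. definable_term S (\<lambda>e. X e i))"

lemma definable_point_restrict [definability]:
  assumes "\<And>i. i < n \<Longrightarrow> definable_term S (\<lambda>e. f e i)"
  shows "definable_point S n (\<lambda>e. restrict (f e) {..<n})"
  using assms unfolding definable_point_def by auto

lemma definable_point_const [definability]:
  "x \<in> kspace n \<Longrightarrow> definable_point S n (\<lambda>e. x)"
  unfolding definable_point_def by (auto intro: definability)

lemma definable_point_nth:
  "definable_point S n X \<Longrightarrow> i < n \<Longrightarrow> definable_term S (\<lambda>e. X e i)"
  unfolding definable_point_def by auto

lemma kspace_undefined: "x \<in> kspace n \<Longrightarrow> n \<le> i \<Longrightarrow> x i = undefined"
  by (auto simp: PiE_def extensional_def)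

lemma kspace_extI:
  assumes "x \<in> kspace n" "y \<in> kspace n" "\<And>i. i < n \<Longrightarrow> x i = y i" shows "x = y"
  by (rule PiE_ext[OF assms(1,2)]) (use assms(3) in auto)

lemma kspace_upd_inj:
  assumes "x(n := a) = y(n := b)" "x \<in> kspace n" "y \<in> kspace n" shows "x = y" "a = b"
proof -
  show "a = b" using fun_cong[OF assms(1), of n] by simp
  show "x = y"
  proof (rule kspace_extI[OF assms(2,3)])
    show "x i = y i" if "i < n" for i using fun_cong[OF assms(1), of i] that by simp
  qed
qed

lemma definable_pred_bex_kspace [definability]:
  assumes "definable_pred S (\<lambda>e. Q (restrict e {..<n}) (\<lambda>i. e (i + n)))"
  shows "definable_pred S (\<lambda>e. \<exists>x\<in>kspace n. Q x e)"
proof -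
  have "(\<exists>y. Q (restrict (\<lambda>i. if i < n then y i else e (i - n)) {..<n}) e) \<longleftrightarrow>
    (\<exists>x\<in>kspace n. Q x e)" for e
  proof
    assume "\<exists>y. Q (restrict (\<lambda>i. if i < n then y i else e (i - n)) {..<n}) e"
    then obtain y where "Q (restrict (\<lambda>i. if i < n then y i else e (i - n)) {..<n}) e" ..
    then show "\<exists>x\<in>kspace n. Q x e"
      by (rule bexI[where x = "restrict (\<lambda>i. if i < n then y i else e (i - n)) {..<n}"]) auto
  next
    assume "\<exists>x\<in>kspace n. Q x e"
    then obtain x where x: "x \<in> kspace n" "Q x e" by blast
    have "restrict (\<lambda>i. if i < n then x i else e (i - n)) {..<n} = x"
      using x by (intro kspace_extI[of _ n]) auto
    with x show "\<exists>y. Q (restrict (\<lambda>i. if i < n then y i else e (i - n)) {..<n}) e" by metis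
  qed
  with definable_pred_ex_vector[OF assms, of n] show ?thesis by simp
qed

lemma definable_pred_ball_kspace [definability]:
  assumes "definable_pred S (\<lambda>e. Q (restrict e {..<n}) (\<lambda>i. e (i + n)))"
  shows "definable_pred S (\<lambda>e. \<forall>x\<in>kspace n. Q x e)"
proof -
  have "definable_pred S (\<lambda>e. \<not> (\<exists>x\<in>kspace n. \<not> Q x e))" by (intro definability assms)
  then show ?thesis by simp
qed

text \<open>The bridge from sets given by formulas in the variables below \<open>n\<close> to the
  calculus of predicates; later sets and families are treated through it.\<close>

lemma definable_iff_definable_pred:
  fixes X :: "(nat \<Rightarrow> 'a::linordered_field) set"
  shows
  "definable S n X \<longleftrightarrow> X \<subseteq> kspace n \<and> definable_pred S (\<lambda>e. restrict e {..<n} \<in> X)"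
proof
  assume "definable S n X"
  then obtain p where p: "fvars p \<subseteq> {..<n}" "X = {x \<in> kspace n. sat S x p}"
    by (auto simp: definable_def)
  have "sat S (restrict e {..<n}) p \<longleftrightarrow> sat S e p" for e
    using p by (intro sat_cong) auto
  then show "X \<subseteq> kspace n \<and> definable_pred S (\<lambda>e. restrict e {..<n} \<in> X)"
    unfolding definable_pred_def using p by auto
next
  assume "X \<subseteq> kspace n \<and> definable_pred S (\<lambda>e. restrict e {..<n} \<in> X)"
  then obtain p where X: "X \<subseteq> kspace n" and p: "\<And>e. sat S e p \<longleftrightarrow> restrict e {..<n} \<in> X"
    by (auto simp: definable_pred_def)
  \<comment> \<open>Variables beyond \<open>n\<close> may occur in \<open>p\<close>; they are bound by quantifiers.\<close>
  have "\<exists>q. fvars q = fvars p - A \<and> (\<forall>e. sat S e q \<longleftrightarrow> restrict e {..<n} \<in> X)"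
    if "finite A" "A \<inter> {..<n} = {}" for A
    using that
  proof (induction A)
    case empty show ?case by (intro exI[of _ p]) (simp only: Diff_empty p simp_thms)
  next
    case (insert a A)
    have "\<exists>q. fvars q = fvars p - A \<and> (\<forall>e. sat S e q \<longleftrightarrow> restrict e {..<n} \<in> X)"
      by (rule insert.IH) (use insert.hyps insert.prems in auto)
    then obtain q where q: "fvars q = fvars p - A" "\<And>e. sat S e q \<longleftrightarrow> restrict e {..<n} \<in> X"
      by (elim exE conjE) (rule that, assumption, erule spec)
    have *: "restrict (e(a := b)) {..<n} = restrict e {..<n}" for e :: "nat \<Rightarrow> 'a" and b
      using insert.prems by (auto simp: restrict_def)
    show ?case
    proof (intro exI[of _ "FEx a q"] conjI allI)
      show "fvars (FEx a q) = fvars p - insert a A" using q(1) by auto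
      show "sat S e (FEx a q) \<longleftrightarrow> restrict e {..<n} \<in> X" for e
        by (simp only: sat.simps q(2) * simp_thms)
    qed
  qed
  from this[of "fvars p - {..<n}"] obtain q where
    q: "fvars q \<subseteq> {..<n}" "\<And>e. sat S e q \<longleftrightarrow> restrict e {..<n} \<in> X"
    using finite_fvars[of p] by auto
  have "X = {x \<in> kspace n. sat S x q}" using X q(2) by (auto simp: PiE_restrict)
  with q(1) show "definable S n X" unfolding definable_def by blast
qed

lemma definable_pred_mem [definability]:
  assumes "definable S n A" "definable_point S n X"
  shows "definable_pred S (\<lambda>e. X e \<in> A)"
proof -
  have "definable_pred S (\<lambda>e. restrict e {..<n} \<in> A)"
    using assms(1) by (simp add: definable_iff_definable_pred)
  then have "definable_pred S (\<lambda>e. restrict (\<lambda>i. if i < n then X e i else undefined) {..<n} \<in> A)"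
  proof (rule definable_pred_subst)
    show "definable_term S (\<lambda>e. if i < n then X e i else undefined)" for i
      using assms(2) by (cases "i < n") (auto intro: definability definable_point_nth)
  qed
  moreover have "restrict (\<lambda>i. if i < n then X e i else undefined) {..<n} = X e" for e
    using assms(2) by (intro kspace_extI[of _ n]) (auto simp: definable_point_def)
  ultimately show ?thesis by (simp only:)
qed

lemma definableI:
  assumes "\<And>x. x \<in> X \<longleftrightarrow> x \<in> kspace n \<and> P x"
    "definable_pred S (\<lambda>e. P (restrict e {..<n}))"
  shows "definable S n X"
  using assms by (auto simp: definable_iff_definable_pred)

lemma definable_fun_term:
  fixes f :: "(nat \<Rightarrow> 'a::linordered_field) \<Rightarrow> 'a"
  assumes f: "definable_fun S n U f" "f \<in> extensional U" and X: "definable_point S n X"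
  shows "definable_term S (\<lambda>e. f (X e))"
proof -
  let ?G = "{x(n := f x) | x. x \<in> U}"
  note U = f(1)[unfolded definable_fun_def, THEN conjunct1]
    and G = f(1)[unfolded definable_fun_def, THEN conjunct2]
  define P where "P e a \<longleftrightarrow> restrict (\<lambda>i. if i < n then X e i else a) {..<Suc n} \<in> ?G" for e a
  have eq: "restrict (\<lambda>i. if i < n then x i else a) {..<Suc n} = x(n := a)" if "x \<in> kspace n" for x a
    using kspace_undefined[OF that] by (auto simp: fun_eq_iff)
  have P: "P e a \<longleftrightarrow> X e \<in> U \<and> a = f (X e)" for e a
  proof -
    have "X e \<in> kspace n" using X by (auto simp: definable_point_def)
    then have "P e a \<longleftrightarrow> (X e)(n := a) \<in> ?G" unfolding P_def by (simp only: eq)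
    also have "\<dots> \<longleftrightarrow> X e \<in> U \<and> a = f (X e)"
    proof
      assume "(X e)(n := a) \<in> ?G"
      then obtain x where x: "(X e)(n := a) = x(n := f x)" "x \<in> U" by blast
      from kspace_upd_inj[OF x(1) \<open>X e \<in> kspace n\<close> subsetD[OF U x(2)]] x(2)
      show "X e \<in> U \<and> a = f (X e)" by simp
    qed blast
    finally show ?thesis .
  qed
  have *: "definable_term S (\<lambda>e. X (\<lambda>i. e (Suc i)) i)" if "i < n" for i
    using definable_term_shift[OF definable_point_nth[OF X that]] by simp
  have 1: "definable_pred S (\<lambda>e. P (\<lambda>i. e (Suc i)) (e 0))" unfolding P_def
  proof (intro definable_pred_mem[OF G] definable_point_restrict)
    show "definable_term S (\<lambda>e. if i < n then X (\<lambda>i. e (Suc i)) i else e 0)" for i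
      using * by (cases "i < n") (simp_all add: definable_term_var)
  qed
  have 2: "definable_pred S (\<lambda>e. \<exists>a. P (\<lambda>i. e (Suc i)) a)"
  proof (rule definable_pred_ex)
    show "definable_pred S (\<lambda>e. P (\<lambda>i. e (Suc (Suc i))) (e 0))"
      using definable_pred_rename[OF 1, of "case_nat 0 (\<lambda>i. Suc (Suc i))"] by simp
  qed
  \<comment> \<open>Outside \<open>U\<close> the extensional \<open>f\<close> has the value
    \<open>undefined\<close>, which is an ordinary element of the field and hence a parameter. This
    second branch makes the graph total.\<close>
  have "definable_pred S (\<lambda>e. P (\<lambda>i. e (Suc i)) (e 0) \<or>
      \<not> (\<exists>a. P (\<lambda>i. e (Suc i)) a) \<and> e 0 = undefined)"
    by (intro definability 1 2)
  then show ?thesis unfolding definable_term_def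
    by (rule back_subst) (rule arg_cong[where f = "definable_pred S"], rule ext, use f(2) in \<open>auto simp: P extensional_def\<close>)
qed

section \<open>Definable analysis\<close>

text \<open>The element \<open>a\<close> and the bound \<open>b\<close> rule out both infinite
  values, so the supremum lies in the field.\<close>

lemma definable_sup:
  fixes S :: "('f, 'r, 'a::linordered_field) expansion"
  assumes dc: "definably_complete S" and P: "definable_pred S (\<lambda>e. P (e 0))"
    and a: "P a" and b: "\<And>a. P a \<Longrightarrow> a \<le> b"
  obtains s where "\<And>a. P a \<Longrightarrow> a \<le> s" "\<And>u. (\<And>a. P a \<Longrightarrow> a \<le> u) \<Longrightarrow> s \<le> u"
proof -
  let ?X = "{x \<in> kspace 1. P (x 0)}"
  have "definable S 1 ?X"
    by (rule definableI[where P = "\<lambda>x. P (x 0)"]) (use P in simp_all)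
  from dc[unfolded definably_complete_def, THEN spec, THEN mp, OF this]
  obtain s where s: "\<forall>x\<in>?X. Fin (x 0) \<le> s" "\<forall>u. (\<forall>x\<in>?X. Fin (x 0) \<le> u) \<longrightarrow> s \<le> u"
    by (elim exE conjE)
  have s1: "Fin c \<le> s" if "P c" for c
    using bspec[OF s(1), of "restrict (\<lambda>_. c) {..<1}"] that by simp
  have "\<forall>x\<in>?X. Fin (x 0) \<le> Fin b" using b by simp
  then have "s \<le> Fin b" by (rule s(2)[THEN spec, THEN mp])
  with s1[OF a] obtain s' where s': "s = Fin s'" by (cases s) auto
  show ?thesis
  proof (rule that)
    show "c \<le> s'" if "P c" for c using s1[OF that] s' by simp
    show "s' \<le> u" if "\<And>a. P a \<Longrightarrow> a \<le> u" for u
      using s(2)[THEN spec, of "Fin u"] that s' by simp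
  qed
qed

text \<open>Continuous induction along the interval: at the supremum of the points up to which the
  estimate holds, the local estimate first gives the estimate there and then pushes it further
  unless \<open>b\<close> is reached.\<close>

lemma definable_lipschitz_strict:
  fixes S :: "('f, 'r, 'a::linordered_field) expansion"
  assumes dc: "definably_complete S" and f: "definable_term S (\<lambda>e. f (e 0))"
    and "a \<le> b" "0 \<le> c"
    and loc: "\<And>s. a \<le> s \<Longrightarrow> s \<le> b \<Longrightarrow>
      \<exists>d>0. \<forall>r. a \<le> r \<longrightarrow> r \<le> b \<longrightarrow> \<bar>r - s\<bar> < d \<longrightarrow> \<bar>f r - f s\<bar> \<le> c * \<bar>r - s\<bar>"
  shows "\<bar>f b - f a\<bar> \<le> c * (b - a)"
proof -
  define P where "P s \<longleftrightarrow> a \<le> s \<and> s \<le> b \<and> (\<forall>r. a \<le> r \<and> r \<le> s \<longrightarrow> \<bar>f r - f a\<bar> \<le> c * (r - a))" for s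
  have fi: "definable_term S (\<lambda>e. f (e i))" for i
    using definable_term_shift[OF f, of "\<lambda>_. i"] .
  have "definable_pred S (\<lambda>e. P (e 0))" unfolding P_def by (intro definability fi)
  moreover have Pa: "P a" using \<open>a \<le> b\<close> by (auto simp: P_def)
  ultimately obtain s where s: "\<And>a. P a \<Longrightarrow> a \<le> s" "\<And>u. (\<And>a. P a \<Longrightarrow> a \<le> u) \<Longrightarrow> s \<le> u"
    using definable_sup[OF dc, of P a b] by (auto simp: P_def)
  have "a \<le> s" using s(1)[OF Pa] .
  moreover have "s \<le> b" by (rule s(2)) (auto simp: P_def)
  ultimately obtain d where d: "d > 0"
    "\<And>r. a \<le> r \<Longrightarrow> r \<le> b \<Longrightarrow> \<bar>r - s\<bar> < d \<Longrightarrow> \<bar>f r - f s\<bar> \<le> c * \<bar>r - s\<bar>"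
    using loc by blast
  have below: "\<bar>f r - f a\<bar> \<le> c * (r - a)" if r: "a \<le> r" "r < s" for r
  proof -
    obtain q where "P q" "r < q" using s(2)[of r] r(2) by (meson not_le)
    then show ?thesis using r by (auto simp: P_def)
  qed
  have at: "\<bar>f s - f a\<bar> \<le> c * (s - a)"
  proof (cases "s = a")
    case False
    \<comment> \<open>A point of the interval below \<open>s\<close> and within \<open>d\<close> of
      it: the bound known below \<open>s\<close> and the local bound at \<open>s\<close> meet
      there.\<close>
    define r where "r = max a (s - d / 2)"
    have r: "a \<le> r" "r < s" "r \<le> b" "\<bar>r - s\<bar> < d"
      using False \<open>a \<le> s\<close> \<open>s \<le> b\<close> d(1) by (auto simp: r_def max_def abs_if field_simps)
    have "\<bar>f s - f a\<bar> \<le> \<bar>f r - f s\<bar> + \<bar>f r - f a\<bar>" by linarith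
    also have "\<dots> \<le> c * \<bar>r - s\<bar> + c * (r - a)" using d(2)[of r] below[of r] r by auto
    also have "\<dots> = c * (s - a)" using r by (simp add: abs_if algebra_simps)
    finally show ?thesis .
  qed simp
  have above: "\<bar>f r - f a\<bar> \<le> c * (r - a)" if "s \<le> r" "r \<le> b" "r < s + d" for r
  proof -
    have "\<bar>f r - f a\<bar> \<le> \<bar>f r - f s\<bar> + \<bar>f s - f a\<bar>" by linarith
    also have "\<dots> \<le> c * \<bar>r - s\<bar> + c * (s - a)" using d(2)[of r] at that \<open>a \<le> s\<close> by auto
    also have "\<dots> = c * (r - a)" using that by (simp add: abs_if algebra_simps)
    finally show ?thesis .
  qed
  have half: "min b (s + d / 2) < s + d" using d(1) by (simp add: min_def field_simps)
  have "P (min b (s + d / 2))"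
    unfolding P_def
  proof (intro conjI allI impI)
    show "a \<le> min b (s + d / 2)" using \<open>a \<le> b\<close> \<open>a \<le> s\<close> d(1) by auto
    fix r assume r: "a \<le> r \<and> r \<le> min b (s + d / 2)"
    then show "\<bar>f r - f a\<bar> \<le> c * (r - a)"
      using below[of r] above[of r] half by (cases "r < s") auto
  qed simp
  then have "min b (s + d / 2) \<le> s" by (rule s(1))
  with d(1) have "b \<le> s" by (auto simp: min_def split: if_splits)
  with at \<open>s \<le> b\<close> show ?thesis by auto
qed

text \<open>A substitute for the mean value theorem.\<close>

lemma definable_lipschitz:
  fixes S :: "('f, 'r, 'a::linordered_field) expansion"
  assumes dc: "definably_complete S" and f: "definable_term S (\<lambda>e. f (e 0))"
    and "a \<le> b" "0 \<le> c"
    and loc: "\<And>s \<epsilon>. a \<le> s \<Longrightarrow> s \<le> b \<Longrightarrow> 0 < \<epsilon> \<Longrightarrow>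
      \<exists>d>0. \<forall>r. a \<le> r \<longrightarrow> r \<le> b \<longrightarrow> \<bar>r - s\<bar> < d \<longrightarrow> \<bar>f r - f s\<bar> \<le> (c + \<epsilon>) * \<bar>r - s\<bar>"
  shows "\<bar>f b - f a\<bar> \<le> c * (b - a)"
proof (rule field_le_epsilon)
  fix \<epsilon> :: 'a assume "0 < \<epsilon>"
  \<comment> \<open>The summand 1 keeps the denominator positive when \<open>a = b\<close>.\<close>
  define \<eta> where "\<eta> = \<epsilon> / (b - a + 1)"
  have \<eta>: "0 < \<eta>" "\<eta> * (b - a) \<le> \<epsilon>"
    using \<open>0 < \<epsilon>\<close> \<open>a \<le> b\<close> by (auto simp: \<eta>_def field_simps)
  have "\<bar>f b - f a\<bar> \<le> (c + \<eta>) * (b - a)"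
    using \<eta>(1) assms by (intro definable_lipschitz_strict[OF dc f]) auto
  then show "\<bar>f b - f a\<bar> \<le> c * (b - a) + \<epsilon>" using \<eta>(2) by (simp add: algebra_simps)
qed

text \<open>With the sum norm, distances over complementary sets of coordinates add up exactly,
  which suits both changing one coordinate at a time and splitting into dependent and free
  coordinates.\<close>

definition l1dist :: "nat \<Rightarrow> (nat \<Rightarrow> 'a::linordered_field) \<Rightarrow> (nat \<Rightarrow> 'a) \<Rightarrow> 'a" where
  "l1dist n x y = (\<Sum>i<n. \<bar>x i - y i\<bar>)"

lemma l1dist_nonneg [simp]: "0 \<le> l1dist n x y"
  by (auto simp: l1dist_def intro: sum_nonneg)

lemma l1dist_self [simp]: "l1dist n x x = 0"
  by (simp add: l1dist_def)

lemma l1dist_commute: "l1dist n x y = l1dist n y x"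
  by (simp add: l1dist_def abs_minus_commute)

lemma l1dist_triangle: "l1dist n x z \<le> l1dist n x y + l1dist n y z"
  unfolding l1dist_def sum.distrib[symmetric] by (rule sum_mono) linarith

lemma abs_le_l1dist: "i < n \<Longrightarrow> \<bar>x i - y i\<bar> \<le> l1dist n x y"
  unfolding l1dist_def by (rule member_le_sum) auto

text \<open>\<open>Suc n\<close> instead of \<open>n\<close> avoids division by 0 in dimension 0 and
  leaves room for the strict inequality.\<close>

lemma l1dist_less_if:
  fixes \<epsilon> :: "'a::linordered_field"
  assumes "0 < \<epsilon>" "\<And>i. i < n \<Longrightarrow> \<bar>x i - y i\<bar> < \<epsilon> / of_nat (Suc n)"
  shows "l1dist n x y < \<epsilon>"
proof -
  have "l1dist n x y \<le> (\<Sum>i<n. \<epsilon> / of_nat (Suc n))"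
    unfolding l1dist_def by (rule sum_mono) (use assms in \<open>auto intro: less_imp_le\<close>)
  also have "\<dots> = \<epsilon> * (of_nat n / of_nat (Suc n))" by simp
  also have "\<dots> < \<epsilon> * 1"
  proof (rule mult_strict_left_mono[OF _ assms(1)])
    have "(0::'a) < of_nat (Suc n)" "(of_nat n :: 'a) < of_nat (Suc n)"
      by (simp_all only: of_nat_less_iff of_nat_0_less_iff lessI zero_less_Suc)
    then show "(of_nat n :: 'a) / of_nat (Suc n) < 1" by (simp only: divide_less_eq_1_pos)
  qed
  finally show ?thesis by simp
qed

lemma l1dist_upd:
  assumes "i < n" shows "l1dist n (x(i := a)) y \<le> l1dist n x y + \<bar>a - x i\<bar>"
proof -
  have "l1dist n (x(i := a)) x = (\<Sum>j<n. if j = i then \<bar>a - x i\<bar> else 0)"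
    unfolding l1dist_def by (rule sum.cong) auto
  also have "\<dots> = \<bar>a - x i\<bar>" using assms by simp
  finally show ?thesis using l1dist_triangle[of n "x(i := a)" y x] by simp
qed

lemma l1dist_eq_0D:
  assumes "l1dist n x y = 0" "x \<in> kspace n" "y \<in> kspace n" shows "x = y"
  using assms(2,3)
proof (rule kspace_extI)
  show "x i = y i" if "i < n" for i using abs_le_l1dist[OF that, of x y] assms(1) by simp
qed

lemma definable_term_l1dist [definability]:
  assumes "definable_point S n X" "definable_point S n Y"
  shows "definable_term S (\<lambda>e. l1dist n (X e) (Y e))"
  unfolding l1dist_def using assms
  by (intro definable_term_sum definable_term_abs definable_term_diff definable_point_nth) auto

text \<open>This plays the role of compactness of closed bounded sets.\<close>

lemma definable_compactness:
  fixes S :: "('f, 'r, 'a::linordered_field) expansion"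
  assumes dc: "definably_complete S"
    and "definable_pred S (\<lambda>e. restrict e {..<n} \<in> X (e n))"
    and "\<And>t. X t \<subseteq> kspace n" "\<And>t. 0 < t \<Longrightarrow> X t \<noteq> {}"
    and "\<And>s t. 0 < s \<Longrightarrow> s \<le> t \<Longrightarrow> X s \<subseteq> X t"
    and "\<And>t x i. x \<in> X t \<Longrightarrow> i < n \<Longrightarrow> \<bar>x i\<bar> \<le> C"
  obtains x where "x \<in> kspace n" "\<And>t \<epsilon>. 0 < t \<Longrightarrow> 0 < \<epsilon> \<Longrightarrow> \<exists>y\<in>X t. l1dist n y x < \<epsilon>"
proof -
  have "\<exists>x\<in>kspace n. \<forall>t \<epsilon>. 0 < t \<longrightarrow> 0 < \<epsilon> \<longrightarrow> (\<exists>y\<in>X t. l1dist n y x < \<epsilon>)"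
    using assms(2-)
  proof (induction n arbitrary: X)
    case 0
    then show ?case
      by (intro bexI[of _ "\<lambda>_. undefined"]) (auto simp: l1dist_def ex_in_conv)
  next
    case (Suc n)
    note D0 = Suc.prems(1) and sub = Suc.prems(2) and ne = Suc.prems(3)
      and mono = Suc.prems(4) and bd = Suc.prems(5)
    have D: "definable_pred S (\<lambda>e. (restrict (\<lambda>i. e (r i)) {..<n})(n := e p) \<in> X (e q))" for r p q
    proof -
      have eq: "restrict (\<lambda>i. e (if i < n then r i else if i = n then p else q)) {..<Suc n}
        = (restrict (\<lambda>i. e (r i)) {..<n})(n := e p)" for e :: "nat \<Rightarrow> 'a"
        by (auto simp: fun_eq_iff)
      have q: "(if Suc n < n then r (Suc n) else if Suc n = n then p else q) = q" by simp
      from definable_pred_rename[OF D0, of "\<lambda>i. if i < n then r i else if i = n then p else q"]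
      show ?thesis by (simp only: eq q)
    qed
    \<comment> \<open>Projection to the first \<open>n\<close> coordinates; the induction hypothesis
      gives it a cluster point \<open>y\<close>.\<close>
    define Y where "Y t = {y \<in> kspace n. \<exists>a. y(n := a) \<in> X t}" for t
    have YI: "restrict x {..<n} \<in> Y t" "(restrict x {..<n})(n := x n) = x" if "x \<in> X t" for x t
    proof -
      show *: "(restrict x {..<n})(n := x n) = x"
        using subsetD[OF sub that] kspace_undefined[of x "Suc n"] by (auto simp: fun_eq_iff)
      show "restrict x {..<n} \<in> Y t" using * that by (auto simp: Y_def intro!: exI[of _ "x n"])
    qed
    have Ybd: "\<bar>y i\<bar> \<le> C" if "y \<in> Y t" "i < n" for y t i
    proof -
      have "\<exists>a. y(n := a) \<in> X t" using that by (auto simp: Y_def)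
      then obtain a where "y(n := a) \<in> X t" ..
      from bd[OF this, of i] that show ?thesis by simp
    qed
    have "\<exists>y\<in>kspace n. \<forall>t \<epsilon>. 0 < t \<longrightarrow> 0 < \<epsilon> \<longrightarrow> (\<exists>z\<in>Y t. l1dist n z y < \<epsilon>)"
    proof (rule Suc.IH)
      have "definable_pred S (\<lambda>e. \<exists>a. (restrict e {..<n})(n := a) \<in> X (e n))"
        by (rule definable_pred_ex) (rule D)
      then show "definable_pred S (\<lambda>e. restrict e {..<n} \<in> Y (e n))"
        by (simp add: Y_def)
      show "Y t \<subseteq> kspace n" for t by (auto simp: Y_def)
      show "Y t \<noteq> {}" if "0 < t" for t using ne[OF that] YI by blast
      show "Y s \<subseteq> Y t" if "0 < s" "s \<le> t" for s t using mono[OF that] by (auto simp: Y_def)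
      show "\<bar>x i\<bar> \<le> C" if "x \<in> Y t" "i < n" for t x i using Ybd that .
    qed
    then obtain y where y: "y \<in> kspace n"
      "\<And>t \<epsilon>. 0 < t \<Longrightarrow> 0 < \<epsilon> \<Longrightarrow> \<exists>z\<in>Y t. l1dist n z y < \<epsilon>" by blast
    define Z where "Z t a \<longleftrightarrow> (\<exists>z\<in>kspace n. z(n := a) \<in> X t \<and> l1dist n z y < t)" for t a
    \<comment> \<open>\<open>Q c\<close> says that eventually, as \<open>t\<close> tends to 0, all
      last coordinates over points near \<open>y\<close> are at least \<open>c\<close>. The supremum
      \<open>b\<close> of such \<open>c\<close> is the limit inferior of the last
      coordinates.\<close>
    define Q where "Q c \<longleftrightarrow> (\<exists>t. 0 < t \<and> (\<forall>a. Z t a \<longrightarrow> c \<le> a))" for c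
    have Zne: "\<exists>a. Z t a" if "0 < t" for t
      using y(2)[OF that that] by (auto simp: Z_def Y_def)
    have Zbd: "\<bar>a\<bar> \<le> C" if Z: "Z t a" for t a
    proof -
      obtain z where "z(n := a) \<in> X t" using Z by (auto simp: Z_def)
      from bd[OF this, of n] show ?thesis by simp
    qed
    have Zmono: "Z t a" if "Z s a" "0 < s" "s \<le> t" for s t a
      using that mono[OF that(2,3)] unfolding Z_def by (meson less_le_trans subsetD)
    have "definable_pred S (\<lambda>e. Q (e 0))"
      unfolding Q_def Z_def
      by (intro definability D D[where r = "\<lambda>i. i"] y(1))
    moreover have "Q (- C)"
      unfolding Q_def using Zbd by (intro exI[of _ 1]) (auto simp: abs_le_iff, force)
    moreover have "c \<le> C" if "Q c" for c
      using that Zne Zbd unfolding Q_def by (meson abs_le_D1 order_trans)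
    ultimately obtain b where b: "\<And>c. Q c \<Longrightarrow> c \<le> b" "\<And>u. (\<And>c. Q c \<Longrightarrow> c \<le> u) \<Longrightarrow> b \<le> u"
      using definable_sup[OF dc, of Q "- C" C] by blast
    show ?case
    proof (rule bexI[of _ "y(n := b)"], intro allI impI)
      show "y(n := b) \<in> kspace (Suc n)" using y(1) by (auto simp: PiE_def extensional_def Pi_def)
      fix t \<epsilon> :: 'a assume "0 < t" "0 < \<epsilon>"
      obtain c where c: "Q c" "b - \<epsilon> / 2 < c" using b(2)[of "b - \<epsilon> / 2"] \<open>0 < \<epsilon>\<close> by force
      then obtain t' where t': "0 < t'" "\<And>a. Z t' a \<Longrightarrow> c \<le> a" by (auto simp: Q_def)
      \<comment> \<open>Up to \<open>t'\<close> all last coordinates are at least \<open>c\<close>,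
        up to \<open>t\<close> the point lies in \<open>X t\<close>, and up to half of
        \<open>\<epsilon>\<close> the first coordinates use only half of the allowed distance. Since
        \<open>b + \<epsilon> / 2\<close> does not satisfy \<open>Q\<close>, some last coordinate at
        \<open>s\<close> stays below it.\<close>
      define s where "s = min (min t t') (\<epsilon> / 2)"
      have s: "0 < s" "s \<le> t" "s \<le> t'" "s \<le> \<epsilon> / 2" using \<open>0 < t\<close> \<open>0 < \<epsilon>\<close> t'(1) by (auto simp: s_def)
      have "\<not> Q (b + \<epsilon> / 2)" using b(1)[of "b + \<epsilon> / 2"] \<open>0 < \<epsilon>\<close> by auto
      then obtain a where a: "Z s a" "a < b + \<epsilon> / 2" using s(1) by (auto simp: Q_def not_le)
      have "c \<le> a" using t'(2) Zmono[OF a(1) s(1,3)] .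
      with a(2) c(2) have ab: "\<bar>a - b\<bar> < \<epsilon> / 2" unfolding abs_less_iff by linarith
      from a(1) obtain z where z: "z \<in> kspace n" "z(n := a) \<in> X s" "l1dist n z y < s"
        by (auto simp: Z_def)
      have "l1dist (Suc n) (z(n := a)) (y(n := b)) = l1dist n z y + \<bar>a - b\<bar>"
        by (simp add: l1dist_def)
      also have "\<dots> < \<epsilon> / 2 + \<epsilon> / 2" using z(3) s(4) ab by (intro add_strict_mono) auto
      finally show "\<exists>x\<in>X t. l1dist (Suc n) x (y(n := b)) < \<epsilon>"
        using z(2) mono[OF s(1,2)] by auto
    qed
  qed
  then show ?thesis using that by blast
qed

text \<open>Radii are handled through the filter \<open>at_right 0\<close>: finitely many smallness
  conditions combine by \<open>eventually_conj\<close> and \<open>eventually_ball_finite\<close>,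
  and one common radius is extracted at the end.\<close>

lemma eventually_small:
  fixes P :: "'a::{linordered_field, linorder_topology} \<Rightarrow> bool"
  assumes "eventually P (at_right 0)" obtains \<rho> where "0 < \<rho>" "P \<rho>"
proof -
  obtain b where "b > 0" "\<forall>y>0. y < b \<longrightarrow> P y"
    using assms unfolding eventually_at_right_field by blast
  then show ?thesis using that[of "b / 2"] by simp
qed

lemma eventually_smallI:
  fixes b :: "'a::{linordered_field, linorder_topology}"
  assumes "0 < b" "\<And>y. 0 < y \<Longrightarrow> y \<le> b \<Longrightarrow> P y"
  shows "eventually P (at_right 0)"
  unfolding eventually_at_right_field using assms by (intro exI[of _ b]) auto

section \<open>The order topology in terms of distances\<close>

lemma open_interval:
  fixes A :: "'a::{linordered_field, linorder_topology} set"
  assumes "open A" "x \<in> A"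
  obtains \<epsilon> where "0 < \<epsilon>" "\<And>y. \<bar>y - x\<bar> < \<epsilon> \<Longrightarrow> y \<in> A"
proof -
  obtain b where b: "b > x" "{x..<b} \<subseteq> A" using open_right[OF assms, of "x + 1"] by auto
  obtain c where c: "c < x" "{c<..x} \<subseteq> A" using open_left[OF assms, of "x - 1"] by auto
  show ?thesis
  proof (rule that[of "min (b - x) (x - c)"])
    show "0 < min (b - x) (x - c)" using b c by simp
    fix y assume "\<bar>y - x\<bar> < min (b - x) (x - c)"
    then have "y < b" "c < y" by (auto simp: abs_less_iff)
    then show "y \<in> A" using b c by (cases "x \<le> y") auto
  qed
qed

lemma topspace_ptop [simp]: "topspace (ptop n) = kspace n"
  by (simp add: ptop_def)

lemma openin_ptop_l1dist:
  fixes A :: "(nat \<Rightarrow> 'a::{linordered_field, linorder_topology}) set"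
  assumes "openin (ptop n) A" "x \<in> A"
  obtains \<epsilon> where "0 < \<epsilon>" "\<And>y. y \<in> kspace n \<Longrightarrow> l1dist n y x < \<epsilon> \<Longrightarrow> y \<in> A"
proof -
  obtain V where V: "\<And>i. i < n \<Longrightarrow> open (V i)" "x \<in> Pi\<^sub>E {..<n} V" "Pi\<^sub>E {..<n} V \<subseteq> A"
  proof -
    have "\<exists>V. (\<forall>i\<in>{..<n}. open (V i)) \<and> x \<in> Pi\<^sub>E {..<n} V \<and> Pi\<^sub>E {..<n} V \<subseteq> A"
      using assms unfolding ptop_def openin_product_topology_alt by (auto simp: open_openin[symmetric])
    then show thesis using that by auto
  qed
  have "eventually (\<lambda>\<epsilon>. \<forall>i\<in>{..<n}. \<forall>y. \<bar>y - x i\<bar> < \<epsilon> \<longrightarrow> y \<in> V i) (at_right 0)"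
  proof (intro eventually_ball_finite ballI)
    fix i assume i: "i \<in> {..<n}"
    then obtain \<epsilon> where "0 < \<epsilon>" "\<And>y. \<bar>y - x i\<bar> < \<epsilon> \<Longrightarrow> y \<in> V i"
      using open_interval[of "V i" "x i"] V(1)[of i] V(2) by auto
    then show "eventually (\<lambda>\<epsilon>. \<forall>y. \<bar>y - x i\<bar> < \<epsilon> \<longrightarrow> y \<in> V i) (at_right 0)"
      by (intro eventually_smallI[of \<epsilon>]) auto
  qed simp
  then obtain \<epsilon> where e: "0 < \<epsilon>" "\<And>i y. i < n \<Longrightarrow> \<bar>y - x i\<bar> < \<epsilon> \<Longrightarrow> y \<in> V i"
    by (elim eventually_small) auto
  show ?thesis
  proof (rule that[OF e(1)])
    fix y assume y: "y \<in> kspace n" "l1dist n y x < \<epsilon>"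
    have "y i \<in> V i" if "i < n" for i
      using e(2)[OF that] abs_le_l1dist[OF that, of y x] y(2) by auto
    then have "y \<in> Pi\<^sub>E {..<n} V" using y(1) by (auto simp: PiE_def)
    with V(3) show "y \<in> A" by blast
  qed
qed

lemma continuous_map_l1dist:
  fixes f :: "(nat \<Rightarrow> 'a::{linordered_field, linorder_topology}) \<Rightarrow> 'a"
  assumes "continuous_map (subtopology (ptop n) U) euclidean f" "openin (ptop n) U" "x \<in> U" "0 < \<epsilon>"
  obtains d where "0 < d" "\<And>y. y \<in> kspace n \<Longrightarrow> l1dist n y x < d \<Longrightarrow> y \<in> U \<and> \<bar>f y - f x\<bar> < \<epsilon>"
proof -
  have U: "U \<subseteq> kspace n" using openin_subset[OF assms(2)] by simp
  then have ts: "topspace (subtopology (ptop n) U) = U" by auto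
  let ?A = "{y \<in> U. f y \<in> {f x - \<epsilon> <..< f x + \<epsilon>}}"
  have "openin (subtopology (ptop n) U) ?A"
    using openin_continuous_map_preimage[OF assms(1), of "{f x - \<epsilon> <..< f x + \<epsilon>}"]
    unfolding ts by (simp add: open_openin[symmetric])
  then have "openin (ptop n) ?A" using openin_trans_full[OF _ assms(2)] by blast
  moreover have "x \<in> ?A" using assms by simp
  ultimately obtain d where d: "0 < d" "\<And>y. y \<in> kspace n \<Longrightarrow> l1dist n y x < d \<Longrightarrow> y \<in> ?A"
    by (rule openin_ptop_l1dist) (rule that)
  show ?thesis
  proof (rule that[OF d(1)])
    fix y assume "y \<in> kspace n" "l1dist n y x < d"
    then have "y \<in> ?A" by (rule d(2))
    then show "y \<in> U \<and> \<bar>f y - f x\<bar> < \<epsilon>" by (simp add: abs_less_iff algebra_simps)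
  qed
qed

text \<open>\<open>closed\<close> makes \<open>A\<close> its own closure, and \<open>thin\<close>
  then leaves no interior point.\<close>

lemma nowhere_dense_inI:
  fixes A :: "(nat \<Rightarrow> 'a::{linordered_field, linorder_topology}) set"
  assumes A: "A \<subseteq> kspace m"
    and closed: "\<And>z. z \<in> kspace m \<Longrightarrow> (\<And>\<epsilon>. 0 < \<epsilon> \<Longrightarrow> \<exists>y\<in>A. l1dist m y z < \<epsilon>) \<Longrightarrow> z \<in> A"
    and thin: "\<And>z \<epsilon>. z \<in> A \<Longrightarrow> 0 < \<epsilon> \<Longrightarrow> \<exists>y\<in>kspace m. l1dist m y z < \<epsilon> \<and> y \<notin> A"
  shows "nowhere_dense_in m (kspace m) A"
proof -
  have st: "subtopology (ptop m) (kspace m) = (ptop m :: (nat \<Rightarrow> 'a) topology)"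
    using subtopology_topspace[of "ptop m"] by simp
  have "ptop m closure_of A \<subseteq> A"
  proof
    fix z assume z: "z \<in> ptop m closure_of A"
    then have zk: "z \<in> kspace m" using closure_of_subset_topspace[of "ptop m" A] by auto
    show "z \<in> A"
    proof (rule closed[OF zk])
      fix \<epsilon> :: 'a assume "0 < \<epsilon>"
      define \<eta> where "\<eta> = \<epsilon> / of_nat (Suc m)"
      have "0 < \<eta>" using \<open>0 < \<epsilon>\<close> by (simp add: \<eta>_def del: of_nat_Suc)
      let ?B = "Pi\<^sub>E {..<m} (\<lambda>i. {z i - \<eta> <..< z i + \<eta>})"
      have "openin (ptop m) ?B" unfolding ptop_def
        by (subst openin_PiE) (auto simp: open_openin[symmetric])
      moreover have "z \<in> ?B" using zk \<open>0 < \<eta>\<close> by (auto simp: PiE_def)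
      ultimately obtain y where y: "y \<in> A" "y \<in> ?B" using z by (auto simp: in_closure_of)
      have "l1dist m y z < \<epsilon>"
        by (rule l1dist_less_if[OF \<open>0 < \<epsilon>\<close>])
          (use y(2) in \<open>auto simp: \<eta>_def[symmetric] abs_less_iff PiE_def Pi_def algebra_simps simp del: of_nat_Suc\<close>)
      with y(1) show "\<exists>y\<in>A. l1dist m y z < \<epsilon>" by blast
    qed
  qed
  moreover have "ptop m interior_of A = {}"
  proof (rule ccontr)
    assume "ptop m interior_of A \<noteq> {}"
    then obtain z where z: "z \<in> ptop m interior_of A" by blast
    obtain \<epsilon> where "0 < \<epsilon>" "\<And>y. y \<in> kspace m \<Longrightarrow> l1dist m y z < \<epsilon> \<Longrightarrow> y \<in> ptop m interior_of A"
      by (rule openin_ptop_l1dist[OF openin_interior_of z]) (rule that)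
    then show False using thin[of z \<epsilon>] z interior_of_subset[of "ptop m" A] by blast
  qed
  ultimately show ?thesis
    unfolding nowhere_dense_in_def st using A interior_of_mono[of "ptop m closure_of A" A "ptop m"]
    by auto
qed

lemma definable_point_upd [definability]:
  assumes "definable_point S n X" "definable_term S a" "i < n"
  shows "definable_point S n (\<lambda>e. (X e)(i := a e))"
proof -
  have "definable_term S (\<lambda>e. ((X e)(i := a e)) j)" if "j < n" for j
    using assms definable_point_nth[OF assms(1) that] by (cases "j = i") simp_all
  moreover have "(X e)(i := a e) \<in> kspace n" for e
    using assms(1,3) by (auto simp: definable_point_def PiE_def extensional_def)
  ultimately show ?thesis by (simp add: definable_point_def)
qed

lemma definable_term_restrict [definability]:
  assumes "definable_term S (\<lambda>e. f e i)"
  shows "definable_term S (\<lambda>e. restrict (f e) A i)"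
  using assms by (cases "i \<in> A") (simp_all add: definable_term_const)

text \<open>Halving shows that 0 is not isolated; uniqueness of limits, hence of partial
  derivatives, rests on this.\<close>

lemma at_0_neq_bot: "at (0::'a::{linordered_field, linorder_topology}) \<noteq> bot"
proof
  assume "at (0::'a) = bot"
  then have "open {0::'a}" by (simp add: at_eq_bot_iff)
  then obtain \<epsilon> :: 'a where e: "0 < \<epsilon>" "\<And>y. \<bar>y - 0\<bar> < \<epsilon> \<Longrightarrow> y \<in> {0}"
    by (rule open_interval[OF _ singletonI]) (rule that)
  from e(2)[of "\<epsilon> / 2"] e(1) show False by simp
qed

lemma has_partial_unique:
  assumes "has_partial f i x D" "has_partial f i x D'" shows "D = D'"
  using tendsto_unique[OF at_0_neq_bot] assms unfolding has_partial_def by blast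

text \<open>Multiplied out, the difference quotient makes sense for \<open>h = 0\<close> too and can
  be fed into Lipschitz estimates.\<close>

lemma has_partialD:
  assumes "has_partial f i x D" "0 < \<epsilon>"
  obtains d where "0 < d" "\<And>h. \<bar>h\<bar> < d \<Longrightarrow> \<bar>f (x(i := x i + h)) - f x - D * h\<bar> \<le> \<epsilon> * \<bar>h\<bar>"
proof -
  define q where "q h = (f (x(i := x i + h)) - f x) / h" for h
  have q: "(q \<longlongrightarrow> D) (at 0)" using assms(1) unfolding has_partial_def q_def .
  have "eventually (\<lambda>h. D - \<epsilon> < q h \<and> q h < D + \<epsilon>) (at 0)"
    using assms(2) by (intro eventually_conj order_tendstoD[OF q]) simp_all
  then obtain A where A: "open A" "0 \<in> A" "\<And>h. h \<in> A \<Longrightarrow> h \<noteq> 0 \<Longrightarrow> D - \<epsilon> < q h \<and> q h < D + \<epsilon>"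
    unfolding eventually_at_topological by auto
  obtain d where d: "0 < d" "\<And>y. \<bar>y - 0\<bar> < d \<Longrightarrow> y \<in> A"
    by (rule open_interval[OF A(1,2)]) (rule that)
  show ?thesis
  proof (rule that[OF d(1)])
    fix h assume h: "\<bar>h\<bar> < d"
    show "\<bar>f (x(i := x i + h)) - f x - D * h\<bar> \<le> \<epsilon> * \<bar>h\<bar>"
    proof (cases "h = 0")
      case False
      have "\<bar>q h - D\<bar> \<le> \<epsilon>" using A(3)[OF d(2) False] h by (simp add: abs_le_iff algebra_simps less_imp_le)
      then have "\<bar>q h - D\<bar> * \<bar>h\<bar> \<le> \<epsilon> * \<bar>h\<bar>" by (rule mult_right_mono) simp
      moreover have "f (x(i := x i + h)) - f x - D * h = (q h - D) * h"
        using False by (simp add: q_def field_simps)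
      ultimately show ?thesis by (simp add: abs_mult)
    qed simp
  qed
qed

section \<open>Strict differentiability of the functions in \<open>M\<close>\<close>

locale definable_differential_ring =
  fixes S :: "('f, 'r, 'a::{linordered_field, linorder_topology}) expansion"
    and n :: nat and U :: "(nat \<Rightarrow> 'a) set" and M :: "((nat \<Rightarrow> 'a) \<Rightarrow> 'a) set"
  assumes dc: "definably_complete S"
    and U_open: "openin (ptop n) U"
    and M: "noetherian_differential_ring S n U M"
begin

lemma U_kspace: "U \<subseteq> kspace n"
  using openin_subset[OF U_open] by simp

lemma M_smooth: "f \<in> M \<Longrightarrow> f \<in> smooth_definable S n U"
  using M subgroup.subset[OF subring.axioms(1)]
  unfolding noetherian_differential_ring_def by (fastforce simp: smooth_ring_def)

lemma M_extensional: "f \<in> M \<Longrightarrow> f \<in> extensional U"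
  using M_smooth by (simp add: smooth_definable_def)

lemma M_partial: "f \<in> M \<Longrightarrow> i < n \<Longrightarrow> partial U i f \<in> M"
  using M by (simp add: noetherian_differential_ring_def)

lemma M_definable:
  assumes "f \<in> M" "definable_point S n X" shows "definable_term S (\<lambda>e. f (X e))"
  using M_smooth[OF assms(1)] assms(2) by (auto simp: smooth_definable_def intro: definable_fun_term)

lemma M_continuous:
  assumes "f \<in> M" "x \<in> U" "0 < \<epsilon>"
  obtains d where "0 < d" "\<And>y. y \<in> kspace n \<Longrightarrow> l1dist n y x < d \<Longrightarrow> y \<in> U \<and> \<bar>f y - f x\<bar> < \<epsilon>"
proof -
  have "smooth_upto n U 0 f" using M_smooth[OF assms(1)] unfolding smooth_definable_def by blast
  then have "continuous_map (subtopology (ptop n) U) euclidean f" by simp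
  then show ?thesis using continuous_map_l1dist[OF _ U_open assms(2,3)] that by metis
qed

lemma M_has_partial:
  assumes "f \<in> M" "i < n" "x \<in> U" shows "has_partial f i x (partial U i f x)"
proof -
  have "smooth_upto n U (Suc 0) f" using M_smooth[OF assms(1)] unfolding smooth_definable_def by blast
  then obtain D where D: "has_partial f i x D" using assms by auto
  then have "has_partial f i x (THE D. has_partial f i x D)"
    by (rule theI) (rule has_partial_unique[OF _ D])
  then show ?thesis using assms(3) by (simp add: partial_def)
qed

text \<open>The coordinates are changed one at a time.\<close>

lemma strict_derivative:
  assumes f: "f \<in> M" and p: "p \<in> U" and \<epsilon>: "0 < \<epsilon>"
  obtains \<rho> where "0 < \<rho>"
    "\<And>x x'. x \<in> kspace n \<Longrightarrow> x' \<in> kspace n \<Longrightarrow> l1dist n x p < \<rho> \<Longrightarrow> l1dist n x' p < \<rho> \<Longrightarrow>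
      \<bar>f x' - f x - (\<Sum>i<n. partial U i f p * (x' i - x i))\<bar> \<le> \<epsilon> * l1dist n x' x"
proof -
  have "eventually (\<lambda>\<rho>. \<forall>y\<in>kspace n. l1dist n y p < \<rho> \<longrightarrow> y \<in> U) (at_right 0)"
  proof -
    obtain d where "0 < d" "\<And>y. y \<in> kspace n \<Longrightarrow> l1dist n y p < d \<Longrightarrow> y \<in> U"
      by (rule openin_ptop_l1dist[OF U_open p]) (rule that)
    then show ?thesis by (intro eventually_smallI[of d]) auto
  qed
  moreover have "eventually (\<lambda>\<rho>. \<forall>i\<in>{..<n}. \<forall>y\<in>kspace n. l1dist n y p < \<rho> \<longrightarrow>
      \<bar>partial U i f y - partial U i f p\<bar> \<le> \<epsilon>) (at_right 0)"
  proof (rule eventually_ball_finite[OF finite_lessThan], rule ballI)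
    fix i assume "i \<in> {..<n}"
    then obtain d where "0 < d"
      "\<And>y. y \<in> kspace n \<Longrightarrow> l1dist n y p < d \<Longrightarrow> y \<in> U \<and> \<bar>partial U i f y - partial U i f p\<bar> < \<epsilon>"
      using M_continuous[OF M_partial[OF f] p \<epsilon>, of i] by (metis lessThan_iff)
    then show "eventually (\<lambda>\<rho>. \<forall>y\<in>kspace n. l1dist n y p < \<rho> \<longrightarrow>
      \<bar>partial U i f y - partial U i f p\<bar> \<le> \<epsilon>) (at_right 0)"
      by (intro eventually_smallI[of d]) (auto intro: less_imp_le)
  qed
  ultimately have "eventually (\<lambda>\<rho>. (\<forall>y\<in>kspace n. l1dist n y p < \<rho> \<longrightarrow> y \<in> U) \<and>
    (\<forall>i\<in>{..<n}. \<forall>y\<in>kspace n. l1dist n y p < \<rho> \<longrightarrow>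
      \<bar>partial U i f y - partial U i f p\<bar> \<le> \<epsilon>)) (at_right 0)" by (rule eventually_conj)
  then obtain \<rho> where \<rho>: "0 < \<rho>" and C: "(\<forall>y\<in>kspace n. l1dist n y p < \<rho> \<longrightarrow> y \<in> U) \<and>
    (\<forall>i\<in>{..<n}. \<forall>y\<in>kspace n. l1dist n y p < \<rho> \<longrightarrow>
      \<bar>partial U i f y - partial U i f p\<bar> \<le> \<epsilon>)"
    by (rule eventually_small) (rule that)
  have inU: "y \<in> U" if "y \<in> kspace n" "l1dist n y p < \<rho>" for y
    using conjunct1[OF C] that by blast
  have small: "\<bar>partial U i f y - partial U i f p\<bar> \<le> \<epsilon>"
    if "i < n" "y \<in> kspace n" "l1dist n y p < \<rho>" for i y
    using conjunct2[OF C] that by blast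
  \<comment> \<open>Half the radius: the distance of an intermediate point from \<open>p\<close> is
    at most the sum of the distances of \<open>x\<close> and \<open>x'\<close> from
    \<open>p\<close>.\<close>
  show ?thesis
  proof (rule that[of "\<rho> / 2"])
    show "0 < \<rho> / 2" using \<rho> by simp
    fix x x' assume x: "x \<in> kspace n" "x' \<in> kspace n" "l1dist n x p < \<rho> / 2" "l1dist n x' p < \<rho> / 2"
    \<comment> \<open>The first \<open>k\<close> coordinates come from \<open>x'\<close>, the others
      from \<open>x\<close>, so the difference of the values telescopes from \<open>z 0 = x\<close>
      to \<open>z n = x'\<close>.\<close>
    define z where "z k = (\<lambda>i. if i < k then x' i else x i)" for k
    have zk: "z k \<in> kspace n" if "k \<le> n" for k
      using x(1,2) that by (auto simp: z_def PiE_def extensional_def)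
    have step: "\<bar>f (z (Suc k)) - f (z k) - partial U k f p * (x' k - x k)\<bar> \<le> \<epsilon> * \<bar>x' k - x k\<bar>"
      if k: "k < n" for k
    proof -
      define y where "y s = (z k)(k := s)" for s
      \<comment> \<open>Subtracting the linear part at \<open>p\<close> leaves a function whose
        derivative is at most \<open>\<epsilon>\<close> in absolute value, by continuity of the
        partial derivative.\<close>
      define \<phi> where "\<phi> s = f (y s) - partial U k f p * s" for s
      define a b where "a = min (x k) (x' k)" and "b = max (x k) (x' k)"
      have "a \<le> b" by (simp add: a_def b_def)
      have "definable_term S (\<lambda>e. \<phi> (e 0))"
        unfolding \<phi>_def y_def using k zk[of k] by (intro definability M_definable[OF f]) auto
      then have "\<bar>\<phi> b - \<phi> a\<bar> \<le> \<epsilon> * (b - a)"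
      proof (rule definable_lipschitz[OF dc _ \<open>a \<le> b\<close> less_imp_le[OF \<epsilon>]])
        fix s \<eta> :: 'a assume s: "a \<le> s" "s \<le> b" and \<eta>: "0 < \<eta>"
        have yk: "y s \<in> kspace n" using zk[of k] k by (auto simp: y_def PiE_def extensional_def)
        have "l1dist n (y s) p \<le> (\<Sum>i<n. \<bar>x i - p i\<bar> + \<bar>x' i - p i\<bar>)"
          unfolding l1dist_def
        proof (rule sum_mono)
          fix i
          show "\<bar>y s i - p i\<bar> \<le> \<bar>x i - p i\<bar> + \<bar>x' i - p i\<bar>"
            using s by (cases "i = k") (auto simp: y_def z_def a_def b_def min_def max_def split: if_splits)
        qed
        also have "\<dots> = l1dist n x p + l1dist n x' p" by (simp add: l1dist_def sum.distrib)
        also have "\<dots> < \<rho>" using x(3,4) by simp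
        finally have yb: "l1dist n (y s) p < \<rho>" .
        note D = small[OF k yk yb]
        obtain d where d: "0 < d" "\<And>h. \<bar>h\<bar> < d \<Longrightarrow>
            \<bar>f ((y s)(k := y s k + h)) - f (y s) - partial U k f (y s) * h\<bar> \<le> \<eta> * \<bar>h\<bar>"
          by (rule has_partialD[OF M_has_partial[OF f k inU[OF yk yb]] \<eta>]) (rule that)
        show "\<exists>d>0. \<forall>r. a \<le> r \<longrightarrow> r \<le> b \<longrightarrow> \<bar>r - s\<bar> < d \<longrightarrow> \<bar>\<phi> r - \<phi> s\<bar> \<le> (\<epsilon> + \<eta>) * \<bar>r - s\<bar>"
        proof (intro exI[of _ d] conjI allI impI d(1))
          fix r assume "\<bar>r - s\<bar> < d"
          from d(2)[OF this]
          have 1: "\<bar>f (y r) - f (y s) - partial U k f (y s) * (r - s)\<bar> \<le> \<eta> * \<bar>r - s\<bar>"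
            by (simp add: y_def)
          have 2: "\<bar>(partial U k f (y s) - partial U k f p) * (r - s)\<bar> \<le> \<epsilon> * \<bar>r - s\<bar>"
            unfolding abs_mult using D by (rule mult_right_mono) simp
          have eq: "\<phi> r - \<phi> s = (f (y r) - f (y s) - partial U k f (y s) * (r - s)) +
            (partial U k f (y s) - partial U k f p) * (r - s)"
            by (simp add: \<phi>_def algebra_simps)
          have "\<bar>\<phi> r - \<phi> s\<bar> \<le> \<eta> * \<bar>r - s\<bar> + \<epsilon> * \<bar>r - s\<bar>"
            unfolding eq by (rule order_trans[OF abs_triangle_ineq add_mono[OF 1 2]])
          then show "\<bar>\<phi> r - \<phi> s\<bar> \<le> (\<epsilon> + \<eta>) * \<bar>r - s\<bar>" by (simp add: algebra_simps)
        qed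
      qed
      then have "\<bar>\<phi> (x' k) - \<phi> (x k)\<bar> \<le> \<epsilon> * \<bar>x' k - x k\<bar>"
        by (cases "x k \<le> x' k") (simp_all add: a_def b_def min_def max_def abs_minus_commute)
      moreover have "y (x' k) = z (Suc k)" "y (x k) = z k"
        by (auto simp: y_def z_def fun_eq_iff less_Suc_eq)
      ultimately show ?thesis by (simp add: \<phi>_def algebra_simps)
    qed
    have "z 0 = x" by (simp add: z_def)
    moreover have "z n = x'" using x(1,2) by (intro kspace_extI[of _ n] zk) (auto simp: z_def)
    ultimately have "f x' - f x = (\<Sum>k<n. f (z (Suc k)) - f (z k))"
      using sum_lessThan_telescope[of "\<lambda>k. f (z k)" n] by simp
    then have "f x' - f x - (\<Sum>i<n. partial U i f p * (x' i - x i)) =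
      (\<Sum>k<n. f (z (Suc k)) - f (z k) - partial U k f p * (x' k - x k))"
      by (simp add: sum_subtractf)
    also have "\<bar>\<dots>\<bar> \<le> (\<Sum>k<n. \<epsilon> * \<bar>x' k - x k\<bar>)"
      by (rule order_trans[OF sum_abs sum_mono]) (use step in simp)
    also have "\<dots> = \<epsilon> * l1dist n x' x" by (simp add: l1dist_def sum_distrib_left)
    finally show "\<bar>f x' - f x - (\<Sum>i<n. partial U i f p * (x' i - x i))\<bar> \<le> \<epsilon> * l1dist n x' x" .
  qed
qed

end

text \<open>The coordinates in \<open>J\<close> are free and run along a segment, those in
  \<open>B\<close> are determined by \<open>g = 0\<close>. The Lipschitz constant \<open>L\<close>
  later converts errors in the distance of points into errors in the parameter.\<close>

definition level_curve :: "('f, 'r, 'a::linordered_field) expansion \<Rightarrow> nat \<Rightarrow> nat set \<Rightarrow> nat set \<Rightarrow>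
    (nat \<Rightarrow> (nat \<Rightarrow> 'a) \<Rightarrow> 'a) \<Rightarrow> (nat \<Rightarrow> 'a) \<Rightarrow> (nat \<Rightarrow> 'a) \<Rightarrow> 'a \<Rightarrow> 'a \<Rightarrow> ('a \<Rightarrow> nat \<Rightarrow> 'a) \<Rightarrow> bool" where
  "level_curve S n B J g x0 x1 \<rho> L \<gamma> \<longleftrightarrow> definable_point S n (\<lambda>e. \<gamma> (e 0)) \<and> \<gamma> 0 = x0 \<and> \<gamma> 1 = x1 \<and>
     (\<forall>t. 0 \<le> t \<longrightarrow> t \<le> 1 \<longrightarrow> l1dist n (\<gamma> t) x0 < \<rho> \<and> (\<forall>b\<in>B. g b (\<gamma> t) = 0) \<and>
       (\<forall>j\<in>J. \<gamma> t j = x0 j + t * (x1 j - x0 j))) \<and>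
     (\<forall>s t. 0 \<le> s \<longrightarrow> s \<le> 1 \<longrightarrow> 0 \<le> t \<longrightarrow> t \<le> 1 \<longrightarrow>
       l1dist n (\<gamma> s) (\<gamma> t) \<le> L * \<bar>s - t\<bar>)"

text \<open>
  The derivative of \<open>g\<close> in the directions of \<open>B\<close> is close to the identity. The points of the curve
  exist because a step \<open>z \<mapsto> z - g z\<close> in these directions quarters \<open>g\<close>, so the infimum of \<open>g\<close> over a
  box vanishes.
\<close>

lemma implicit_curve:
  fixes S :: "('f, 'r, 'a::linordered_field) expansion"
    and g :: "nat \<Rightarrow> (nat \<Rightarrow> 'a) \<Rightarrow> 'a" and c :: "nat \<Rightarrow> nat \<Rightarrow> 'a"
  assumes dc: "definably_complete S"
    and BJ: "B \<union> J = {..<n}" "B \<inter> J = {}"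
    and gdef: "\<And>b X. b \<in> B \<Longrightarrow> definable_point S n X \<Longrightarrow> definable_term S (\<lambda>e. g b (X e))"
    and x0: "x0 \<in> kspace n" and \<rho>: "0 < \<rho>" and \<kappa>: "0 \<le> \<kappa>" "of_nat (card B) * \<kappa> \<le> 1 / 4"
    and strict: "\<And>b x x'. b \<in> B \<Longrightarrow> x \<in> kspace n \<Longrightarrow> x' \<in> kspace n \<Longrightarrow>
      l1dist n x x0 < \<rho> \<Longrightarrow> l1dist n x' x0 < \<rho> \<Longrightarrow>
      \<bar>g b x' - g b x - (x' b - x b) - (\<Sum>j\<in>J. c b j * (x' j - x j))\<bar> \<le> \<kappa> * l1dist n x' x"
    and g0: "\<And>b. b \<in> B \<Longrightarrow> g b x0 = 0"
  obtains \<rho>' L where "0 < \<rho>'" "0 \<le> L"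
    "\<And>x1. x1 \<in> kspace n \<Longrightarrow> l1dist n x1 x0 < \<rho>' \<Longrightarrow> (\<forall>b\<in>B. g b x1 = 0) \<Longrightarrow>
      \<exists>\<gamma>. level_curve S n B J g x0 x1 \<rho> L \<gamma>"
proof -
  define dB dJ where "dB x y = (\<Sum>b\<in>B. \<bar>x b - y b\<bar>)" and "dJ x y = (\<Sum>j\<in>J. \<bar>x j - y j\<bar>)"
    for x y :: "nat \<Rightarrow> 'a"
  have fin: "finite B" "finite J" using BJ(1) finite_lessThan[of n] by (metis finite_Un)+
  have Bn: "b < n" if "b \<in> B" for b using BJ(1) that by auto
  have Jn: "j < n" if "j \<in> J" for j using BJ(1) that by auto
  have dsum: "l1dist n x y = dB x y + dJ x y" for x y :: "nat \<Rightarrow> 'a"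
    unfolding l1dist_def dB_def dJ_def BJ(1)[symmetric] using fin BJ(2) by (rule sum.union_disjoint)
  have dnn: "0 \<le> dB x y" "0 \<le> dJ x y" for x y :: "nat \<Rightarrow> 'a"
    by (simp_all add: dB_def dJ_def sum_nonneg)
  define C where "C = (\<Sum>b\<in>B. \<Sum>j\<in>J. \<bar>c b j\<bar>)"
  have C: "0 \<le> C" by (simp add: C_def sum_nonneg)
  define N where "N z = (\<Sum>b\<in>B. \<bar>g b z\<bar>)" for z
  \<comment> \<open>The hypothesis on \<open>\<kappa>\<close> makes the errors of all
    \<open>b \<in> B\<close> together at most a quarter of the distance.\<close>
  have est: "(\<Sum>b\<in>B. \<bar>g b x' - g b x - (x' b - x b)\<bar>) \<le> C * dJ x' x + l1dist n x' x / 4"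
    if x: "x \<in> kspace n" "x' \<in> kspace n" "l1dist n x x0 < \<rho>" "l1dist n x' x0 < \<rho>" for x x'
  proof -
    have "(\<Sum>b\<in>B. \<bar>g b x' - g b x - (x' b - x b)\<bar>)
      \<le> (\<Sum>b\<in>B. (\<Sum>j\<in>J. \<bar>c b j\<bar>) * dJ x' x + \<kappa> * l1dist n x' x)"
    proof (rule sum_mono)
      fix b assume b: "b \<in> B"
      have "\<bar>\<Sum>j\<in>J. c b j * (x' j - x j)\<bar> \<le> (\<Sum>j\<in>J. \<bar>c b j\<bar> * \<bar>x' j - x j\<bar>)"
        using sum_abs[of "\<lambda>j. c b j * (x' j - x j)" J] by (simp only: abs_mult)
      also have "\<dots> \<le> (\<Sum>j\<in>J. \<bar>c b j\<bar> * dJ x' x)"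
      proof (rule sum_mono)
        fix j assume "j \<in> J"
        then have "\<bar>x' j - x j\<bar> \<le> dJ x' x"
          unfolding dJ_def by (intro member_le_sum[of j J "\<lambda>j. \<bar>x' j - x j\<bar>"]) (use fin in auto)
        then show "\<bar>c b j\<bar> * \<bar>x' j - x j\<bar> \<le> \<bar>c b j\<bar> * dJ x' x"
          by (rule mult_left_mono) simp
      qed
      also have "\<dots> = (\<Sum>j\<in>J. \<bar>c b j\<bar>) * dJ x' x" by (simp only: sum_distrib_right)
      finally have 1: "\<bar>\<Sum>j\<in>J. c b j * (x' j - x j)\<bar> \<le> (\<Sum>j\<in>J. \<bar>c b j\<bar>) * dJ x' x" .
      have "\<bar>p\<bar> \<le> r + q" if "\<bar>p - s\<bar> \<le> q" "\<bar>s\<bar> \<le> r" for p q r s :: 'a using that by linarith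
      from this[OF strict[OF b x] 1]
      show "\<bar>g b x' - g b x - (x' b - x b)\<bar> \<le> (\<Sum>j\<in>J. \<bar>c b j\<bar>) * dJ x' x + \<kappa> * l1dist n x' x" .
    qed
    also have "\<dots> = C * dJ x' x + (of_nat (card B) * \<kappa>) * l1dist n x' x"
      by (simp add: sum.distrib C_def sum_distrib_right)
    also have "\<dots> \<le> C * dJ x' x + (1 / 4) * l1dist n x' x"
      by (intro add_left_mono mult_right_mono \<kappa>) simp
    finally show ?thesis by simp
  qed
  \<comment> \<open>The part \<open>dB x' x / 4\<close> of the error is absorbed on the left. This
    yields the factor \<open>(4 * C + 4) / 3\<close>, rounded up to \<open>2 * C + 2\<close>:
    between points with equal values of \<open>g\<close> the free coordinates control the dependent
    ones.\<close>
  have inj: "l1dist n x' x \<le> (2 * C + 2) * dJ x' x"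
    if x: "x \<in> kspace n" "x' \<in> kspace n" "l1dist n x x0 < \<rho>" "l1dist n x' x0 < \<rho>"
      and g: "\<And>b. b \<in> B \<Longrightarrow> g b x' = g b x" for x x'
  proof -
    have "dB x' x = (\<Sum>b\<in>B. \<bar>g b x' - g b x - (x' b - x b)\<bar>)"
      unfolding dB_def by (rule sum.cong) (simp_all add: g)
    with est[OF x] have "dB x' x \<le> C * dJ x' x + (dB x' x + dJ x' x) / 4" by (simp add: dsum)
    moreover have "0 \<le> C * dJ x' x" using C dnn by simp
    ultimately have "dB x' x + dJ x' x \<le> 2 * (C * dJ x' x) + 2 * dJ x' x"
      using dnn[of x' x] by (simp add: field_simps)
    then show ?thesis by (simp add: dsum algebra_simps)
  qed
  \<comment> \<open>With this radius the starting point satisfies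
    \<open>N z0 \<le> \<rho> / 8\<close>, small enough for the steps to stay in the box
    \<open>Y\<close>.\<close>
  define \<rho>' where "\<rho>' = \<rho> / (8 * (C + 1))"
  have \<rho>': "0 < \<rho>'" "8 * (C * \<rho>' + \<rho>') = \<rho>"
  proof -
    have pos: "0 < 8 * (C + 1)" using C by simp
    then show "0 < \<rho>'" using \<rho> unfolding \<rho>'_def by (rule divide_pos_pos[rotated])
    have "8 * (C + 1) * \<rho>' = \<rho>" unfolding \<rho>'_def
      using pos
      by (simp only: times_divide_eq_right nonzero_mult_div_cancel_left less_imp_neq[THEN not_sym] not_False_eq_True)
    then show "8 * (C * \<rho>' + \<rho>') = \<rho>" by (simp add: algebra_simps)
  qed
  have C\<rho>': "0 \<le> C * \<rho>'" using C \<rho>'(1) by simp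
  have ex: "\<exists>z\<in>kspace n. l1dist n z x0 < \<rho> \<and> (\<forall>b\<in>B. g b z = 0) \<and> (\<forall>j\<in>J. z j = z0 j)"
    if z0: "z0 \<in> kspace n" "\<And>b. b \<in> B \<Longrightarrow> z0 b = x0 b" "dJ z0 x0 < \<rho>'" for z0
  proof -
    \<comment> \<open>The box fixes the free coordinates. Its radius \<open>\<rho> / 2\<close> in
      the dependent ones leaves room for the free displacement inside the ball where
      \<open>strict\<close> applies.\<close>
    define Y where "Y z \<longleftrightarrow> (\<forall>j\<in>J. z j = z0 j) \<and> dB z x0 \<le> \<rho> / 2" for z
    have Yball: "l1dist n z x0 < \<rho>" if "Y z" for z
    proof -
      have "dJ z x0 = dJ z0 x0" unfolding dJ_def using that by (intro sum.cong) (auto simp: Y_def)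
      then show ?thesis using that z0(3) \<rho>' C\<rho>' by (simp add: dsum Y_def)
    qed
    have dB0: "dB z0 x0 = 0" using z0(2) by (simp add: dB_def)
    have Y0: "Y z0" using \<rho> dB0 by (simp add: Y_def)
    have ball0: "l1dist n x0 x0 < \<rho>" using \<rho> by simp
    have "N z0 = (\<Sum>b\<in>B. \<bar>g b z0 - g b x0 - (z0 b - x0 b)\<bar>)"
      unfolding N_def by (rule sum.cong) (simp_all add: g0 z0(2))
    also have "\<dots> \<le> C * dJ z0 x0 + l1dist n z0 x0 / 4" by (rule est[OF x0 z0(1) ball0 Yball[OF Y0]])
    also have "\<dots> \<le> C * \<rho>' + \<rho>' / 4"
      using z0(3) mult_left_mono[OF less_imp_le[OF z0(3)] C] by (simp add: dsum dB0)
    finally have N0: "N z0 \<le> \<rho> / 8" using \<rho>' by simp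
    have step: "\<exists>z'\<in>kspace n. Y z' \<and> N z' \<le> N z / 4" if z: "z \<in> kspace n" "Y z" for z
    proof -
      \<comment> \<open>In the dependent coordinates the new displacement from \<open>z0\<close> is
        minus the linearisation error between \<open>z0\<close> and \<open>z\<close>, minus
        \<open>g z0\<close>. Each of the two contributes at most \<open>\<rho> / 8\<close>, so the
        box is not left.\<close>
      define z' where "z' = (\<lambda>i. if i \<in> B then z i - g i z else z i)"
      have z'k: "z' \<in> kspace n" using z(1) Bn by (auto simp: z'_def PiE_def extensional_def)
      have J0: "dJ z z0 = 0" using z(2) by (simp add: dJ_def Y_def)
      have "dB z' x0 \<le> (\<Sum>b\<in>B. \<bar>g b z - g b z0 - (z b - z0 b)\<bar> + \<bar>g b z0\<bar>)"
        unfolding dB_def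
      proof (rule sum_mono)
        fix b assume "b \<in> B"
        then have "z' b = z b - g b z" "x0 b = z0 b" by (simp_all add: z'_def z0(2))
        then show "\<bar>z' b - x0 b\<bar> \<le> \<bar>g b z - g b z0 - (z b - z0 b)\<bar> + \<bar>g b z0\<bar>" by simp
      qed
      also have "\<dots> = (\<Sum>b\<in>B. \<bar>g b z - g b z0 - (z b - z0 b)\<bar>) + N z0"
        by (simp only: N_def sum.distrib)
      also have "\<dots> \<le> (C * dJ z z0 + l1dist n z z0 / 4) + N z0"
        using est[OF z0(1) z(1) Yball[OF Y0] Yball[OF z(2)]] by simp
      also have "\<dots> \<le> \<rho> / 2"
      proof -
        have "dB z z0 = dB z x0" unfolding dB_def by (rule sum.cong) (simp_all add: z0(2))
        then have "l1dist n z z0 \<le> \<rho> / 2" using z(2) by (simp add: dsum J0 Y_def)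
        then show ?thesis using N0 \<rho> by (simp add: J0)
      qed
      finally have Y': "Y z'" using z(2) BJ(2) by (auto simp: Y_def z'_def)
      have d': "dB z' z = N z" unfolding dB_def N_def by (rule sum.cong) (simp_all add: z'_def)
      have J': "dJ z' z = 0" using BJ(2) by (auto simp: dJ_def z'_def intro!: sum.neutral)
      have "N z' = (\<Sum>b\<in>B. \<bar>g b z' - g b z - (z' b - z b)\<bar>)"
        unfolding N_def by (rule sum.cong) (simp_all add: z'_def)
      also have "\<dots> \<le> C * dJ z' z + l1dist n z' z / 4"
        by (rule est[OF z(1) z'k Yball[OF z(2)] Yball[OF Y']])
      finally have "N z' \<le> N z / 4" by (simp add: J' dsum d')
      with Y' z'k show ?thesis by blast
    qed
    have Ydef: "definable_pred S (\<lambda>e. Y (restrict e {..<n}))"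
      unfolding Y_def dB_def using fin by (intro definability)
    have Ndef: "definable_term S (\<lambda>e. N (restrict e {..<n}))"
      unfolding N_def by (intro definable_term_sum definable_term_abs gdef definability)
    have small: "\<exists>z\<in>kspace n. Y z \<and> N z < t" if t: "0 < t" for t
    proof (rule ccontr)
      assume none: "\<not> (\<exists>z\<in>kspace n. Y z \<and> N z < t)"
      \<comment> \<open>Negated values of \<open>N\<close>, because \<open>definable_sup\<close>
        provides suprema: \<open>- s\<close> will be the infimum of \<open>N\<close> on the
        box.\<close>
      define Q where "Q a \<longleftrightarrow> (\<exists>z\<in>kspace n. Y z \<and> N z = - a)" for a
      have Qdef: "definable_pred S (\<lambda>e. Q (e 0))"
        unfolding Q_def by (intro definability Ydef Ndef)
      have Q0: "Q (- N z0)" using z0(1) Y0 by (auto simp: Q_def)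
      have Qt: "a \<le> - t" if "Q a" for a using that none by (force simp: Q_def not_less)
      obtain s where s: "\<And>a. Q a \<Longrightarrow> a \<le> s" "\<And>u. (\<And>a. Q a \<Longrightarrow> a \<le> u) \<Longrightarrow> s \<le> u"
        using Qdef Q0 Qt definable_sup[OF dc, of Q "- N z0" "- t"] by blast
      have "s \<le> - t" using s(2)[of "- t"] Qt by blast
      \<comment> \<open>As \<open>s\<close> is negative, some value of \<open>N\<close> is below
        twice the infimum; the step would take it below half of the infimum.\<close>
      then have "\<not> s \<le> 2 * s" using t by linarith
      then obtain a where a: "Q a" "2 * s < a" using s(2)[of "2 * s"] by (meson not_le)
      then obtain z where z: "z \<in> kspace n" "Y z" "N z = - a" by (auto simp: Q_def)
      obtain z' where z': "z' \<in> kspace n" "Y z'" "N z' \<le> N z / 4" using step[OF z(1,2)] by blast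
      have "Q (- N z')" using z' by (auto simp: Q_def)
      then have "- N z' \<le> s" by (rule s(1))
      with z'(3) z(3) a(2) \<open>s \<le> - t\<close> t show False by (simp add: field_simps)
    qed
    \<comment> \<open>The infimum 0 still has to be attained; a cluster point of these sublevel sets
      does it.\<close>
    define X where "X t = {z \<in> kspace n. Y z \<and> N z < t}" for t
    obtain z where z: "z \<in> kspace n" "\<And>t \<epsilon>. 0 < t \<Longrightarrow> 0 < \<epsilon> \<Longrightarrow> \<exists>y\<in>X t. l1dist n y z < \<epsilon>"
    proof (rule definable_compactness[OF dc, of n X])
      have "definable_pred S (\<lambda>e. Y (restrict e {..<n}) \<and> N (restrict e {..<n}) < e n)"
        by (intro definability Ydef Ndef)
      then show "definable_pred S (\<lambda>e. restrict e {..<n} \<in> X (e n))" by (simp add: X_def)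
      show "X t \<subseteq> kspace n" for t by (auto simp: X_def)
      show "X t \<noteq> {}" if "0 < t" for t using small[OF that] unfolding X_def by blast
      show "X s \<subseteq> X t" if "s \<le> t" for s t
        unfolding X_def using less_le_trans[OF _ that] by blast
      show "\<bar>z i\<bar> \<le> (\<Sum>i<n. \<bar>x0 i\<bar>) + \<rho>" if "z \<in> X t" "i < n" for t z i
      proof -
        have "\<bar>x0 i\<bar> \<le> (\<Sum>i<n. \<bar>x0 i\<bar>)" using that by (intro member_le_sum[of i _ "\<lambda>i. \<bar>x0 i\<bar>"]) auto
        moreover have "\<bar>z i - x0 i\<bar> \<le> \<rho>"
          using abs_le_l1dist[OF that(2), of z x0] Yball[of z] that(1) by (simp add: X_def)
        ultimately show ?thesis by linarith
      qed
    qed (rule that)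
    have zY: "Y z"
      unfolding Y_def
    proof
      show "\<forall>j\<in>J. z j = z0 j"
      proof
        fix j assume j: "j \<in> J"
        have "\<bar>z j - z0 j\<bar> \<le> 0 + \<epsilon>" if e: "0 < \<epsilon>" for \<epsilon>
        proof -
          obtain y where "y \<in> X 1" "l1dist n y z < \<epsilon>" using z(2)[of 1 \<epsilon>] e by auto
          then show ?thesis using abs_le_l1dist[OF Jn[OF j], of y z] j
            by (simp add: X_def Y_def abs_minus_commute)
        qed
        then have "\<bar>z j - z0 j\<bar> \<le> 0" by (rule field_le_epsilon)
        then show "z j = z0 j" by simp
      qed
      show "dB z x0 \<le> \<rho> / 2"
      proof (rule field_le_epsilon)
        fix \<epsilon> :: 'a assume e: "0 < \<epsilon>"
        obtain y where y: "y \<in> X 1" "l1dist n y z < \<epsilon>" using z(2)[of 1 \<epsilon>] e by auto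
        have "dB z x0 \<le> (\<Sum>b\<in>B. \<bar>y b - z b\<bar> + \<bar>y b - x0 b\<bar>)"
          unfolding dB_def by (rule sum_mono) linarith
        also have "\<dots> = dB y z + dB y x0" by (simp add: dB_def sum.distrib)
        also have "\<dots> \<le> \<rho> / 2 + \<epsilon>" using y dnn[of y z] by (simp add: X_def Y_def dsum)
        finally show "dB z x0 \<le> \<rho> / 2 + \<epsilon>" .
      qed
    qed
    have "N z \<le> 0 + \<epsilon>" if e: "0 < \<epsilon>" for \<epsilon>
    proof -
      define \<eta> where "\<eta> = \<epsilon> / (2 * (C + 2))"
      have \<eta>: "0 < \<eta>" "2 * (C * \<eta> + 2 * \<eta>) = \<epsilon>"
      proof -
        have pos: "0 < 2 * (C + 2)" using C by simp
        then show "0 < \<eta>" using e unfolding \<eta>_def by (rule divide_pos_pos[rotated])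
        have "2 * (C + 2) * \<eta> = \<epsilon>" using pos unfolding \<eta>_def
          by (simp only: times_divide_eq_right nonzero_mult_div_cancel_left less_imp_neq[THEN not_sym] not_False_eq_True)
        then show "2 * (C * \<eta> + 2 * \<eta>) = \<epsilon>" by (simp add: algebra_simps)
      qed
      have "0 < \<epsilon> / 2" using e by simp
      then obtain y where y: "y \<in> X (\<epsilon> / 2)" "l1dist n y z < \<eta>" using z(2)[OF _ \<eta>(1)] by blast
      have yX: "y \<in> kspace n" "Y y" "N y < \<epsilon> / 2" using y(1) by (auto simp: X_def)
      have "N z \<le> (\<Sum>b\<in>B. \<bar>g b y\<bar> + \<bar>g b z - g b y - (z b - y b)\<bar> + \<bar>z b - y b\<bar>)"
        unfolding N_def by (rule sum_mono) linarith
      also have "\<dots> = N y + (\<Sum>b\<in>B. \<bar>g b z - g b y - (z b - y b)\<bar>) + dB z y"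
        by (simp add: N_def dB_def sum.distrib)
      also have "\<dots> \<le> N y + (C * dJ z y + l1dist n z y / 4) + dB z y"
        using est[OF yX(1) z(1) Yball[OF yX(2)] Yball[OF zY]] by simp
      also have "\<dots> \<le> \<epsilon> / 2 + (C * \<eta> + \<eta>) + \<eta>"
      proof -
        have l: "l1dist n z y < \<eta>" using y(2) by (simp add: l1dist_commute)
        then have "dJ z y \<le> \<eta>" "dB z y \<le> \<eta>" using dnn[of z y] by (simp_all add: dsum)
        moreover from this have "C * dJ z y \<le> C * \<eta>" using C by (intro mult_left_mono)
        moreover have "l1dist n z y / 4 \<le> \<eta>" using l \<eta>(1) by simp
        ultimately show ?thesis using yX(3) by linarith
      qed
      also have "\<dots> = \<epsilon>" using \<eta>(2) by (simp add: field_simps)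
      finally show ?thesis by simp
    qed
    then have "N z \<le> 0" by (rule field_le_epsilon)
    moreover have "\<bar>g b z\<bar> \<le> N z" if "b \<in> B" for b
      unfolding N_def using that fin by (intro member_le_sum[of b B "\<lambda>b. \<bar>g b z\<bar>"]) auto
    ultimately have "\<forall>b\<in>B. g b z = 0" by (meson abs_le_zero_iff order_trans)
    then show ?thesis using z(1) zY Yball[OF zY] by (auto simp: Y_def)
  qed
  \<comment> \<open>The free coordinates move with total speed below \<open>\<rho>'\<close>, and
    \<open>inj\<close> passes this on to all coordinates.\<close>
  define L where "L = (2 * C + 2) * \<rho>'"
  show ?thesis
  proof (rule that[of \<rho>' L])
    show "0 < \<rho>'" by (rule \<rho>')
    show "0 \<le> L" using C \<rho>' by (simp add: L_def)
    fix x1 assume x1: "x1 \<in> kspace n" "l1dist n x1 x0 < \<rho>'" and g1: "\<forall>b\<in>B. g b x1 = 0"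
    define good where "good t z \<longleftrightarrow> l1dist n z x0 < \<rho> \<and> (\<forall>b\<in>B. g b z = 0) \<and>
      (\<forall>j\<in>J. z j = x0 j + t * (x1 j - x0 j))" for t z
    \<comment> \<open>A default value makes the curve total. Where a good point exists it is unique,
      so the choice has a first-order description.\<close>
    define \<gamma> where "\<gamma> t = (if \<exists>z\<in>kspace n. good t z then SOME z. z \<in> kspace n \<and> good t z else x0)" for t
    have d1: "dJ x1 x0 < \<rho>'" using x1(2) dnn[of x1 x0] by (simp add: dsum)
    have dist: "l1dist n z' z \<le> L * \<bar>s - t\<bar>"
      if "z \<in> kspace n" "z' \<in> kspace n" "good t z" "good s z'" for z z' s t
    proof -
      have "dJ z' z = (\<Sum>j\<in>J. \<bar>s - t\<bar> * \<bar>x1 j - x0 j\<bar>)"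
        unfolding dJ_def abs_mult[symmetric]
      proof (intro sum.cong arg_cong[where f = abs] refl)
        fix j assume "j \<in> J"
        then have "z j = x0 j + t * (x1 j - x0 j)" "z' j = x0 j + s * (x1 j - x0 j)"
          using that(3,4) by (simp_all add: good_def)
        then show "z' j - z j = (s - t) * (x1 j - x0 j)" by (simp add: algebra_simps)
      qed
      also have "\<dots> = \<bar>s - t\<bar> * dJ x1 x0" by (simp only: dJ_def sum_distrib_left)
      also have "\<dots> \<le> \<bar>s - t\<bar> * \<rho>'" using d1 by (intro mult_left_mono) auto
      finally have 1: "dJ z' z \<le> \<bar>s - t\<bar> * \<rho>'" .
      have "l1dist n z' z \<le> (2 * C + 2) * dJ z' z" using that by (intro inj) (auto simp: good_def)
      also have "\<dots> \<le> (2 * C + 2) * (\<bar>s - t\<bar> * \<rho>')" using 1 C by (intro mult_left_mono) auto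
      finally show ?thesis by (simp add: L_def mult_ac)
    qed
    have uniq: "z' = z" if "z \<in> kspace n" "z' \<in> kspace n" "good t z" "good t z'" for z z' t
    proof -
      have "l1dist n z' z \<le> 0" using dist[OF that] by simp
      then have "l1dist n z' z = 0" using l1dist_nonneg[of n z' z] by (rule antisym)
      then show ?thesis using that by (intro l1dist_eq_0D)
    qed
    have \<gamma>eq: "\<gamma> t = z" if "z \<in> kspace n" "good t z" for t z
    proof -
      have "\<exists>z. z \<in> kspace n \<and> good t z" using that by blast
      from someI_ex[OF this] have "(SOME z. z \<in> kspace n \<and> good t z) = z"
        using that uniq by blast
      then show ?thesis using that by (auto simp: \<gamma>_def)
    qed
    have \<gamma>good: "\<gamma> t \<in> kspace n" "good t (\<gamma> t)" if t: "0 \<le> t" "t \<le> 1" for t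
    proof -
      define z0 where "z0 = (\<lambda>i. if i \<in> J then x0 i + t * (x1 i - x0 i) else x0 i)"
      have 1: "z0 \<in> kspace n" using x0 Jn by (auto simp: z0_def PiE_def extensional_def)
      have 2: "z0 b = x0 b" if "b \<in> B" for b using BJ(2) that by (auto simp: z0_def)
      have 3: "dJ z0 x0 < \<rho>'"
      proof -
        have "dJ z0 x0 = (\<Sum>j\<in>J. t * \<bar>x1 j - x0 j\<bar>)"
          unfolding dJ_def using t by (intro sum.cong) (auto simp: z0_def abs_mult)
        also have "\<dots> = t * dJ x1 x0" by (simp only: dJ_def sum_distrib_left)
        also have "\<dots> \<le> dJ x1 x0" using t dnn[of x1 x0] by (simp add: mult_left_le_one_le)
        finally show ?thesis using d1 by simp
      qed
      from ex[OF 1 2 3] obtain z where z: "z \<in> kspace n" "l1dist n z x0 < \<rho>" "\<forall>b\<in>B. g b z = 0"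
        "\<forall>j\<in>J. z j = z0 j" by blast
      then have "good t z" by (auto simp: good_def z0_def)
      with z(1) \<gamma>eq show "\<gamma> t \<in> kspace n" "good t (\<gamma> t)" by auto
    qed
    have \<gamma>k: "\<gamma> t \<in> kspace n" for t
    proof (cases "\<exists>z\<in>kspace n. good t z")
      case True then show ?thesis using \<gamma>eq by metis
    next
      case False then show ?thesis using x0 by (simp only: \<gamma>_def if_False)
    qed
    have \<gamma>i: "e = \<gamma> t i \<longleftrightarrow> (\<exists>z\<in>kspace n. good t z \<and> e = z i) \<or>
      \<not> (\<exists>z\<in>kspace n. good t z) \<and> e = x0 i" for e t i
    proof (cases "\<exists>z\<in>kspace n. good t z")
      case True then show ?thesis using \<gamma>eq by metis
    next
      case False
      then have "\<gamma> t = x0" by (simp only: \<gamma>_def if_False)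
      with False show ?thesis by blast
    qed
    have good: "definable_pred S (\<lambda>e. good (e p) (restrict e {..<n}))" for p
      unfolding good_def using fin x0
      by (intro definability definable_pred_ball_finite gdef) auto
    have \<gamma>def: "definable_term S (\<lambda>e. \<gamma> (e 0) i)" for i
      unfolding definable_term_def \<gamma>i by (intro definability good)
    show "\<exists>\<gamma>. level_curve S n B J g x0 x1 \<rho> L \<gamma>"
    proof (rule exI[of _ \<gamma>], unfold level_curve_def, intro conjI allI impI)
      show "definable_point S n (\<lambda>e. \<gamma> (e 0))" using \<gamma>k \<gamma>def by (simp add: definable_point_def)
      show "\<gamma> 0 = x0" using \<rho> g0 x0 by (intro \<gamma>eq) (auto simp: good_def)
      have "p \<le> 8 * (q + p)" if "0 < p" "0 \<le> q" for p q :: 'a using that by simp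
      from this[OF \<rho>'(1) C\<rho>'] have "\<rho>' \<le> \<rho>" unfolding \<rho>'(2) .
      then show "\<gamma> 1 = x1" using x1 g1 by (intro \<gamma>eq) (auto simp: good_def)
      show "l1dist n (\<gamma> t) x0 < \<rho>" "\<forall>b\<in>B. g b (\<gamma> t) = 0"
        "\<forall>j\<in>J. \<gamma> t j = x0 j + t * (x1 j - x0 j)" if "0 \<le> t" "t \<le> 1" for t
        using \<gamma>good[OF that] by (simp_all add: good_def)
      show "l1dist n (\<gamma> s) (\<gamma> t) \<le> L * \<bar>s - t\<bar>" if "0 \<le> s" "s \<le> 1" "0 \<le> t" "t \<le> 1" for s t
        using that by (intro dist \<gamma>good)
    qed
  qed
qed

section \<open>Frames\<close>

text \<open>
  A frame at a point: \<open>dG\<close> contains the differentials of functions \<open>G b\<close> for pivots \<open>b \<in> B\<close>,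
  the vectors \<open>D j\<close> for \<open>j \<notin> B\<close> span their common kernel, and the \<open>E b\<close> are dual to the \<open>dG b\<close>,
  all up to the common factor \<open>\<delta>\<close>. It is the state of a fraction-free Gaussian elimination.
\<close>

definition frame_at :: "nat \<Rightarrow> nat set \<Rightarrow> (nat \<Rightarrow> nat \<Rightarrow> 'a::field) \<Rightarrow> (nat \<Rightarrow> nat \<Rightarrow> 'a) \<Rightarrow>
    (nat \<Rightarrow> nat \<Rightarrow> 'a) \<Rightarrow> 'a \<Rightarrow> bool" where
  "frame_at n B dG D E \<delta> \<longleftrightarrow>
     (\<forall>i\<in>{..<n} - B. \<forall>j\<in>{..<n} - B. D j i = (if i = j then \<delta> else 0)) \<and>
     (\<forall>b\<in>B. \<forall>i\<in>{..<n} - B. E b i = 0) \<and>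
     (\<forall>j\<in>{..<n} - B. \<forall>b\<in>B. (\<Sum>i<n. D j i * dG b i) = 0) \<and>
     (\<forall>b\<in>B. \<forall>b'\<in>B. (\<Sum>i<n. E b i * dG b' i) = (if b = b' then \<delta> else 0)) \<and>
     (\<forall>v. \<forall>i<n. \<delta> * v i = (\<Sum>j\<in>{..<n} - B. v j * D j i) +
        (\<Sum>b\<in>B. (\<Sum>k<n. dG b k * v k) * E b i))"

lemma frame_at_start: "frame_at n {} dG (\<lambda>j i. if i = j then 1 else 0) E 1"
  unfolding frame_at_def by (auto simp: if_distrib if_distribR cong: if_cong)

lemma frame_at_cong:
  assumes "frame_at n B dG D E \<delta>"
    and "\<And>b k. b \<in> B \<Longrightarrow> k < n \<Longrightarrow> dG b k = dG' b k"
    and "\<And>j i. j < n \<Longrightarrow> i < n \<Longrightarrow> D j i = D' j i"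
    and "\<And>b i. b \<in> B \<Longrightarrow> i < n \<Longrightarrow> E b i = E' b i" and "\<delta> = \<delta>'"
  shows "frame_at n B dG' D' E' \<delta>'"
proof -
  have 1: "(\<Sum>i<n. D j i * dG b i) = (\<Sum>i<n. D' j i * dG' b i)" if "j < n" "b \<in> B" for j b
    using that assms by (intro sum.cong) auto
  have 2: "(\<Sum>i<n. E b i * dG b' i) = (\<Sum>i<n. E' b i * dG' b' i)" if "b \<in> B" "b' \<in> B" for b b'
    using that assms by (intro sum.cong) auto
  have 3: "(\<Sum>j\<in>{..<n} - B. v j * D j i) = (\<Sum>j\<in>{..<n} - B. v j * D' j i)" if "i < n" for i v
    using that assms by (intro sum.cong) auto
  have 4: "(\<Sum>b\<in>B. (\<Sum>k<n. dG b k * v k) * E b i) = (\<Sum>b\<in>B. (\<Sum>k<n. dG' b k * v k) * E' b i)"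
    if "i < n" for i v
    using that assms by (intro sum.cong arg_cong2[where f = "(*)"]) auto
  show ?thesis
    unfolding frame_at_def
  proof (intro conjI ballI allI impI)
    show "D' j i = (if i = j then \<delta>' else 0)" if "i \<in> {..<n} - B" "j \<in> {..<n} - B" for i j
      using assms(1,3,5) that unfolding frame_at_def by auto
    show "E' b i = 0" if "b \<in> B" "i \<in> {..<n} - B" for b i
      using assms(1,4) that unfolding frame_at_def by auto
    show "(\<Sum>i<n. D' j i * dG' b i) = 0" if "j \<in> {..<n} - B" "b \<in> B" for j b
      using assms(1) that 1[of j b] unfolding frame_at_def by auto
    show "(\<Sum>i<n. E' b i * dG' b' i) = (if b = b' then \<delta>' else 0)" if "b \<in> B" "b' \<in> B" for b b'
      using assms(1,5) that 2[of b b'] unfolding frame_at_def by auto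
    show "\<delta>' * v i = (\<Sum>j\<in>{..<n} - B. v j * D' j i) + (\<Sum>b\<in>B. (\<Sum>k<n. dG' b k * v k) * E' b i)"
      if "i < n" for v i
      using assms(1,5) that 3[of i v] 4[of i v] unfolding frame_at_def by auto
  qed
qed

text \<open>The expansion of vectors in the frame, paired with a covector \<open>dh\<close>. On a
  vector killed by all \<open>dG b\<close> only the terms with the \<open>D j\<close>
  survive.\<close>

lemma frame_at_covector:
  assumes "frame_at n B dG D E \<delta>"
  shows "\<delta> * (\<Sum>k<n. dh k * v k) = (\<Sum>j\<in>{..<n} - B. v j * (\<Sum>i<n. D j i * dh i)) +
    (\<Sum>b\<in>B. (\<Sum>k<n. dG b k * v k) * (\<Sum>i<n. E b i * dh i))"
proof -
  define w where "w b = (\<Sum>k<n. dG b k * v k)" for b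
  have v: "\<delta> * v i = (\<Sum>j\<in>{..<n} - B. v j * D j i) + (\<Sum>b\<in>B. w b * E b i)" if "i < n" for i
    using assms that unfolding frame_at_def w_def by blast
  have "\<delta> * (\<Sum>k<n. dh k * v k) = (\<Sum>k<n. dh k * (\<delta> * v k))" by (simp add: sum_distrib_left mult_ac)
  also have "\<dots> = (\<Sum>k<n. (\<Sum>j\<in>{..<n} - B. v j * (D j k * dh k)) + (\<Sum>b\<in>B. w b * (E b k * dh k)))"
    by (rule sum.cong) (simp_all add: v distrib_left sum_distrib_left mult_ac)
  also have "\<dots> = (\<Sum>j\<in>{..<n} - B. v j * (\<Sum>i<n. D j i * dh i)) + (\<Sum>b\<in>B. w b * (\<Sum>i<n. E b i * dh i))"
    unfolding sum.distrib sum_distrib_left by (intro arg_cong2[where f = "(+)"] sum.swap)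
  finally show ?thesis unfolding w_def .
qed

text \<open>One elimination step with pivot \<open>Dg j0\<close>. The remaining \<open>D j\<close>
  are corrected by \<open>D j0\<close> so that \<open>dg\<close> kills them, \<open>D j0\<close>
  scaled by \<open>\<delta>\<close> becomes dual to \<open>dg\<close>, and the old dual vectors are
  corrected likewise. Cross-multiplication replaces division, so that coefficients stay in a ring
  when the step is applied to functions.\<close>

lemma frame_at_extend:
  fixes D E dG :: "nat \<Rightarrow> nat \<Rightarrow> 'a::field" and dg :: "nat \<Rightarrow> 'a"
  assumes F: "frame_at n B dG D E \<delta>" and B: "B \<subseteq> {..<n}" and j0: "j0 < n" "j0 \<notin> B"
  defines "Dg \<equiv> \<lambda>j. \<Sum>i<n. D j i * dg i" and "Eg \<equiv> \<lambda>b. \<Sum>i<n. E b i * dg i"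
  shows "frame_at n (insert j0 B) (dG(j0 := dg))
    (\<lambda>j i. Dg j0 * D j i - Dg j * D j0 i)
    (\<lambda>b i. if b = j0 then \<delta> * D j0 i else Dg j0 * E b i - Eg b * D j0 i) (Dg j0 * \<delta>)"
proof -
  let ?J = "{..<n} - B" and ?J' = "{..<n} - insert j0 B"
  have Dg: "(\<Sum>i<n. D j i * dg i) = Dg j" and Eg: "(\<Sum>i<n. E j i * dg i) = Eg j" for j
    by (simp_all add: Dg_def Eg_def)
  have finB: "finite B" using B by (rule finite_subset) simp
  have F1: "\<And>i j. i \<in> ?J \<Longrightarrow> j \<in> ?J \<Longrightarrow> D j i = (if i = j then \<delta> else 0)"
    and F2: "\<And>b i. b \<in> B \<Longrightarrow> i \<in> ?J \<Longrightarrow> E b i = 0"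
    and F3: "\<And>j b. j \<in> ?J \<Longrightarrow> b \<in> B \<Longrightarrow> (\<Sum>i<n. D j i * dG b i) = 0"
    and F4: "\<And>b b'. b \<in> B \<Longrightarrow> b' \<in> B \<Longrightarrow> (\<Sum>i<n. E b i * dG b' i) = (if b = b' then \<delta> else 0)"
    and F5: "\<And>v i. i < n \<Longrightarrow> \<delta> * v i = (\<Sum>j\<in>?J. v j * D j i) + (\<Sum>b\<in>B. (\<Sum>k<n. dG b k * v k) * E b i)"
    using F unfolding frame_at_def by blast+
  have j0J: "j0 \<in> ?J" using j0 by simp
  have J: "?J = insert j0 ?J'" "j0 \<notin> ?J'" "finite ?J'" using j0 by auto
  have lin: "(\<Sum>i<n. (p * x i - q * y i) * z i) = p * (\<Sum>i<n. x i * z i) - q * (\<Sum>i<n. y i * z i)"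
    for p q :: 'a and x y z by (simp add: sum_distrib_left sum_subtractf algebra_simps)
  have lin1: "(\<Sum>i<n. (p * x i) * z i) = p * (\<Sum>i<n. x i * z i)" for p :: 'a and x z
    by (simp add: sum_distrib_left mult.assoc)
  show ?thesis
    unfolding frame_at_def
  proof (intro conjI ballI allI impI)
    fix i j assume "i \<in> ?J'" "j \<in> ?J'"
    then show "Dg j0 * D j i - Dg j * D j0 i = (if i = j then Dg j0 * \<delta> else 0)"
      using F1[of i j] F1[of i j0] j0J by auto
  next
    fix b i assume "b \<in> insert j0 B" "i \<in> ?J'"
    then show "(if b = j0 then \<delta> * D j0 i else Dg j0 * E b i - Eg b * D j0 i) = 0"
      using F1[of i j0] F2[of b i] j0J by auto
  next
    fix j b assume j: "j \<in> ?J'" and b: "b \<in> insert j0 B"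
    show "(\<Sum>i<n. (Dg j0 * D j i - Dg j * D j0 i) * (dG(j0 := dg)) b i) = 0"
    proof (cases "b = j0")
      case True then show ?thesis by (simp add: lin Dg)
    next
      case False then show ?thesis using b j F3[of j b] F3[of j0 b] j0J by (simp add: lin)
    qed
  next
    fix b b' assume b: "b \<in> insert j0 B" "b' \<in> insert j0 B"
    show "(\<Sum>i<n. (if b = j0 then \<delta> * D j0 i else Dg j0 * E b i - Eg b * D j0 i) * (dG(j0 := dg)) b' i)
      = (if b = b' then Dg j0 * \<delta> else 0)"
    proof (cases "b = j0"; cases "b' = j0")
      assume "b = j0" "b' = j0"
      then show ?thesis by (simp add: lin1 Dg)
    next
      assume "b = j0" "b' \<noteq> j0"
      then show ?thesis using b F3[of j0 b'] j0J by (simp add: lin1)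
    next
      assume "b \<noteq> j0" "b' = j0"
      then show ?thesis by (simp add: lin Dg Eg)
    next
      assume "b \<noteq> j0" "b' \<noteq> j0"
      then show ?thesis using b F3[of j0 b'] F4[of b b'] j0J by (simp add: lin)
    qed
  next
    fix v :: "nat \<Rightarrow> 'a" and i assume i: "i < n"
    define w where "w b = (\<Sum>k<n. dG b k * v k)" for b
    define wg where "wg = (\<Sum>k<n. dg k * v k)"
    have F5w: "\<delta> * v i = (\<Sum>j\<in>?J. v j * D j i) + (\<Sum>b\<in>B. w b * E b i)" if "i < n" for i
      unfolding w_def using that by (rule F5)
    have wg: "\<delta> * wg = (\<Sum>j\<in>?J. v j * Dg j) + (\<Sum>b\<in>B. w b * Eg b)"
      unfolding wg_def w_def Dg_def Eg_def by (rule frame_at_covector[OF F])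
    have sJ: "(\<Sum>j\<in>?J. v j * h j) = v j0 * h j0 + (\<Sum>j\<in>?J'. v j * h j)" for h :: "nat \<Rightarrow> 'a"
      unfolding J(1) using J(2,3) by (simp add: sum.insert)
    have D': "(\<Sum>j\<in>?J'. v j * (Dg j0 * D j i - Dg j * D j0 i)) =
      Dg j0 * (\<Sum>j\<in>?J'. v j * D j i) - D j0 i * (\<Sum>j\<in>?J'. v j * Dg j)"
      by (simp add: sum_distrib_left sum_subtractf algebra_simps)
    have E': "(\<Sum>b\<in>B. w b * (Dg j0 * E b i - Eg b * D j0 i)) =
      Dg j0 * (\<Sum>b\<in>B. w b * E b i) - D j0 i * (\<Sum>b\<in>B. w b * Eg b)"
      by (simp add: sum_distrib_left sum_subtractf algebra_simps)
    have ins: "(\<Sum>b\<in>insert j0 B. (\<Sum>k<n. (dG(j0 := dg)) b k * v k) *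
        (if b = j0 then \<delta> * D j0 i else Dg j0 * E b i - Eg b * D j0 i)) =
      wg * (\<delta> * D j0 i) + (\<Sum>b\<in>B. w b * (Dg j0 * E b i - Eg b * D j0 i))"
      using finB j0(2) by (subst sum.insert) (auto simp: wg_def w_def intro!: sum.cong)
    have V: "Dg j0 * \<delta> * v i = Dg j0 * ((\<Sum>j\<in>?J. v j * D j i) + (\<Sum>b\<in>B. w b * E b i))"
      by (simp only: mult.assoc F5w[OF i])
    \<comment> \<open>The old expansion of \<open>v\<close> is multiplied by the pivot; then
      \<open>v j0 * Dg j0\<close> is eliminated through the expansion of
      \<open>\<delta> * wg\<close>.\<close>
    have key: "d * ((v0 * y + A) + C) = (d * A - y * P) + (wg * (\<delta> * y) + (d * C - y * R))"
      if "\<delta> * wg = (v0 * d + P) + R" for d v0 y A C P R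
    proof -
      have "wg * (\<delta> * y) = ((v0 * d + P) + R) * y" unfolding that[symmetric] by (simp only: mult_ac)
      then show ?thesis by (simp add: algebra_simps)
    qed
    show "Dg j0 * \<delta> * v i = (\<Sum>j\<in>?J'. v j * (Dg j0 * D j i - Dg j * D j0 i)) +
      (\<Sum>b\<in>insert j0 B. (\<Sum>k<n. (dG(j0 := dg)) b k * v k) *
        (if b = j0 then \<delta> * D j0 i else Dg j0 * E b i - Eg b * D j0 i))"
      unfolding V ins D' E' sJ by (rule key[OF wg[unfolded sJ]])
  qed
qed

lemma restrict_mem_cong:
  "(\<lambda>x\<in>A. f x) \<in> X \<Longrightarrow> (\<And>x. x \<in> A \<Longrightarrow> f x = g x) \<Longrightarrow> (\<lambda>x\<in>A. g x) \<in> X"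
  by (metis restrict_ext)

section \<open>Frames over \<open>M\<close> and curves along their fields\<close>

context definable_differential_ring
begin

lemma strict_derivative_eventually:
  assumes "f \<in> M" "p \<in> U" "0 < \<epsilon>"
  shows "eventually (\<lambda>\<rho>. \<forall>x\<in>kspace n. \<forall>x'\<in>kspace n. l1dist n x p < \<rho> \<longrightarrow> l1dist n x' p < \<rho> \<longrightarrow>
      \<bar>f x' - f x - (\<Sum>i<n. partial U i f p * (x' i - x i))\<bar> \<le> \<epsilon> * l1dist n x' x) (at_right 0)"
proof -
  obtain \<rho> where "0 < \<rho>"
    and *: "\<And>x x'. x \<in> kspace n \<Longrightarrow> x' \<in> kspace n \<Longrightarrow> l1dist n x p < \<rho> \<Longrightarrow> l1dist n x' p < \<rho> \<Longrightarrow>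
      \<bar>f x' - f x - (\<Sum>i<n. partial U i f p * (x' i - x i))\<bar> \<le> \<epsilon> * l1dist n x' x"
    by (rule strict_derivative[OF assms]) (rule that)
  show ?thesis
  proof (rule eventually_smallI[OF \<open>0 < \<rho>\<close>], intro ballI impI)
    fix y x x' assume "y \<le> \<rho>" "x \<in> kspace n" "x' \<in> kspace n" "l1dist n x p < y" "l1dist n x' p < y"
    then show "\<bar>f x' - f x - (\<Sum>i<n. partial U i f p * (x' i - x i))\<bar> \<le> \<epsilon> * l1dist n x' x"
      by (intro *) auto
  qed
qed

lemma M_continuous_eventually:
  assumes "f \<in> M" "p \<in> U" "0 < \<epsilon>"
  shows "eventually (\<lambda>\<rho>. \<forall>x\<in>kspace n. l1dist n x p < \<rho> \<longrightarrow> \<bar>f x - f p\<bar> < \<epsilon>) (at_right 0)"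
proof -
  obtain d where "0 < d" and *: "\<And>y. y \<in> kspace n \<Longrightarrow> l1dist n y p < d \<Longrightarrow> y \<in> U \<and> \<bar>f y - f p\<bar> < \<epsilon>"
    by (rule M_continuous[OF assms]) (rule that)
  show ?thesis
  proof (rule eventually_smallI[OF \<open>0 < d\<close>], intro ballI impI)
    fix y x assume "y \<le> d" "x \<in> kspace n" "l1dist n x p < y"
    then show "\<bar>f x - f p\<bar> < \<epsilon>" using *[of x] by auto
  qed
qed

lemma U_eventually:
  assumes "p \<in> U"
  shows "eventually (\<lambda>\<rho>. \<forall>x\<in>kspace n. l1dist n x p < \<rho> \<longrightarrow> x \<in> U) (at_right 0)"
proof -
  obtain d where "0 < d" and *: "\<And>y. y \<in> kspace n \<Longrightarrow> l1dist n y p < d \<Longrightarrow> y \<in> U"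
    by (rule openin_ptop_l1dist[OF U_open assms]) (rule that)
  show ?thesis
  proof (rule eventually_smallI[OF \<open>0 < d\<close>], intro ballI impI)
    fix y x assume "y \<le> d" "x \<in> kspace n" "l1dist n x p < y"
    then show "x \<in> U" using *[of x] by auto
  qed
qed

definition der :: "(nat \<Rightarrow> (nat \<Rightarrow> 'a) \<Rightarrow> 'a) \<Rightarrow> ((nat \<Rightarrow> 'a) \<Rightarrow> 'a) \<Rightarrow> (nat \<Rightarrow> 'a) \<Rightarrow> 'a" where
  "der X h = (\<lambda>x\<in>U. \<Sum>i<n. X i x * partial U i h x)"

definition frame :: "nat set \<Rightarrow> (nat \<Rightarrow> (nat \<Rightarrow> 'a) \<Rightarrow> 'a) \<Rightarrow> (nat \<Rightarrow> nat \<Rightarrow> (nat \<Rightarrow> 'a) \<Rightarrow> 'a) \<Rightarrow>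
    (nat \<Rightarrow> nat \<Rightarrow> (nat \<Rightarrow> 'a) \<Rightarrow> 'a) \<Rightarrow> ((nat \<Rightarrow> 'a) \<Rightarrow> 'a) \<Rightarrow> bool" where
  "frame B G D E \<delta> \<longleftrightarrow> B \<subseteq> {..<n} \<and> (\<forall>b\<in>B. G b \<in> M) \<and> (\<forall>j<n. \<forall>i<n. D j i \<in> M) \<and>
     (\<forall>b\<in>B. \<forall>i<n. E b i \<in> M) \<and> \<delta> \<in> M \<and>
     (\<forall>x\<in>U. frame_at n B (\<lambda>b k. partial U k (G b) x) (\<lambda>j i. D j i x) (\<lambda>b i. E b i x) (\<delta> x))"

text \<open>The last clause, multiplied by \<open>\<delta>\<close> instead of dividing by it, gives
  the derivative of \<open>h\<close> along the curve. The weights \<open>x1 j - x0 j\<close> are the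
  constant speeds of the free coordinates.\<close>

definition tangent_curve :: "nat set \<Rightarrow> (nat \<Rightarrow> nat \<Rightarrow> (nat \<Rightarrow> 'a) \<Rightarrow> 'a) \<Rightarrow> ((nat \<Rightarrow> 'a) \<Rightarrow> 'a) \<Rightarrow>
    (nat \<Rightarrow> 'a) \<Rightarrow> (nat \<Rightarrow> 'a) \<Rightarrow> 'a \<Rightarrow> ('a \<Rightarrow> nat \<Rightarrow> 'a) \<Rightarrow> bool" where
  "tangent_curve B D \<delta> x0 x1 r \<gamma> \<longleftrightarrow> definable_point S n (\<lambda>e. \<gamma> (e 0)) \<and> \<gamma> 0 = x0 \<and> \<gamma> 1 = x1 \<and>
     (\<forall>t. 0 \<le> t \<longrightarrow> t \<le> 1 \<longrightarrow> \<gamma> t \<in> U \<and> l1dist n (\<gamma> t) x0 < r) \<and>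
     (\<forall>h t \<epsilon>. h \<in> M \<longrightarrow> 0 \<le> t \<longrightarrow> t \<le> 1 \<longrightarrow> 0 < \<epsilon> \<longrightarrow>
       (\<exists>d>0. \<forall>s. 0 \<le> s \<longrightarrow> s \<le> 1 \<longrightarrow> \<bar>s - t\<bar> < d \<longrightarrow>
         \<bar>\<delta> (\<gamma> t) * (h (\<gamma> s) - h (\<gamma> t)) -
           (s - t) * (\<Sum>j\<in>{..<n} - B. (x1 j - x0 j) * der (D j) h (\<gamma> t))\<bar> \<le> \<epsilon> * \<bar>s - t\<bar>))"

text \<open>
  The curve joins nearby points of a level set of \<open>G\<close> inside the level set. It need not be
  differentiable, but along it every \<open>h \<in> M\<close> has a derivative given by the fields \<open>D j\<close>.
\<close>

lemma frame_curve:
  assumes fr: "frame B G D E \<delta>" and x0: "x0 \<in> U" and \<delta>0: "\<delta> x0 \<noteq> 0" and r: "0 < r"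
  obtains \<rho>' where "0 < \<rho>'"
    "\<And>x1. x1 \<in> kspace n \<Longrightarrow> l1dist n x1 x0 < \<rho>' \<Longrightarrow> (\<forall>b\<in>B. G b x1 = G b x0) \<Longrightarrow>
      \<exists>\<gamma>. tangent_curve B D \<delta> x0 x1 r \<gamma>"
proof -
  let ?J = "{..<n} - B"
  have B: "B \<subseteq> {..<n}" and GM: "\<And>b. b \<in> B \<Longrightarrow> G b \<in> M"
    and fa: "\<And>x. x \<in> U \<Longrightarrow> frame_at n B (\<lambda>b k. partial U k (G b) x) (\<lambda>j i. D j i x) (\<lambda>b i. E b i x) (\<delta> x)"
    using fr unfolding frame_def by blast+
  have finB: "finite B" using B by (rule finite_subset) simp
  have x0k: "x0 \<in> kspace n" using x0 U_kspace by blast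
  \<comment> \<open>At \<open>x0\<close> the matrix \<open>R\<close> inverts the \<open>B\<close>
    columns of the differentials of the pivots. So \<open>g\<close> is \<open>G\<close> minus its
    value at \<open>x0\<close>, normalised to have the identity as derivative in the directions of
    \<open>B\<close>.\<close>
  define R where "R b b' = E b' b x0 / \<delta> x0" for b b'
  define g where "g b x = (\<Sum>b'\<in>B. R b b' * (G b' x - G b' x0))" for b x
  \<comment> \<open>The derivative of \<open>g b\<close> at \<open>x0\<close> in the free direction
    \<open>j\<close>, read off from the expansion of vectors in the frame.\<close>
  define c where "c b j = - (D j b x0 / \<delta> x0)" for b j
  define A where "A = (\<Sum>b\<in>B. \<Sum>b'\<in>B. \<bar>R b b'\<bar>)"
  have A: "0 \<le> A" by (simp add: A_def sum_nonneg)
  \<comment> \<open>The accuracy that \<open>implicit_curve\<close> asks for; \<open>Suc\<close>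
    avoids division by 0 if there are no pivots.\<close>
  define \<kappa> :: 'a where "\<kappa> = 1 / (4 * of_nat (Suc (card B)))"
  have \<kappa>: "0 < \<kappa>" "of_nat (card B) * \<kappa> \<le> 1 / 4"
  proof -
    have pos: "(0::'a) < of_nat (Suc (card B))" by (simp only: of_nat_0_less_iff)
    then show "0 < \<kappa>" by (simp add: \<kappa>_def del: of_nat_Suc)
    have "of_nat (card B) * \<kappa> = (of_nat (card B) / of_nat (Suc (card B))) * (1 / 4)"
      by (simp add: \<kappa>_def del: of_nat_Suc)
    also have "\<dots> \<le> 1 * (1 / 4)"
    proof (rule mult_right_mono)
      have "(of_nat (card B) :: 'a) \<le> of_nat (Suc (card B))" by (simp only: of_nat_le_iff)
      then show "of_nat (card B) / of_nat (Suc (card B)) \<le> (1::'a)"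
        using pos by (simp only: divide_le_eq_1_pos)
    qed simp
    finally show "of_nat (card B) * \<kappa> \<le> 1 / 4" by simp
  qed
  \<comment> \<open>An accuracy for the \<open>G b\<close> that survives multiplication by
    \<open>R\<close>, whose absolute row sums are bounded by \<open>A\<close>.\<close>
  define \<epsilon>0 where "\<epsilon>0 = \<kappa> / (A + 1)"
  have \<epsilon>0: "0 < \<epsilon>0" "A * \<epsilon>0 \<le> \<kappa>"
  proof -
    show "0 < \<epsilon>0" using \<kappa>(1) A by (simp add: \<epsilon>0_def)
    have "(A + 1) * \<epsilon>0 = \<kappa>" using A by (simp add: \<epsilon>0_def)
    then show "A * \<epsilon>0 \<le> \<kappa>" using \<open>0 < \<epsilon>0\<close> by (simp add: algebra_simps)
  qed
  have "eventually (\<lambda>\<rho>. (\<forall>b\<in>B. \<forall>x\<in>kspace n. \<forall>x'\<in>kspace n. l1dist n x x0 < \<rho> \<longrightarrow> l1dist n x' x0 < \<rho> \<longrightarrow>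
      \<bar>G b x' - G b x - (\<Sum>i<n. partial U i (G b) x0 * (x' i - x i))\<bar> \<le> \<epsilon>0 * l1dist n x' x) \<and>
      (\<forall>x\<in>kspace n. l1dist n x x0 < \<rho> \<longrightarrow> x \<in> U) \<and> \<rho> \<le> r) (at_right 0)"
  proof (rule eventually_conj[OF _ eventually_conj[OF U_eventually[OF x0]]])
    show "eventually (\<lambda>\<rho>. \<forall>b\<in>B. \<forall>x\<in>kspace n. \<forall>x'\<in>kspace n. l1dist n x x0 < \<rho> \<longrightarrow> l1dist n x' x0 < \<rho> \<longrightarrow>
      \<bar>G b x' - G b x - (\<Sum>i<n. partial U i (G b) x0 * (x' i - x i))\<bar> \<le> \<epsilon>0 * l1dist n x' x) (at_right 0)"
      by (rule eventually_ball_finite[OF finB], rule ballI, rule strict_derivative_eventually[OF GM x0 \<epsilon>0(1)])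
    show "eventually (\<lambda>\<rho>. \<rho> \<le> r) (at_right 0)" by (rule eventually_smallI[OF r])
  qed
  then obtain \<rho> where \<rho>: "0 < \<rho>"
    and \<rho>_all: "(\<forall>b\<in>B. \<forall>x\<in>kspace n. \<forall>x'\<in>kspace n. l1dist n x x0 < \<rho> \<longrightarrow> l1dist n x' x0 < \<rho> \<longrightarrow>
      \<bar>G b x' - G b x - (\<Sum>i<n. partial U i (G b) x0 * (x' i - x i))\<bar> \<le> \<epsilon>0 * l1dist n x' x) \<and>
      (\<forall>x\<in>kspace n. l1dist n x x0 < \<rho> \<longrightarrow> x \<in> U) \<and> \<rho> \<le> r"
    by (rule eventually_small) (rule that)
  have strictG: "\<bar>G b x' - G b x - (\<Sum>i<n. partial U i (G b) x0 * (x' i - x i))\<bar> \<le> \<epsilon>0 * l1dist n x' x"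
    if "b \<in> B" "x \<in> kspace n" "x' \<in> kspace n" "l1dist n x x0 < \<rho>" "l1dist n x' x0 < \<rho>" for b x x'
    using \<rho>_all that by blast
  have inU: "x \<in> U" if "x \<in> kspace n" "l1dist n x x0 < \<rho>" for x using \<rho>_all that by blast
  have \<rho>r: "\<rho> \<le> r" using \<rho>_all by blast
  have strict: "\<bar>g b x' - g b x - (x' b - x b) - (\<Sum>j\<in>?J. c b j * (x' j - x j))\<bar> \<le> \<kappa> * l1dist n x' x"
    if b: "b \<in> B" and x: "x \<in> kspace n" "x' \<in> kspace n" "l1dist n x x0 < \<rho>" "l1dist n x' x0 < \<rho>" for b x x'
  proof -
    define v where "v i = x' i - x i" for i
    define err where "err b' = G b' x' - G b' x - (\<Sum>i<n. partial U i (G b') x0 * v i)" for b'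
    have "b < n" using b B by auto
    then have "\<delta> x0 * v b = (\<Sum>j\<in>?J. v j * D j b x0) + (\<Sum>b'\<in>B. (\<Sum>k<n. partial U k (G b') x0 * v k) * E b' b x0)"
      using fa[OF x0] unfolding frame_at_def by blast
    then have "v b = ((\<Sum>j\<in>?J. v j * D j b x0) + (\<Sum>b'\<in>B. (\<Sum>k<n. partial U k (G b') x0 * v k) * E b' b x0)) / \<delta> x0"
      using \<delta>0 by (simp add: nonzero_eq_divide_eq mult.commute)
    also have "\<dots> = - (\<Sum>j\<in>?J. c b j * v j) + (\<Sum>b'\<in>B. R b b' * (\<Sum>k<n. partial U k (G b') x0 * v k))"
      by (simp add: c_def R_def add_divide_distrib sum_divide_distrib sum_negf mult_ac)
    finally have vb: "v b + (\<Sum>j\<in>?J. c b j * v j) = (\<Sum>b'\<in>B. R b b' * (\<Sum>k<n. partial U k (G b') x0 * v k))"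
      by simp
    have "g b x' - g b x = (\<Sum>b'\<in>B. R b b' * (G b' x' - G b' x))"
      by (simp add: g_def sum_subtractf[symmetric] algebra_simps)
    also have "\<dots> = (\<Sum>b'\<in>B. R b b' * err b') + (v b + (\<Sum>j\<in>?J. c b j * v j))"
      unfolding vb by (simp add: err_def sum.distrib[symmetric] algebra_simps)
    finally have "g b x' - g b x - v b - (\<Sum>j\<in>?J. c b j * v j) = (\<Sum>b'\<in>B. R b b' * err b')" by simp
    also have "\<bar>\<dots>\<bar> \<le> (\<Sum>b'\<in>B. \<bar>R b b'\<bar> * (\<epsilon>0 * l1dist n x' x))"
    proof (rule order_trans[OF sum_abs sum_mono])
      fix b' assume "b' \<in> B"
      then have "\<bar>err b'\<bar> \<le> \<epsilon>0 * l1dist n x' x" unfolding err_def v_def using x by (rule strictG)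
      then show "\<bar>R b b' * err b'\<bar> \<le> \<bar>R b b'\<bar> * (\<epsilon>0 * l1dist n x' x)"
        unfolding abs_mult by (rule mult_left_mono) simp
    qed
    also have "\<dots> = (\<Sum>b'\<in>B. \<bar>R b b'\<bar>) * (\<epsilon>0 * l1dist n x' x)" by (simp only: sum_distrib_right)
    also have "\<dots> \<le> A * (\<epsilon>0 * l1dist n x' x)"
    proof (rule mult_right_mono)
      show "(\<Sum>b'\<in>B. \<bar>R b b'\<bar>) \<le> A"
        unfolding A_def using b finB by (intro member_le_sum[of b B "\<lambda>b. \<Sum>b'\<in>B. \<bar>R b b'\<bar>"]) (auto intro: sum_nonneg)
    qed (use \<epsilon>0 in simp)
    also have "\<dots> = (A * \<epsilon>0) * l1dist n x' x" by (simp only: mult.assoc)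
    also have "\<dots> \<le> \<kappa> * l1dist n x' x" using \<epsilon>0(2) by (rule mult_right_mono) simp
    finally show ?thesis by (simp only: v_def)
  qed
  have gdef: "definable_term S (\<lambda>e. g b (X e))" if "b \<in> B" "definable_point S n X" for b X
    unfolding g_def using GM that(2)
    by (intro definable_term_sum definable_term_mult definable_term_diff definable_term_const M_definable) auto
  have BJ: "B \<union> ?J = {..<n}" "B \<inter> ?J = {}" using B by auto
  have g0: "g b x0 = 0" for b by (simp add: g_def)
  obtain \<rho>' L where \<rho>': "0 < \<rho>'" and L: "0 \<le> L"
    and curve: "\<And>x1. x1 \<in> kspace n \<Longrightarrow> l1dist n x1 x0 < \<rho>' \<Longrightarrow> (\<forall>b\<in>B. g b x1 = 0) \<Longrightarrow>
      \<exists>\<gamma>. level_curve S n B ?J g x0 x1 \<rho> L \<gamma>"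
    by (rule implicit_curve[OF dc BJ gdef x0k \<rho> less_imp_le[OF \<kappa>(1)] \<kappa>(2) strict g0]) (assumption+, rule that)
  \<comment> \<open>The \<open>E b\<close> vanish outside \<open>B\<close>, so duality with the
    differentials of the pivots is an identity between square matrices: \<open>R\<close> is
    invertible, and zeros of \<open>g\<close> lie on the level set of \<open>G\<close> through
    \<open>x0\<close>.\<close>
  have G_const: "G b' x = G b' x0" if b': "b' \<in> B" and gx: "\<And>b. b \<in> B \<Longrightarrow> g b x = 0" for b' x
  proof -
    have 1: "(\<Sum>b\<in>B. partial U b (G b') x0 * R b b'') = (if b'' = b' then 1 else 0)" if "b'' \<in> B" for b''
    proof -
      have m1: "(\<Sum>i<n. E b'' i x0 * partial U i (G b') x0) = (\<Sum>i\<in>B. E b'' i x0 * partial U i (G b') x0)"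
        using fa[OF x0] that B unfolding frame_at_def by (intro sum.mono_neutral_right) auto
      have m2: "(\<Sum>i<n. E b'' i x0 * partial U i (G b') x0) = (if b'' = b' then \<delta> x0 else 0)"
        using fa[OF x0] that b' unfolding frame_at_def by blast
      have "(\<Sum>i\<in>B. E b'' i x0 * partial U i (G b') x0) / \<delta> x0 = (if b'' = b' then 1 else 0)"
        unfolding m2[unfolded m1] using \<delta>0 by simp
      then show ?thesis by (simp add: R_def sum_divide_distrib mult.commute)
    qed
    have "0 = (\<Sum>b\<in>B. partial U b (G b') x0 * g b x)" using gx by simp
    also have "\<dots> = (\<Sum>b\<in>B. \<Sum>b''\<in>B. partial U b (G b') x0 * R b b'' * (G b'' x - G b'' x0))"
      by (simp add: g_def sum_distrib_left mult.assoc)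
    also have "\<dots> = (\<Sum>b''\<in>B. (\<Sum>b\<in>B. partial U b (G b') x0 * R b b'') * (G b'' x - G b'' x0))"
      unfolding sum_distrib_right by (rule sum.swap)
    also have "\<dots> = (\<Sum>b''\<in>B. if b'' = b' then G b'' x - G b'' x0 else 0)"
      by (rule sum.cong) (simp_all add: 1)
    also have "\<dots> = G b' x - G b' x0" using finB b' by simp
    finally show ?thesis by simp
  qed
  show ?thesis
  proof (rule that[OF \<rho>'])
    fix x1 assume x1: "x1 \<in> kspace n" "l1dist n x1 x0 < \<rho>'" "\<forall>b\<in>B. G b x1 = G b x0"
    have "\<forall>b\<in>B. g b x1 = 0" using x1(3) by (simp add: g_def)
    from curve[OF x1(1,2) this] obtain \<gamma> where "level_curve S n B ?J g x0 x1 \<rho> L \<gamma>" ..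
    note C = this[unfolded level_curve_def]
    note \<gamma> = C[THEN conjunct1] C[THEN conjunct2, THEN conjunct1] C[THEN conjunct2, THEN conjunct2, THEN conjunct1]
      and \<gamma>1 = C[THEN conjunct2, THEN conjunct2, THEN conjunct2, THEN conjunct1, rule_format]
      and \<gamma>2 = C[THEN conjunct2, THEN conjunct2, THEN conjunct2, THEN conjunct2, rule_format]
    have \<gamma>k: "\<gamma> t \<in> kspace n" for t
      using \<gamma>(1) unfolding definable_point_def by (auto dest: spec[of _ "\<lambda>_. t"])
    have \<gamma>U: "\<gamma> t \<in> U" if "0 \<le> t" "t \<le> 1" for t using inU[OF \<gamma>k] \<gamma>1[OF that] by blast
    have \<gamma>G: "G b (\<gamma> t) = G b x0" if "0 \<le> t" "t \<le> 1" "b \<in> B" for t b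
      using G_const[OF that(3)] \<gamma>1[OF that(1,2)] by blast
    \<comment> \<open>The frame is now used at the point \<open>p\<close> of the curve. As the
      pivots are constant along the curve, their differentials at \<open>p\<close> kill the
      displacement to first order, and only the \<open>D j\<close> remain in the expansion of the
      differential of \<open>h\<close>.\<close>
    have deriv: "\<exists>d>0. \<forall>s. 0 \<le> s \<longrightarrow> s \<le> 1 \<longrightarrow> \<bar>s - t\<bar> < d \<longrightarrow>
        \<bar>\<delta> (\<gamma> t) * (h (\<gamma> s) - h (\<gamma> t)) -
          (s - t) * (\<Sum>j\<in>?J. (x1 j - x0 j) * der (D j) h (\<gamma> t))\<bar> \<le> \<epsilon> * \<bar>s - t\<bar>"
      if h: "h \<in> M" and t: "0 \<le> t" "t \<le> 1" and \<epsilon>: "0 < \<epsilon>" for h t \<epsilon>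
    proof -
      define p where "p = \<gamma> t"
      have p: "p \<in> U" "p \<in> kspace n" unfolding p_def using \<gamma>U[OF t] \<gamma>k by auto
      define Eh where "Eh b = (\<Sum>i<n. E b i p * partial U i h p)" for b
      define K where "K = \<bar>\<delta> p\<bar> + (\<Sum>b\<in>B. \<bar>Eh b\<bar>)"
      have K: "0 \<le> K" by (simp add: K_def sum_nonneg)
      \<comment> \<open>\<open>K\<close> collects the factors by which linearisation errors enter
        and \<open>L\<close> turns distance into parameter; the summand 1 guards against
        \<open>K * L = 0\<close>.\<close>
      define \<eta> where "\<eta> = \<epsilon> / (K * L + 1)"
      have KL: "0 < K * L + 1" using K L by (simp add: add_nonneg_pos)
      have \<eta>: "0 < \<eta>" "\<eta> * K * L \<le> \<epsilon>"
      proof -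
        show "0 < \<eta>" using \<epsilon> KL by (simp add: \<eta>_def)
        have "(K * L + 1) * \<eta> = \<epsilon>" using KL by (simp add: \<eta>_def)
        then show "\<eta> * K * L \<le> \<epsilon>" using \<open>0 < \<eta>\<close> by (simp add: algebra_simps)
      qed
      have "eventually (\<lambda>\<rho>. \<forall>f\<in>insert h (G ` B). \<forall>x\<in>kspace n. \<forall>x'\<in>kspace n.
          l1dist n x p < \<rho> \<longrightarrow> l1dist n x' p < \<rho> \<longrightarrow>
          \<bar>f x' - f x - (\<Sum>i<n. partial U i f p * (x' i - x i))\<bar> \<le> \<eta> * l1dist n x' x) (at_right 0)"
        by (rule eventually_ball_finite, simp add: finB, rule ballI,
            rule strict_derivative_eventually[OF _ p(1) \<eta>(1)]) (use h GM in auto)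
      then obtain \<rho>1 where \<rho>1: "0 < \<rho>1"
        and \<rho>1s: "\<forall>f\<in>insert h (G ` B). \<forall>x\<in>kspace n. \<forall>x'\<in>kspace n.
          l1dist n x p < \<rho>1 \<longrightarrow> l1dist n x' p < \<rho>1 \<longrightarrow>
          \<bar>f x' - f x - (\<Sum>i<n. partial U i f p * (x' i - x i))\<bar> \<le> \<eta> * l1dist n x' x"
        by (rule eventually_small) (rule that)
      have lin: "\<bar>f y - f p - (\<Sum>i<n. partial U i f p * (y i - p i))\<bar> \<le> \<eta> * l1dist n y p"
        if "f \<in> insert h (G ` B)" "y \<in> kspace n" "l1dist n y p < \<rho>1" for f y
        using bspec[OF bspec[OF bspec[OF \<rho>1s that(1)] p(2)] that(2)] that(3) \<rho>1 by simp
      show ?thesis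
      proof (intro exI[of _ "\<rho>1 / (L + 1)"] conjI allI impI)
        show "0 < \<rho>1 / (L + 1)" using \<rho>1 L by simp
        fix s assume s: "0 \<le> s" "s \<le> 1" "\<bar>s - t\<bar> < \<rho>1 / (L + 1)"
        define y where "y = \<gamma> s"
        define v where "v i = y i - p i" for i
        have y: "y \<in> kspace n" "l1dist n y p \<le> L * \<bar>s - t\<bar>"
          unfolding y_def p_def using \<gamma>k \<gamma>2[OF s(1,2) t] by auto
        have "(L + 1) * \<bar>s - t\<bar> < \<rho>1" using s(3) L by (simp add: pos_less_divide_eq mult.commute)
        then have yp: "l1dist n y p < \<rho>1" using y(2) by (simp add: algebra_simps)
        have vG: "\<bar>\<Sum>k<n. partial U k (G b) p * v k\<bar> \<le> \<eta> * l1dist n y p" if "b \<in> B" for b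
          using lin[of "G b" y] y(1) yp that \<gamma>G[OF t that] \<gamma>G[OF s(1,2) that]
          by (simp add: v_def y_def p_def)
        have vh: "\<bar>h y - h p - (\<Sum>k<n. partial U k h p * v k)\<bar> \<le> \<eta> * l1dist n y p"
          using lin[of h y] y(1) yp by (simp add: v_def)
        have vJ: "v j = (s - t) * (x1 j - x0 j)" if "j \<in> ?J" for j
        proof -
          have "y j = x0 j + s * (x1 j - x0 j)" "p j = x0 j + t * (x1 j - x0 j)"
            unfolding y_def p_def using \<gamma>1[OF s(1,2)] \<gamma>1[OF t] that by blast+
          then show ?thesis by (simp add: v_def algebra_simps)
        qed
        define T where "T = (\<Sum>j\<in>?J. v j * (\<Sum>i<n. D j i p * partial U i h p))"
        have T: "T = (s - t) * (\<Sum>j\<in>?J. (x1 j - x0 j) * der (D j) h p)"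
          unfolding T_def sum_distrib_left using p(1) by (intro sum.cong) (auto simp: vJ der_def mult.assoc sum_distrib_left)
        have cov: "\<delta> p * (\<Sum>k<n. partial U k h p * v k) = T + (\<Sum>b\<in>B. (\<Sum>k<n. partial U k (G b) p * v k) * Eh b)"
          unfolding T_def Eh_def by (rule frame_at_covector[OF fa[OF p(1)]])
        have "\<delta> p * (h y - h p) - T = \<delta> p * (h y - h p - (\<Sum>k<n. partial U k h p * v k)) +
            (\<Sum>b\<in>B. (\<Sum>k<n. partial U k (G b) p * v k) * Eh b)"
          using cov by (simp add: right_diff_distrib)
        also have "\<bar>\<dots>\<bar> \<le> \<bar>\<delta> p\<bar> * (\<eta> * l1dist n y p) + (\<Sum>b\<in>B. (\<eta> * l1dist n y p) * \<bar>Eh b\<bar>)"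
        proof (rule order_trans[OF abs_triangle_ineq], rule add_mono)
          show "\<bar>\<delta> p * (h y - h p - (\<Sum>k<n. partial U k h p * v k))\<bar> \<le> \<bar>\<delta> p\<bar> * (\<eta> * l1dist n y p)"
            unfolding abs_mult using vh by (rule mult_left_mono) simp
          show "\<bar>\<Sum>b\<in>B. (\<Sum>k<n. partial U k (G b) p * v k) * Eh b\<bar> \<le> (\<Sum>b\<in>B. (\<eta> * l1dist n y p) * \<bar>Eh b\<bar>)"
          proof (rule order_trans[OF sum_abs sum_mono])
            fix b assume "b \<in> B"
            then show "\<bar>(\<Sum>k<n. partial U k (G b) p * v k) * Eh b\<bar> \<le> (\<eta> * l1dist n y p) * \<bar>Eh b\<bar>"
              unfolding abs_mult by (intro mult_right_mono vG abs_ge_zero)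
          qed
        qed
        also have "\<dots> = (\<eta> * K) * l1dist n y p"
          unfolding K_def sum_distrib_left[symmetric] by (simp add: algebra_simps)
        also have "\<dots> \<le> (\<eta> * K) * (L * \<bar>s - t\<bar>)" using y(2) K \<eta>(1) by (intro mult_left_mono) auto
        also have "\<dots> = (\<eta> * K * L) * \<bar>s - t\<bar>" by (simp only: mult.assoc)
        also have "\<dots> \<le> \<epsilon> * \<bar>s - t\<bar>" using \<eta>(2) by (rule mult_right_mono) simp
        finally show "\<bar>\<delta> (\<gamma> t) * (h (\<gamma> s) - h (\<gamma> t)) -
          (s - t) * (\<Sum>j\<in>?J. (x1 j - x0 j) * der (D j) h (\<gamma> t))\<bar> \<le> \<epsilon> * \<bar>s - t\<bar>"
          unfolding T p_def y_def .
      qed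
    qed
    show "\<exists>\<gamma>. tangent_curve B D \<delta> x0 x1 r \<gamma>"
    proof (rule exI[of _ \<gamma>], unfold tangent_curve_def, intro conjI)
      show "\<forall>t. 0 \<le> t \<longrightarrow> t \<le> 1 \<longrightarrow> \<gamma> t \<in> U \<and> l1dist n (\<gamma> t) x0 < r"
        using \<gamma>U \<gamma>1 \<rho>r less_le_trans by blast
      show "\<forall>h t \<epsilon>. h \<in> M \<longrightarrow> 0 \<le> t \<longrightarrow> t \<le> 1 \<longrightarrow> 0 < \<epsilon> \<longrightarrow>
          (\<exists>d>0. \<forall>s. 0 \<le> s \<longrightarrow> s \<le> 1 \<longrightarrow> \<bar>s - t\<bar> < d \<longrightarrow>
            \<bar>\<delta> (\<gamma> t) * (h (\<gamma> s) - h (\<gamma> t)) -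
              (s - t) * (\<Sum>j\<in>?J. (x1 j - x0 j) * der (D j) h (\<gamma> t))\<bar> \<le> \<epsilon> * \<bar>s - t\<bar>)"
        by (intro allI impI) (rule deriv)
    qed (rule \<gamma>)+
  qed
qed

text \<open>
  Along a short curve \<open>\<bar>h'\<bar> \<le> \<mu>/2\<close> for all \<open>h \<in> A\<close> if \<open>\<bar>h\<bar> \<le> \<mu>\<close> for all \<open>h \<in> A\<close>, so the best bound
  is \<open>\<mu> = 0\<close> and the functions in \<open>A\<close> stay zero; hence so does \<open>f'\<close>.
\<close>

lemma locally_constant_on_level:
  assumes fr: "frame B G D E \<delta>" and x0: "x0 \<in> U" and \<delta>0: "\<delta> x0 \<noteq> 0"
    and A: "finite A" "A \<subseteq> M" and A0: "\<And>h. h \<in> A \<Longrightarrow> h x0 = 0"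
    and f: "f \<in> M"
    and c: "\<And>h j a. h \<in> insert f A \<Longrightarrow> j < n \<Longrightarrow> j \<notin> B \<Longrightarrow> a \<in> A \<Longrightarrow> c h j a \<in> M"
    and cc: "\<And>h j x. h \<in> insert f A \<Longrightarrow> j < n \<Longrightarrow> j \<notin> B \<Longrightarrow> x \<in> U \<Longrightarrow>
      der (D j) h x = (\<Sum>a\<in>A. c h j a x * a x)"
  obtains \<rho>' where "0 < \<rho>'"
    "\<And>x1. x1 \<in> kspace n \<Longrightarrow> l1dist n x1 x0 < \<rho>' \<Longrightarrow> (\<forall>b\<in>B. G b x1 = G b x0) \<Longrightarrow> f x1 = f x0"
proof -
  let ?J = "{..<n} - B"
  have \<delta>M: "\<delta> \<in> M" and B: "B \<subseteq> {..<n}" using fr unfolding frame_def by blast+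
  \<comment> \<open>Near \<open>x0\<close> the absolute value of \<open>\<delta>\<close> is at least
    this half.\<close>
  define q where "q = \<bar>\<delta> x0\<bar> / 2"
  have q: "0 < q" using \<delta>0 by (simp add: q_def)
  have one_pos: "(0::'a) < 1" by simp
  define I where "I = (A \<times> ?J) \<times> A"
  have finI: "finite I" using A(1) by (simp add: I_def)
  \<comment> \<open>The values at \<open>x0\<close> plus 1, the variation allowed by continuity,
    bound all coefficients near \<open>x0\<close>.\<close>
  define K where "K = (\<Sum>((h, j), a)\<in>I. \<bar>c h j a x0\<bar>) + 1"
  have K: "0 < K" by (simp add: K_def add_nonneg_pos sum_nonneg case_prod_beta)
  have cM: "c h j a \<in> M" if "((h, j), a) \<in> I" for h j a using that by (auto simp: I_def intro: c)
  have "eventually (\<lambda>\<rho>. (\<forall>i\<in>I. \<forall>x\<in>kspace n. l1dist n x x0 < \<rho> \<longrightarrow>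
        \<bar>c (fst (fst i)) (snd (fst i)) (snd i) x - c (fst (fst i)) (snd (fst i)) (snd i) x0\<bar> < 1) \<and>
      (\<forall>h\<in>A. \<forall>x\<in>kspace n. l1dist n x x0 < \<rho> \<longrightarrow> \<bar>h x - h x0\<bar> < 1) \<and>
      (\<forall>x\<in>kspace n. l1dist n x x0 < \<rho> \<longrightarrow> \<bar>\<delta> x - \<delta> x0\<bar> < q)) (at_right 0)"
  proof (rule eventually_conj[OF _ eventually_conj[OF _ M_continuous_eventually[OF \<delta>M x0 q]]])
    show "eventually (\<lambda>\<rho>. \<forall>i\<in>I. \<forall>x\<in>kspace n. l1dist n x x0 < \<rho> \<longrightarrow>
        \<bar>c (fst (fst i)) (snd (fst i)) (snd i) x - c (fst (fst i)) (snd (fst i)) (snd i) x0\<bar> < 1) (at_right 0)"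
      by (rule eventually_ball_finite[OF finI], rule ballI,
          rule M_continuous_eventually[OF _ x0 one_pos], rule cM) simp
    show "eventually (\<lambda>\<rho>. \<forall>h\<in>A. \<forall>x\<in>kspace n. l1dist n x x0 < \<rho> \<longrightarrow> \<bar>h x - h x0\<bar> < 1) (at_right 0)"
      by (rule eventually_ball_finite[OF A(1)], rule ballI,
          rule M_continuous_eventually[OF _ x0 one_pos], rule subsetD[OF A(2)])
  qed
  then obtain r where r: "0 < r" and r_all: "(\<forall>i\<in>I. \<forall>x\<in>kspace n. l1dist n x x0 < r \<longrightarrow>
        \<bar>c (fst (fst i)) (snd (fst i)) (snd i) x - c (fst (fst i)) (snd (fst i)) (snd i) x0\<bar> < 1) \<and>
      (\<forall>h\<in>A. \<forall>x\<in>kspace n. l1dist n x x0 < r \<longrightarrow> \<bar>h x - h x0\<bar> < 1) \<and>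
      (\<forall>x\<in>kspace n. l1dist n x x0 < r \<longrightarrow> \<bar>\<delta> x - \<delta> x0\<bar> < q)"
    by (rule eventually_small) (rule that)
  have c_bound: "\<bar>c h j a x\<bar> \<le> K"
    if "h \<in> A" "j \<in> ?J" "a \<in> A" "x \<in> kspace n" "l1dist n x x0 < r" for h j a x
  proof -
    have i: "((h, j), a) \<in> I" using that by (simp add: I_def)
    have "\<bar>c h j a x - c h j a x0\<bar> < 1"
      using bspec[OF bspec[OF conjunct1[OF r_all] i] that(4)] that(5) by simp
    moreover have "\<bar>c h j a x0\<bar> \<le> (\<Sum>((h, j), a)\<in>I. \<bar>c h j a x0\<bar>)"
      using member_le_sum[OF i, of "\<lambda>((h, j), a). \<bar>c h j a x0\<bar>"] finI by (simp add: case_prod_beta)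
    ultimately show ?thesis unfolding K_def by linarith
  qed
  have h_bound: "\<bar>h x\<bar> \<le> 1" if "h \<in> A" "x \<in> kspace n" "l1dist n x x0 < r" for h x
    using bspec[OF bspec[OF conjunct1[OF conjunct2[OF r_all]] that(1)] that(2)] that(3) A0[OF that(1)]
    by simp
  have \<delta>_bound: "q \<le> \<bar>\<delta> x\<bar>" if "x \<in> kspace n" "l1dist n x x0 < r" for x
  proof -
    have "\<bar>\<delta> x - \<delta> x0\<bar> < q"
      using bspec[OF conjunct2[OF conjunct2[OF r_all]] that(1)] that(2) by simp
    moreover have "\<bar>\<delta> x0\<bar> = q + q" by (simp add: q_def)
    ultimately show ?thesis by linarith
  qed
  obtain \<rho>0 where \<rho>0: "0 < \<rho>0"
    and curve: "\<And>x1. x1 \<in> kspace n \<Longrightarrow> l1dist n x1 x0 < \<rho>0 \<Longrightarrow> (\<forall>b\<in>B. G b x1 = G b x0) \<Longrightarrow>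
      \<exists>\<gamma>. tangent_curve B D \<delta> x0 x1 r \<gamma>"
    by (rule frame_curve[OF fr x0 \<delta>0 r]) (rule that)
  define N :: 'a where "N = of_nat (card A)"
  have N: "0 \<le> N" by (simp add: N_def)
  \<comment> \<open>If all functions in \<open>A\<close> are bounded by \<open>\<mu>\<close>, their
    derivatives along each \<open>D j\<close> are bounded by \<open>K * N * \<mu>\<close>. With
    total speed at most \<open>\<eta>\<close> this becomes at most \<open>q * \<mu> / 2\<close>, and
    dividing by \<open>\<delta>\<close> leaves \<open>\<mu> / 2\<close>. The summand 1 covers an
    empty \<open>A\<close>.\<close>
  define \<eta> where "\<eta> = q / (2 * K * (N + 1))"
  have \<eta>: "0 < \<eta>" "\<eta> * (K * N) \<le> q / 2"
  proof -
    have pos: "0 < 2 * K * (N + 1)" using K N by simp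
    then show "0 < \<eta>" using q unfolding \<eta>_def by simp
    have "\<eta> * (2 * K * (N + 1)) = q"
      using less_imp_neq[OF pos, THEN not_sym] nonzero_eq_divide_eq[of "2 * K * (N + 1)" \<eta> q] by (simp add: \<eta>_def)
    then have "2 * (\<eta> * (K * N)) + 2 * (\<eta> * K) = q" by (simp add: algebra_simps)
    moreover have "0 < \<eta> * K" using \<open>0 < \<eta>\<close> K by simp
    ultimately show "\<eta> * (K * N) \<le> q / 2" by simp
  qed
  show ?thesis
  proof (rule that[of "min \<rho>0 \<eta>"])
    show "0 < min \<rho>0 \<eta>" using \<rho>0 \<eta> by simp
    fix x1 assume x1: "x1 \<in> kspace n" "l1dist n x1 x0 < min \<rho>0 \<eta>" "\<forall>b\<in>B. G b x1 = G b x0"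
    have x1': "l1dist n x1 x0 < \<rho>0" "l1dist n x1 x0 \<le> \<eta>" using x1(2) by auto
    from curve[OF x1(1) x1'(1) x1(3)] obtain \<gamma> where "tangent_curve B D \<delta> x0 x1 r \<gamma>" ..
    note C = this[unfolded tangent_curve_def]
    note \<gamma>def = C[THEN conjunct1] and \<gamma>0 = C[THEN conjunct2, THEN conjunct1]
      and \<gamma>1 = C[THEN conjunct2, THEN conjunct2, THEN conjunct1]
      and \<gamma>Ur = C[THEN conjunct2, THEN conjunct2, THEN conjunct2, THEN conjunct1, rule_format]
      and deriv = C[THEN conjunct2, THEN conjunct2, THEN conjunct2, THEN conjunct2, rule_format]
    have \<gamma>U: "\<gamma> t \<in> U" and \<gamma>r: "l1dist n (\<gamma> t) x0 < r" and \<gamma>k: "\<gamma> t \<in> kspace n"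
      if "0 \<le> t" "t \<le> 1" for t
      using \<gamma>Ur[OF that] U_kspace by auto
    have along: "\<bar>h (\<gamma> t) - h x0\<bar> \<le> \<mu> * t"
      if h: "h \<in> M" and t: "0 \<le> t" "t \<le> 1" and \<mu>: "0 \<le> \<mu>"
        and b: "\<And>s. 0 \<le> s \<Longrightarrow> s \<le> 1 \<Longrightarrow> \<bar>\<Sum>j\<in>?J. (x1 j - x0 j) * der (D j) h (\<gamma> s)\<bar> \<le> \<mu> * q"
      for h t \<mu>
    proof -
      have "\<bar>h (\<gamma> t) - h (\<gamma> 0)\<bar> \<le> \<mu> * (t - 0)"
      proof (rule definable_lipschitz[OF dc M_definable[OF h \<gamma>def] t(1) \<mu>])
        fix s \<epsilon> :: 'a assume s: "0 \<le> s" "s \<le> t" and \<epsilon>: "0 < \<epsilon>"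
        have s1: "s \<le> 1" using s t by simp
        have "0 < \<epsilon> * q" using \<epsilon> q by simp
        from deriv[OF h s(1) s1 this] obtain d where d: "0 < d"
          "\<forall>u. 0 \<le> u \<longrightarrow> u \<le> 1 \<longrightarrow> \<bar>u - s\<bar> < d \<longrightarrow>
            \<bar>\<delta> (\<gamma> s) * (h (\<gamma> u) - h (\<gamma> s)) -
              (u - s) * (\<Sum>j\<in>?J. (x1 j - x0 j) * der (D j) h (\<gamma> s))\<bar> \<le> \<epsilon> * q * \<bar>u - s\<bar>"
          by (elim exE conjE)
        show "\<exists>d>0. \<forall>u. 0 \<le> u \<longrightarrow> u \<le> t \<longrightarrow> \<bar>u - s\<bar> < d \<longrightarrow> \<bar>h (\<gamma> u) - h (\<gamma> s)\<bar> \<le> (\<mu> + \<epsilon>) * \<bar>u - s\<bar>"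
        proof (intro exI[of _ d] conjI allI impI d(1))
          fix u assume u: "0 \<le> u" "u \<le> t" "\<bar>u - s\<bar> < d"
          define T where "T = (\<Sum>j\<in>?J. (x1 j - x0 j) * der (D j) h (\<gamma> s))"
          have 1: "\<bar>\<delta> (\<gamma> s) * (h (\<gamma> u) - h (\<gamma> s)) - (u - s) * T\<bar> \<le> \<epsilon> * q * \<bar>u - s\<bar>"
            unfolding T_def by (rule d(2)[rule_format]) (use u t in auto)
          have "\<bar>(u - s) * T\<bar> \<le> \<bar>u - s\<bar> * (\<mu> * q)"
            unfolding abs_mult T_def using b[OF s(1) s1] by (rule mult_left_mono) simp
          with 1 have "\<bar>\<delta> (\<gamma> s) * (h (\<gamma> u) - h (\<gamma> s))\<bar> \<le> \<epsilon> * q * \<bar>u - s\<bar> + \<bar>u - s\<bar> * (\<mu> * q)"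
            by linarith
          also have "\<dots> = q * ((\<mu> + \<epsilon>) * \<bar>u - s\<bar>)" by (simp add: algebra_simps)
          finally have "\<bar>\<delta> (\<gamma> s)\<bar> * \<bar>h (\<gamma> u) - h (\<gamma> s)\<bar> \<le> q * ((\<mu> + \<epsilon>) * \<bar>u - s\<bar>)"
            by (simp only: abs_mult)
          moreover have "q * \<bar>h (\<gamma> u) - h (\<gamma> s)\<bar> \<le> \<bar>\<delta> (\<gamma> s)\<bar> * \<bar>h (\<gamma> u) - h (\<gamma> s)\<bar>"
            by (rule mult_right_mono[OF \<delta>_bound[OF \<gamma>k[OF s(1) s1] \<gamma>r[OF s(1) s1]]]) simp
          ultimately have "q * \<bar>h (\<gamma> u) - h (\<gamma> s)\<bar> \<le> q * ((\<mu> + \<epsilon>) * \<bar>u - s\<bar>)" by (rule order_trans[rotated])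
          then show "\<bar>h (\<gamma> u) - h (\<gamma> s)\<bar> \<le> (\<mu> + \<epsilon>) * \<bar>u - s\<bar>"
            using q by (simp only: mult_le_cancel_left_pos)
        qed
      qed
      then show ?thesis by (simp add: \<gamma>0)
    qed
    have halve: "\<bar>h (\<gamma> t)\<bar> \<le> \<mu> / 2"
      if h: "h \<in> A" and t: "0 \<le> t" "t \<le> 1" and \<mu>: "0 \<le> \<mu>"
        and b: "\<forall>h\<in>A. \<forall>s. 0 \<le> s \<longrightarrow> s \<le> 1 \<longrightarrow> \<bar>h (\<gamma> s)\<bar> \<le> \<mu>" for h t \<mu>
    proof -
      have "\<bar>h (\<gamma> t) - h x0\<bar> \<le> (\<mu> / 2) * t"
      proof (rule along[OF subsetD[OF A(2) h] t])
        fix s :: 'a assume s: "0 \<le> s" "s \<le> 1"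
        have D: "\<bar>der (D j) h (\<gamma> s)\<bar> \<le> K * N * \<mu>" if j: "j \<in> ?J" for j
        proof -
          have "\<bar>der (D j) h (\<gamma> s)\<bar> = \<bar>\<Sum>a\<in>A. c h j a (\<gamma> s) * a (\<gamma> s)\<bar>"
            by (subst cc) (use h j \<gamma>U[OF s] in auto)
          also have "\<dots> \<le> (\<Sum>a\<in>A. K * \<mu>)"
          proof (rule order_trans[OF sum_abs sum_mono])
            fix a assume a: "a \<in> A"
            show "\<bar>c h j a (\<gamma> s) * a (\<gamma> s)\<bar> \<le> K * \<mu>"
              unfolding abs_mult
            proof (rule mult_mono)
              show "\<bar>c h j a (\<gamma> s)\<bar> \<le> K" by (rule c_bound[OF h j a \<gamma>k[OF s] \<gamma>r[OF s]])
              show "\<bar>a (\<gamma> s)\<bar> \<le> \<mu>" using b a s by blast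
            qed (use K in simp_all)
          qed
          also have "\<dots> = K * N * \<mu>" by (simp add: N_def)
          finally show ?thesis .
        qed
        have "\<bar>\<Sum>j\<in>?J. (x1 j - x0 j) * der (D j) h (\<gamma> s)\<bar> \<le> (\<Sum>j\<in>?J. \<bar>x1 j - x0 j\<bar> * (K * N * \<mu>))"
        proof (rule order_trans[OF sum_abs sum_mono])
          fix j assume "j \<in> ?J"
          then show "\<bar>(x1 j - x0 j) * der (D j) h (\<gamma> s)\<bar> \<le> \<bar>x1 j - x0 j\<bar> * (K * N * \<mu>)"
            unfolding abs_mult by (intro mult_left_mono D abs_ge_zero)
        qed
        also have "\<dots> = (\<Sum>j\<in>?J. \<bar>x1 j - x0 j\<bar>) * (K * N * \<mu>)" by (simp only: sum_distrib_right)
        also have "\<dots> \<le> \<eta> * (K * N * \<mu>)"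
        proof (rule mult_right_mono)
          have "(\<Sum>j\<in>?J. \<bar>x1 j - x0 j\<bar>) \<le> l1dist n x1 x0"
            unfolding l1dist_def by (rule sum_mono2) auto
          then show "(\<Sum>j\<in>?J. \<bar>x1 j - x0 j\<bar>) \<le> \<eta>" using x1'(2) by (rule order_trans)
        qed (use K N \<mu> in simp)
        also have "\<dots> = (\<eta> * (K * N)) * \<mu>" by (simp only: mult.assoc)
        also have "\<dots> \<le> (q / 2) * \<mu>" by (rule mult_right_mono[OF \<eta>(2) \<mu>])
        finally show "\<bar>\<Sum>j\<in>?J. (x1 j - x0 j) * der (D j) h (\<gamma> s)\<bar> \<le> \<mu> / 2 * q" by (simp add: mult.commute)
      qed (use \<mu> in simp)
      also have "\<dots> \<le> \<mu> / 2" using t \<mu> by (simp add: mult_left_le)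
      finally show ?thesis using A0[OF h] by simp
    qed
    have zero: "h (\<gamma> t) = 0" if h: "h \<in> A" and t: "0 \<le> t" "t \<le> 1" for h t
    proof -
      \<comment> \<open>Bounds are negated to form a supremum: it is minus the best common bound of
        the functions in \<open>A\<close> along the curve, and \<open>halve\<close> forces it to be
        0.\<close>
      define Q where "Q a \<longleftrightarrow> a \<le> 0 \<and> (\<forall>h\<in>A. \<forall>s. 0 \<le> s \<longrightarrow> s \<le> 1 \<longrightarrow> \<bar>h (\<gamma> s)\<bar> \<le> - a)" for a
      have hd: "definable_term S (\<lambda>e. h (\<gamma> (e i)))" if "h \<in> A" for h i
        using definable_term_shift[OF M_definable[OF subsetD[OF A(2) that] \<gamma>def], of "\<lambda>_. i"] .
      have Qdef: "definable_pred S (\<lambda>e. Q (e 0))"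
        unfolding Q_def
        by (intro definability definable_pred_ball_finite[OF A(1)] hd)
      have "\<forall>h\<in>A. \<forall>s. 0 \<le> s \<longrightarrow> s \<le> 1 \<longrightarrow> \<bar>h (\<gamma> s)\<bar> \<le> 1"
        by (intro ballI allI impI h_bound \<gamma>k \<gamma>r)
      then have Q1: "Q (- 1)" by (simp add: Q_def)
      have Qle: "a \<le> 0" if "Q a" for a using that by (simp add: Q_def)
      obtain s where s: "\<And>a. Q a \<Longrightarrow> a \<le> s" "\<And>u. (\<And>a. Q a \<Longrightarrow> a \<le> u) \<Longrightarrow> s \<le> u"
        using Qdef Q1 Qle definable_sup[OF dc, of Q "- 1" 0] by blast
      have half: "Q (a / 2)" if "Q a" for a
        using that halve[where \<mu> = "- a"] by (simp add: Q_def)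
      have "\<not> s < 0"
      proof
        assume "s < 0"
        then have "\<not> s \<le> 2 * s" by simp
        then obtain a where a: "Q a" "2 * s < a" using s(2)[of "2 * s"] by (meson not_le)
        have "a / 2 \<le> s" by (rule s(1)[OF half[OF a(1)]])
        with a(2) show False by simp
      qed
      have "\<bar>h (\<gamma> t)\<bar> \<le> 0 + \<epsilon>" if "0 < \<epsilon>" for \<epsilon>
      proof -
        have "\<not> s \<le> - \<epsilon>" using \<open>\<not> s < 0\<close> that by simp
        then obtain a where a: "Q a" "- \<epsilon> < a" using s(2)[of "- \<epsilon>"] by (meson not_le)
        have "\<bar>h (\<gamma> t)\<bar> \<le> - a" using a(1) h t unfolding Q_def by blast
        with a(2) show ?thesis by simp
      qed
      then have "\<bar>h (\<gamma> t)\<bar> \<le> 0" by (rule field_le_epsilon)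
      then show ?thesis by simp
    qed
    have "\<bar>f (\<gamma> 1) - f x0\<bar> \<le> 0 * 1"
    proof (rule along[OF f])
      fix s :: 'a assume s: "0 \<le> s" "s \<le> 1"
      have "der (D j) f (\<gamma> s) = 0" if "j \<in> ?J" for j
        using that zero[OF _ s] \<gamma>U[OF s] by (subst cc) auto
      then show "\<bar>\<Sum>j\<in>?J. (x1 j - x0 j) * der (D j) f (\<gamma> s)\<bar> \<le> 0 * q" by simp
    qed simp_all
    then show "f x1 = f x0" by (simp add: \<gamma>1)
  qed
qed

end

section \<open>Ideals and adapted frames\<close>

context definable_differential_ring
begin

abbreviation M_ring :: "((nat \<Rightarrow> 'a) \<Rightarrow> 'a) ring" where
  "M_ring \<equiv> (smooth_ring S n U)\<lparr>carrier := M\<rparr>"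

lemma M_subring: "subring M (smooth_ring S n U)" and M_noetherian: "noetherian_ring M_ring"
  using M by (simp_all add: noetherian_differential_ring_def)

lemma M_add: "f \<in> M \<Longrightarrow> g \<in> M \<Longrightarrow> (\<lambda>x\<in>U. f x + g x) \<in> M"
  using subgroup.m_closed[OF subring.axioms(1)[OF M_subring], of f g] by (simp add: smooth_ring_def)

lemma M_mult: "f \<in> M \<Longrightarrow> g \<in> M \<Longrightarrow> (\<lambda>x\<in>U. f x * g x) \<in> M"
  using submonoid.m_closed[OF subring.axioms(2)[OF M_subring], of f g] by (simp add: smooth_ring_def)

lemma M_const: "(\<lambda>x\<in>U. c) \<in> M"
  using M polynomial_functions.const unfolding noetherian_differential_ring_def by blast

lemma M_diff:
  assumes "f \<in> M" "g \<in> M" shows "(\<lambda>x\<in>U. f x - g x) \<in> M"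
  by (rule restrict_mem_cong[OF M_add[OF assms(1) M_mult[OF M_const[of "-1"] assms(2)]]]) simp

lemma M_sum:
  assumes "\<And>i. i \<in> A \<Longrightarrow> f i \<in> M" shows "(\<lambda>x\<in>U. \<Sum>i\<in>A. f i x) \<in> M"
  using assms
proof (induction A rule: infinite_finite_induct)
  case (insert a A)
  then have "(\<lambda>x\<in>U. f a x + (\<lambda>x\<in>U. \<Sum>i\<in>A. f i x) x) \<in> M" by (intro M_add) auto
  then show ?case by (rule restrict_mem_cong) (simp add: insert.hyps)
qed (simp_all add: M_const)

lemma der_mem:
  assumes "\<And>i. i < n \<Longrightarrow> X i \<in> M" "h \<in> M" shows "der X h \<in> M"
proof -
  have "(\<lambda>x\<in>U. \<Sum>i\<in>{..<n}. (\<lambda>x\<in>U. X i x * partial U i h x) x) \<in> M"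
    by (intro M_sum M_mult M_partial assms) auto
  then show ?thesis unfolding der_def by (rule restrict_mem_cong) simp
qed

text \<open>Pointwise form of an ideal of \<open>M\<close>; \<open>fun_ideal_imp_ideal\<close>
  connects it with the algebraic notion, through which the chain condition and finite generation
  enter.\<close>

definition fun_ideal :: "((nat \<Rightarrow> 'a) \<Rightarrow> 'a) set \<Rightarrow> bool" where
  "fun_ideal I \<longleftrightarrow> I \<subseteq> M \<and> (\<lambda>x\<in>U. 0) \<in> I \<and>
     (\<forall>f\<in>I. \<forall>g\<in>I. (\<lambda>x\<in>U. f x + g x) \<in> I) \<and> (\<forall>f\<in>M. \<forall>g\<in>I. (\<lambda>x\<in>U. f x * g x) \<in> I)"

lemma fun_ideal_diff:
  assumes "fun_ideal I" "f \<in> I" "g \<in> I" shows "(\<lambda>x\<in>U. f x - g x) \<in> I"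
proof -
  have "(\<lambda>x\<in>U. (\<lambda>x\<in>U. - 1) x * g x) \<in> I" using assms M_const unfolding fun_ideal_def by blast
  then have "(\<lambda>x\<in>U. f x + (\<lambda>x\<in>U. (\<lambda>x\<in>U. - 1) x * g x) x) \<in> I"
    using assms unfolding fun_ideal_def by blast
  then show ?thesis by (rule restrict_mem_cong) simp
qed

lemma fun_ideal_imp_ideal:
  assumes I: "fun_ideal I" shows "ideal I M_ring"
proof -
  interpret R: noetherian_ring M_ring by (rule M_noetherian)
  have IM: "I \<subseteq> M" and zero: "(\<lambda>x\<in>U. 0) \<in> I"
    and add: "\<And>f g. f \<in> I \<Longrightarrow> g \<in> I \<Longrightarrow> (\<lambda>x\<in>U. f x + g x) \<in> I"
    and mult: "\<And>f g. f \<in> M \<Longrightarrow> g \<in> I \<Longrightarrow> (\<lambda>x\<in>U. f x * g x) \<in> I"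
    using I unfolding fun_ideal_def by blast+
  have minus: "(\<lambda>x\<in>U. - f x) \<in> I" if "f \<in> I" for f
    by (rule restrict_mem_cong[OF mult[OF M_const[of "-1"] that]]) simp
  have a_inv: "a_inv M_ring f = (\<lambda>x\<in>U. - f x)" if "f \<in> I" for f
  proof (rule R.minus_equality)
    show "(\<lambda>x\<in>U. - f x) \<oplus>\<^bsub>M_ring\<^esub> f = \<zero>\<^bsub>M_ring\<^esub>"
      by (simp add: smooth_ring_def cong: restrict_cong)
    show "f \<in> carrier M_ring" using that IM by auto
    show "(\<lambda>x\<in>U. - f x) \<in> carrier M_ring" using minus[OF that] IM by auto
  qed
  show ?thesis
  proof (rule idealI[OF R.ring_axioms])
    show "subgroup I (add_monoid M_ring)"
    proof
      show "I \<subseteq> carrier (add_monoid M_ring)" using IM by simp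
      show "x \<otimes>\<^bsub>add_monoid M_ring\<^esub> y \<in> I" if "x \<in> I" "y \<in> I" for x y
        using add[OF that] by (simp add: smooth_ring_def)
      show "\<one>\<^bsub>add_monoid M_ring\<^esub> \<in> I" using zero by (simp add: smooth_ring_def)
      show "inv\<^bsub>add_monoid M_ring\<^esub> x \<in> I" if "x \<in> I" for x
        using minus[OF that] a_inv[OF that] by (simp add: a_inv_def)
    qed
    fix a x assume a: "a \<in> I" and x: "x \<in> carrier M_ring"
    then have xa: "(\<lambda>y\<in>U. x y * a y) \<in> I" by (intro mult) auto
    then show "x \<otimes>\<^bsub>M_ring\<^esub> a \<in> I" by (simp add: smooth_ring_def)
    from xa show "a \<otimes>\<^bsub>M_ring\<^esub> x \<in> I" by (simp add: smooth_ring_def mult.commute)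
  qed
qed

text \<open>The linear combinations of \<open>A\<close> form an ideal containing \<open>A\<close>,
  hence containing the ideal generated by \<open>A\<close>. The coefficients are wanted as functions
  in \<open>M\<close> because they become the matrix of the linear system along a curve and must be
  continuous.\<close>

lemma fun_ideal_generators:
  assumes I: "fun_ideal I"
  obtains A where "finite A" "A \<subseteq> I"
    "\<And>h. h \<in> I \<Longrightarrow> \<exists>c. (\<forall>a\<in>A. c a \<in> M) \<and> (\<forall>x\<in>U. h x = (\<Sum>a\<in>A. c a x * a x))"
proof -
  interpret R: noetherian_ring M_ring by (rule M_noetherian)
  obtain A where A: "A \<subseteq> carrier M_ring" "finite A" "I = genideal M_ring A"
    using R.finetely_gen[OF fun_ideal_imp_ideal[OF I]] by blast
  have AM: "A \<subseteq> M" using A(1) by simp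
  have AI: "A \<subseteq> I" using R.genideal_self[OF A(1)] A(3) by simp
  define P where "P h c \<longleftrightarrow> (\<forall>a\<in>A. c a \<in> M) \<and> (\<forall>x\<in>U. h x = (\<Sum>a\<in>A. c a x * a x))" for h and c :: "_ \<Rightarrow> (nat \<Rightarrow> 'a) \<Rightarrow> 'a"
  define J where "J = {h \<in> M. \<exists>c. P h c}"
  have "fun_ideal J"
    unfolding fun_ideal_def
  proof (intro conjI ballI)
    show "J \<subseteq> M" by (auto simp: J_def)
    have "P (\<lambda>x\<in>U. 0) (\<lambda>a. \<lambda>x\<in>U. 0)" by (simp add: P_def M_const)
    then show "(\<lambda>x\<in>U. 0) \<in> J" using M_const by (auto simp: J_def)
    fix f g assume "f \<in> J" "g \<in> J"
    then obtain c d where "f \<in> M" "g \<in> M" and cd: "P f c" "P g d" by (auto simp: J_def)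
    moreover have "P (\<lambda>x\<in>U. f x + g x) (\<lambda>a. \<lambda>x\<in>U. c a x + d a x)"
      using cd by (simp add: P_def M_add sum.distrib distrib_right)
    ultimately show "(\<lambda>x\<in>U. f x + g x) \<in> J" using M_add unfolding J_def by blast
  next
    fix f g assume "f \<in> M" "g \<in> J"
    then obtain c where "f \<in> M" "g \<in> M" and c: "P g c" by (auto simp: J_def)
    moreover have "P (\<lambda>x\<in>U. f x * g x) (\<lambda>a. \<lambda>x\<in>U. f x * c a x)"
      using c \<open>f \<in> M\<close> by (simp add: P_def M_mult sum_distrib_left mult.assoc)
    ultimately show "(\<lambda>x\<in>U. f x * g x) \<in> J" using M_mult unfolding J_def by blast
  qed
  moreover have "A \<subseteq> J"
  proof
    fix a assume a: "a \<in> A"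
    have "P a (\<lambda>a'. \<lambda>x\<in>U. if a' = a then 1 else 0)"
      unfolding P_def
    proof (intro conjI ballI)
      show "(\<lambda>x\<in>U. if a' = a then 1 else 0) \<in> M" for a' using M_const by simp
      fix x assume "x \<in> U"
      then have "(\<Sum>a'\<in>A. (\<lambda>x\<in>U. if a' = a then 1 else 0) x * a' x) = (\<Sum>a'\<in>A. if a' = a then a' x else 0)"
        by (intro sum.cong) auto
      then show "a x = (\<Sum>a'\<in>A. (\<lambda>x\<in>U. if a' = a then 1 else 0) x * a' x)" using A(2) a by simp
    qed
    then show "a \<in> J" using a AM unfolding J_def by blast
  qed
  ultimately have "I \<subseteq> J" using R.genideal_minimal[OF fun_ideal_imp_ideal] A(3) by simp
  show ?thesis
  proof (rule that[OF A(2) AI])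
    fix h assume "h \<in> I"
    then have "h \<in> J" using \<open>I \<subseteq> J\<close> by blast
    then show "\<exists>c. (\<forall>a\<in>A. c a \<in> M) \<and> (\<forall>x\<in>U. h x = (\<Sum>a\<in>A. c a x * a x))"
      by (simp add: J_def P_def)
  qed
qed

text \<open>Zorn's lemma gives a maximal counterexample, because the union of a nonempty chain of
  ideals of a Noetherian ring belongs to the chain.\<close>

lemma fun_ideal_induct:
  assumes step: "\<And>I. fun_ideal I \<Longrightarrow> (\<And>J. fun_ideal J \<Longrightarrow> I \<subset> J \<Longrightarrow> P J) \<Longrightarrow> P I"
    and I: "fun_ideal I"
  shows "P I"
proof (rule ccontr)
  assume "\<not> P I"
  interpret R: noetherian_ring M_ring by (rule M_noetherian)
  define \<A> where "\<A> = {J. fun_ideal J \<and> \<not> P J}"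
  have "\<exists>J\<in>\<A>. \<forall>X\<in>\<A>. J \<subseteq> X \<longrightarrow> X = J"
  proof (rule subset_Zorn_nonempty)
    show "\<A> \<noteq> {}" using I \<open>\<not> P I\<close> by (auto simp: \<A>_def)
    fix \<C> assume C: "\<C> \<noteq> {}" "subset.chain \<A> \<C>"
    have "\<A> \<subseteq> {I. ideal I M_ring}" using fun_ideal_imp_ideal by (auto simp: \<A>_def)
    with C(2) have "subset.chain {I. ideal I M_ring} \<C>" by (auto simp: pred_on.chain_def)
    from R.ideal_chain_is_trivial[OF C(1) this] show "\<Union>\<C> \<in> \<A>"
      using C(2) by (auto simp: pred_on.chain_def)
  qed
  then obtain J where J: "fun_ideal J" "\<not> P J" "\<And>X. fun_ideal X \<Longrightarrow> \<not> P X \<Longrightarrow> J \<subseteq> X \<Longrightarrow> X = J"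
    unfolding \<A>_def by blast
  show False using step[OF J(1)] J(2,3) by blast
qed

definition zeros :: "((nat \<Rightarrow> 'a) \<Rightarrow> 'a) set \<Rightarrow> (nat \<Rightarrow> 'a) set" where
  "zeros I = {x \<in> U. \<forall>h\<in>I. h x = 0}"

text \<open>The sum of \<open>I\<close> and the multiples of \<open>a\<close>: every
  \<open>f + g * a\<close> vanishes where \<open>I\<close> and \<open>a\<close> do.\<close>

lemma fun_ideal_adjoin:
  assumes I: "fun_ideal I" and a: "a \<in> M" "a \<notin> I"
  obtains J where "fun_ideal J" "I \<subset> J" "\<And>x. x \<in> zeros I \<Longrightarrow> a x = 0 \<Longrightarrow> x \<in> zeros J"
proof -
  have IM: "I \<subseteq> M" and zero: "(\<lambda>x\<in>U. 0) \<in> I"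
    and add: "\<And>f g. f \<in> I \<Longrightarrow> g \<in> I \<Longrightarrow> (\<lambda>x\<in>U. f x + g x) \<in> I"
    and mult: "\<And>f g. f \<in> M \<Longrightarrow> g \<in> I \<Longrightarrow> (\<lambda>x\<in>U. f x * g x) \<in> I"
    using I unfolding fun_ideal_def by blast+
  define c where "c f g = (\<lambda>x\<in>U. f x + g x * a x)" for f g :: "(nat \<Rightarrow> 'a) \<Rightarrow> 'a"
  define J where "J = {c f g | f g. f \<in> I \<and> g \<in> M}"
  have JI: "c f g \<in> J" if "f \<in> I" "g \<in> M" for f g using that by (auto simp: J_def)
  have cM: "c f g \<in> M" if "f \<in> I" "g \<in> M" for f g
    unfolding c_def
    by (rule restrict_mem_cong[OF M_add[OF subsetD[OF IM that(1)] M_mult[OF that(2) a(1)]]]) simp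
  have fI: "f \<in> J" if "f \<in> I" for f
  proof -
    have "c f (\<lambda>x\<in>U. 0) = f"
      using M_extensional[of f] that IM by (auto simp: c_def extensional_def fun_eq_iff)
    then show ?thesis using JI[OF that M_const[of 0]] by simp
  qed
  have aJ: "a \<in> J"
  proof -
    have "c (\<lambda>x\<in>U. 0) (\<lambda>x\<in>U. 1) = a"
      using M_extensional[OF a(1)] by (auto simp: c_def extensional_def fun_eq_iff)
    then show ?thesis using JI[OF zero M_const[of 1]] by simp
  qed
  show ?thesis
  proof (rule that)
    show "fun_ideal J"
      unfolding fun_ideal_def
    proof (intro conjI ballI)
      show "J \<subseteq> M" using cM by (auto simp: J_def)
      show "(\<lambda>x\<in>U. 0) \<in> J" using fI zero by blast
      fix p q assume "p \<in> J" "q \<in> J"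
      then obtain f g f' g' where pq: "f \<in> I" "g \<in> M" "p = c f g" "f' \<in> I" "g' \<in> M" "q = c f' g'"
        unfolding J_def by blast
      have "(\<lambda>x\<in>U. p x + q x) = c (\<lambda>x\<in>U. f x + f' x) (\<lambda>x\<in>U. g x + g' x)"
        unfolding pq c_def by (auto simp: fun_eq_iff algebra_simps)
      then show "(\<lambda>x\<in>U. p x + q x) \<in> J" using JI add M_add pq by simp
    next
      fix p q assume "p \<in> M" "q \<in> J"
      then obtain f g where pq: "f \<in> I" "g \<in> M" "q = c f g" unfolding J_def by blast
      have "(\<lambda>x\<in>U. p x * q x) = c (\<lambda>x\<in>U. p x * f x) (\<lambda>x\<in>U. p x * g x)"
        unfolding pq c_def by (auto simp: fun_eq_iff algebra_simps)
      then show "(\<lambda>x\<in>U. p x * q x) \<in> J" using JI mult M_mult pq \<open>p \<in> M\<close> by simp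
    qed
    show "I \<subset> J" using fI aJ a(2) by blast
    show "x \<in> zeros J" if "x \<in> zeros I" "a x = 0" for x
      using that unfolding zeros_def J_def c_def by auto
  qed
qed

text \<open>The elimination step for functions in \<open>M\<close>. The last three claims express
  the new derivations through the old ones, so that stability of an ideal can be carried
  over.\<close>

lemma frame_extend:
  assumes fr: "frame B G D E \<delta>" and g: "g \<in> M" and j0: "j0 < n" "j0 \<notin> B"
  defines "p \<equiv> der (D j0) g"
  defines "D' \<equiv> \<lambda>j i. \<lambda>x\<in>U. p x * D j i x - der (D j) g x * D j0 i x"
  defines "E' \<equiv> \<lambda>b i. \<lambda>x\<in>U. if b = j0 then \<delta> x * D j0 i x else p x * E b i x - der (E b) g x * D j0 i x"
  shows "frame (insert j0 B) (G(j0 := g)) D' E' (\<lambda>x\<in>U. p x * \<delta> x)"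
    and "\<And>j h. der (D' j) h = (\<lambda>x\<in>U. p x * der (D j) h x - der (D j) g x * der (D j0) h x)"
    and "\<And>b h. b \<noteq> j0 \<Longrightarrow> der (E' b) h = (\<lambda>x\<in>U. p x * der (E b) h x - der (E b) g x * der (D j0) h x)"
    and "\<And>h. der (E' j0) h = (\<lambda>x\<in>U. \<delta> x * der (D j0) h x)"
proof -
  have B: "B \<subseteq> {..<n}" and GM: "\<And>b. b \<in> B \<Longrightarrow> G b \<in> M"
    and DM: "\<And>j i. j < n \<Longrightarrow> i < n \<Longrightarrow> D j i \<in> M" and EM: "\<And>b i. b \<in> B \<Longrightarrow> i < n \<Longrightarrow> E b i \<in> M"
    and \<delta>M: "\<delta> \<in> M"
    and fa: "\<And>x. x \<in> U \<Longrightarrow> frame_at n B (\<lambda>b k. partial U k (G b) x) (\<lambda>j i. D j i x) (\<lambda>b i. E b i x) (\<delta> x)"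
    using fr unfolding frame_def by blast+
  have pM: "p \<in> M" unfolding p_def using DM[OF j0(1)] g by (rule der_mem)
  have D'M: "D' j i \<in> M" if "j < n" "i < n" for j i
  proof -
    have "der (D j) g \<in> M" using DM that(1) g by (intro der_mem)
    from M_diff[OF M_mult[OF pM DM[OF that]] M_mult[OF this DM[OF j0(1) that(2)]]]
    show ?thesis unfolding D'_def by (rule restrict_mem_cong) simp
  qed
  have E'M: "E' b i \<in> M" if "b \<in> insert j0 B" "i < n" for b i
  proof (cases "b = j0")
    case True
    then show ?thesis using M_mult[OF \<delta>M DM[OF j0(1) that(2)]] by (simp add: E'_def)
  next
    case False
    then have b: "b \<in> B" using that by simp
    have "der (E b) g \<in> M" using EM b g by (intro der_mem)
    from M_diff[OF M_mult[OF pM EM[OF b that(2)]] M_mult[OF this DM[OF j0(1) that(2)]]]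
    show ?thesis unfolding E'_def by (rule restrict_mem_cong) (simp add: False)
  qed
  show "frame (insert j0 B) (G(j0 := g)) D' E' (\<lambda>x\<in>U. p x * \<delta> x)"
    unfolding frame_def
  proof (intro conjI ballI allI impI)
    show "insert j0 B \<subseteq> {..<n}" using B j0 by simp
    show "(G(j0 := g)) b \<in> M" if "b \<in> insert j0 B" for b using that GM g by auto
    show "D' j i \<in> M" if "j < n" "i < n" for j i using that by (rule D'M)
    show "E' b i \<in> M" if "b \<in> insert j0 B" "i < n" for b i using that by (rule E'M)
    show "(\<lambda>x\<in>U. p x * \<delta> x) \<in> M" by (rule M_mult[OF pM \<delta>M])
    fix x assume x: "x \<in> U"
    show "frame_at n (insert j0 B) (\<lambda>b k. partial U k ((G(j0 := g)) b) x) (\<lambda>j i. D' j i x) (\<lambda>b i. E' b i x)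
      ((\<lambda>x\<in>U. p x * \<delta> x) x)"
      by (rule frame_at_cong[OF frame_at_extend[OF fa[OF x] B j0, where dg = "\<lambda>k. partial U k g x"]])
        (use x in \<open>auto simp: D'_def E'_def p_def der_def\<close>)
  qed
  show "der (D' j) h = (\<lambda>x\<in>U. p x * der (D j) h x - der (D j) g x * der (D j0) h x)" for j h
    unfolding der_def[of "D' j"]
    by (rule restrict_ext) (simp add: D'_def der_def[of _ h] sum_distrib_left sum_subtractf left_diff_distrib mult.assoc)
  show "der (E' b) h = (\<lambda>x\<in>U. p x * der (E b) h x - der (E b) g x * der (D j0) h x)" if "b \<noteq> j0" for b h
    unfolding der_def[of "E' b"] using that
    by (intro restrict_ext) (simp add: E'_def der_def[of _ h] sum_distrib_left sum_subtractf left_diff_distrib mult.assoc)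
  show "der (E' j0) h = (\<lambda>x\<in>U. \<delta> x * der (D j0) h x)" for h
    unfolding der_def[of "E' j0"]
    by (rule restrict_ext) (simp add: E'_def der_def[of _ h] sum_distrib_left mult.assoc)
qed

lemma frame_start: "frame {} G (\<lambda>j i. \<lambda>x\<in>U. if i = j then 1 else 0) (\<lambda>b i. \<lambda>x\<in>U. 0) (\<lambda>x\<in>U. 1)"
  unfolding frame_def
proof (intro conjI ballI allI impI)
  show "(\<lambda>x\<in>U. if i = j then 1 else 0) \<in> M" for i j :: nat
    using M_const[of 1] M_const[of 0] by (cases "i = j") auto
  show "frame_at n {} (\<lambda>b k. partial U k (G b) x) (\<lambda>j i. (\<lambda>x\<in>U. if i = j then 1 else 0) x)
    (\<lambda>b i. (\<lambda>x\<in>U. 0) x) ((\<lambda>x\<in>U. 1) x)" if "x \<in> U" for x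
    using frame_at_start[of n "\<lambda>b k. partial U k (G b) x" "\<lambda>_ _. 0"] that by simp
qed (simp_all add: M_const)

text \<open>
  For a prime ideal \<open>I\<close>: pivots are taken from \<open>I\<close> as long as possible, and then from \<open>F\<close>. The pivots
  in \<open>B2\<close> are those taken from \<open>F\<close>.
\<close>

definition adapted :: "((nat \<Rightarrow> 'a) \<Rightarrow> 'a) set \<Rightarrow> nat \<Rightarrow> (nat \<Rightarrow> (nat \<Rightarrow> 'a) \<Rightarrow> 'a) \<Rightarrow> nat set \<Rightarrow>
    (nat \<Rightarrow> nat) \<Rightarrow> nat set \<Rightarrow> (nat \<Rightarrow> (nat \<Rightarrow> 'a) \<Rightarrow> 'a) \<Rightarrow> (nat \<Rightarrow> nat \<Rightarrow> (nat \<Rightarrow> 'a) \<Rightarrow> 'a) \<Rightarrow>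
    (nat \<Rightarrow> nat \<Rightarrow> (nat \<Rightarrow> 'a) \<Rightarrow> 'a) \<Rightarrow> ((nat \<Rightarrow> 'a) \<Rightarrow> 'a) \<Rightarrow> bool" where
  "adapted I m F B2 \<sigma> B G D E \<delta> \<longleftrightarrow> frame B G D E \<delta> \<and> \<delta> \<notin> I \<and> B2 \<subseteq> B \<and> (\<forall>b\<in>B - B2. G b \<in> I) \<and>
     (\<forall>b\<in>B2. \<sigma> b < m \<and> G b = F (\<sigma> b)) \<and>
     (\<forall>h\<in>I. \<forall>j<n. j \<notin> B \<longrightarrow> der (D j) h \<in> I) \<and> (\<forall>h\<in>I. \<forall>b\<in>B2. der (E b) h \<in> I)"

text \<open>Two maximality arguments on the number of pivots, which is at most \<open>n\<close>. If
  some \<open>D j\<close> took an element of \<open>I\<close> out of \<open>I\<close>, that element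
  would be a further pivot, so a maximal choice within \<open>I\<close> makes all \<open>D j\<close>
  preserve \<open>I\<close>. The same argument for the \<open>F i\<close> keeps this stability as an
  invariant: a new field combines old fields that preserve \<open>I\<close>.\<close>

lemma adapted_exists:
  assumes I: "fun_ideal I" and one: "(\<lambda>x\<in>U. 1) \<notin> I"
    and prime: "\<And>a b. a \<in> M \<Longrightarrow> b \<in> M \<Longrightarrow> (\<lambda>x\<in>U. a x * b x) \<in> I \<Longrightarrow> a \<in> I \<or> b \<in> I"
    and F: "\<And>i. i < m \<Longrightarrow> F i \<in> M"
  obtains B2 \<sigma> B G D E \<delta> where "adapted I m F B2 \<sigma> B G D E \<delta>"
    "\<And>i j. i < m \<Longrightarrow> j < n \<Longrightarrow> j \<notin> B \<Longrightarrow> der (D j) (F i) \<in> I"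
proof -
  have IM: "I \<subseteq> M" and mult: "\<And>f g. f \<in> M \<Longrightarrow> g \<in> I \<Longrightarrow> (\<lambda>x\<in>U. f x * g x) \<in> I"
    using I unfolding fun_ideal_def by blast+
  have frM: "B \<subseteq> {..<n}" "\<delta> \<in> M" "card B < Suc n"
    "\<And>j h. j < n \<Longrightarrow> h \<in> M \<Longrightarrow> der (D j) h \<in> M" "\<And>b h. b \<in> B \<Longrightarrow> h \<in> M \<Longrightarrow> der (E b) h \<in> M"
    if "frame B G D E \<delta>" for B G D E \<delta>
  proof -
    show "B \<subseteq> {..<n}" "\<delta> \<in> M" using that unfolding frame_def by blast+
    then show "card B < Suc n" using card_mono[of "{..<n}" B] by simp
    show "der (D j) h \<in> M" if "j < n" "h \<in> M" for j h
      using \<open>frame B G D E \<delta>\<close> that unfolding frame_def by (intro der_mem) auto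
    show "der (E b) h \<in> M" if "b \<in> B" "h \<in> M" for b h
      using \<open>frame B G D E \<delta>\<close> that unfolding frame_def by (intro der_mem) auto
  qed
  have card_ins: "card (insert j B) = Suc (card B)" if "frame B G D E \<delta>" "j \<notin> B" for B G D E \<delta> j
    using frM(1)[OF that(1)] that(2) finite_subset[of B "{..<n}"] by simp
  \<comment> \<open>Primeness enters here: a product of pivots outside \<open>I\<close> stays
    outside.\<close>
  have \<delta>ext: "(\<lambda>x\<in>U. p x * \<delta> x) \<notin> I" if "p \<in> M" "\<delta> \<in> M" "p \<notin> I" "\<delta> \<notin> I" for p \<delta>
    using prime that by blast
  define good1 where "good1 = (\<lambda>(B, G, D, E, \<delta>). frame B G D E \<delta> \<and> \<delta> \<notin> I \<and> (\<forall>b\<in>B. G b \<in> I))"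
  have start: "good1 ({}, \<lambda>_ _. 0, \<lambda>j i. \<lambda>x\<in>U. if i = j then 1 else 0, \<lambda>b i. \<lambda>x\<in>U. 0, \<lambda>x\<in>U. 1)"
    using frame_start one by (simp add: good1_def)
  have "\<exists>y. good1 y \<and> (\<forall>z. good1 z \<longrightarrow> card (fst z) \<le> card (fst y))"
    by (rule ex_has_greatest_nat[where P = good1 and b = "Suc n", OF start]) (auto simp: good1_def dest: frM(3))
  then obtain y1 where y1: "good1 y1" "\<forall>z. good1 z \<longrightarrow> card (fst z) \<le> card (fst y1)" by (elim exE conjE)
  obtain B1 G1 D1 E1 \<delta>1 where e1: "y1 = (B1, G1, D1, E1, \<delta>1)" by (rule prod_cases5)
  have g1: "good1 (B1, G1, D1, E1, \<delta>1)" using y1(1) by (simp only: e1)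
  have max1: "card (fst z) \<le> card B1" if "good1 z" for z
    using y1(2)[THEN spec, THEN mp, OF that] by (simp only: e1 fst_conv)
  have fr1: "frame B1 G1 D1 E1 \<delta>1" and \<delta>1: "\<delta>1 \<notin> I" and G1: "\<forall>b\<in>B1. G1 b \<in> I"
    using g1 by (auto simp: good1_def)
  have closed1: "der (D1 j) h \<in> I" if h: "h \<in> I" and j: "j < n" "j \<notin> B1" for h j
  proof (rule ccontr)
    assume p: "der (D1 j) h \<notin> I"
    have hM: "h \<in> M" using h IM by blast
    note ext = frame_extend(1)[OF fr1 hM j]
    have "(\<lambda>x\<in>U. der (D1 j) h x * \<delta>1 x) \<notin> I"
      by (rule \<delta>ext[OF frM(4)[OF fr1 j(1) hM] frM(2)[OF fr1] p \<delta>1])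
    moreover have "\<forall>b\<in>insert j B1. (G1(j := h)) b \<in> I" using G1 h by simp
    ultimately have "good1 (insert j B1, G1(j := h),
        \<lambda>j' i. \<lambda>x\<in>U. der (D1 j) h x * D1 j' i x - der (D1 j') h x * D1 j i x,
        \<lambda>b i. \<lambda>x\<in>U. if b = j then \<delta>1 x * D1 j i x else der (D1 j) h x * E1 b i x - der (E1 b) h x * D1 j i x,
        \<lambda>x\<in>U. der (D1 j) h x * \<delta>1 x)"
      using ext by (simp add: good1_def)
    from max1[OF this] show False using card_ins[OF fr1 j(2)] by simp
  qed
  define good2 where "good2 = (\<lambda>(B2, \<sigma>, B, G, D, E, \<delta>). adapted I m F B2 \<sigma> B G D E \<delta>)"
  have start2: "good2 ({}, id, B1, G1, D1, E1, \<delta>1)"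
    using fr1 \<delta>1 G1 closed1 by (simp add: good2_def adapted_def)
  define crd where "crd = (\<lambda>(B2 :: nat set, \<sigma> :: nat \<Rightarrow> nat, B :: nat set, G :: nat \<Rightarrow> (nat \<Rightarrow> 'a) \<Rightarrow> 'a,
    D :: nat \<Rightarrow> nat \<Rightarrow> (nat \<Rightarrow> 'a) \<Rightarrow> 'a, E :: nat \<Rightarrow> nat \<Rightarrow> (nat \<Rightarrow> 'a) \<Rightarrow> 'a, \<delta> :: (nat \<Rightarrow> 'a) \<Rightarrow> 'a). card B)"
  have "\<exists>y. good2 y \<and> (\<forall>z. good2 z \<longrightarrow> crd z \<le> crd y)"
    by (rule ex_has_greatest_nat[where P = good2 and b = "Suc n", OF start2])
      (auto simp: good2_def crd_def adapted_def dest: frM(3))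
  then obtain y2 where y2: "good2 y2" "\<forall>z. good2 z \<longrightarrow> crd z \<le> crd y2" by (elim exE conjE)
  obtain B2 \<sigma> B G D E \<delta> where e2: "y2 = (B2, \<sigma>, B, G, D, E, \<delta>)" by (rule prod_cases7)
  have g2: "good2 (B2, \<sigma>, B, G, D, E, \<delta>)" using y2(1) by (simp only: e2)
  have max2: "crd z \<le> card B" if "good2 z" for z
    using y2(2)[THEN spec, THEN mp, OF that] by (simp only: e2 crd_def prod.case)
  have ad: "adapted I m F B2 \<sigma> B G D E \<delta>" using g2 by (simp add: good2_def)
  then have fr: "frame B G D E \<delta>" and \<delta>: "\<delta> \<notin> I" and B2: "B2 \<subseteq> B" and GI: "\<forall>b\<in>B - B2. G b \<in> I"
    and GF: "\<forall>b\<in>B2. \<sigma> b < m \<and> G b = F (\<sigma> b)"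
    and DI: "\<And>h j. h \<in> I \<Longrightarrow> j < n \<Longrightarrow> j \<notin> B \<Longrightarrow> der (D j) h \<in> I"
    and EI: "\<And>h b. h \<in> I \<Longrightarrow> b \<in> B2 \<Longrightarrow> der (E b) h \<in> I"
    unfolding adapted_def by blast+
  show ?thesis
  proof (rule that[OF ad], rule ccontr)
    fix i j assume i: "i < m" and j: "j < n" "j \<notin> B" and p: "der (D j) (F i) \<notin> I"
    define g where "g = F i"
    have gM: "g \<in> M" using F[OF i] by (simp add: g_def)
    have pM: "der (D j) g \<in> M" by (rule frM(4)[OF fr j(1) gM])
    note ext = frame_extend[OF fr gM j]
    define D' where "D' = (\<lambda>j' i. \<lambda>x\<in>U. der (D j) g x * D j' i x - der (D j') g x * D j i x)"
    define E' where "E' = (\<lambda>b i. \<lambda>x\<in>U. if b = j then \<delta> x * D j i x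
      else der (D j) g x * E b i x - der (E b) g x * D j i x)"
    define \<delta>' where "\<delta>' = (\<lambda>x\<in>U. der (D j) g x * \<delta> x)"
    have fr': "frame (insert j B) (G(j := g)) D' E' \<delta>'"
      unfolding D'_def E'_def \<delta>'_def by (rule ext(1))
    have "adapted I m F (insert j B2) (\<sigma>(j := i)) (insert j B) (G(j := g)) D' E' \<delta>'"
      unfolding adapted_def
    proof (intro conjI ballI allI impI fr')
      show "\<delta>' \<notin> I" unfolding \<delta>'_def using pM frM(2)[OF fr] p \<delta> by (intro \<delta>ext) (simp_all add: g_def)
      show "insert j B2 \<subseteq> insert j B" using B2 by blast
      show "(G(j := g)) b \<in> I" if "b \<in> insert j B - insert j B2" for b using that GI by auto
      show "(\<sigma>(j := i)) b < m" "(G(j := g)) b = F ((\<sigma>(j := i)) b)" if "b \<in> insert j B2" for b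
        using that GF i by (auto simp: g_def)
      show "der (D' j') h \<in> I" if h: "h \<in> I" and j': "j' < n" "j' \<notin> insert j B" for h j'
      proof -
        have "(\<lambda>x\<in>U. (\<lambda>x\<in>U. der (D j) g x * der (D j') h x) x - (\<lambda>x\<in>U. der (D j') g x * der (D j) h x) x) \<in> I"
          using h j j' DI by (intro fun_ideal_diff[OF I] mult pM frM(4)[OF fr j'(1) gM]) auto
        then show ?thesis unfolding D'_def ext(2) by (rule restrict_mem_cong) simp
      qed
      show "der (E' b) h \<in> I" if h: "h \<in> I" and b: "b \<in> insert j B2" for h b
      proof (cases "b = j")
        case True
        \<comment> \<open>The field dual to the new pivot is a multiple of the old
          \<open>D j\<close>, which preserves \<open>I\<close> because \<open>j\<close> was not yet
          a pivot.\<close>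
        have "(\<lambda>x\<in>U. \<delta> x * der (D j) h x) \<in> I" using DI[OF h j] frM(2)[OF fr] by (intro mult)
        then show ?thesis unfolding True E'_def ext(4) .
      next
        case False
        then have b2: "b \<in> B2" "b \<in> B" using b B2 by auto
        have "(\<lambda>x\<in>U. (\<lambda>x\<in>U. der (D j) g x * der (E b) h x) x - (\<lambda>x\<in>U. der (E b) g x * der (D j) h x) x) \<in> I"
          using h j b2 DI EI by (intro fun_ideal_diff[OF I] mult pM frM(5)[OF fr b2(2) gM]) auto
        then show ?thesis unfolding E'_def ext(3)[OF False] by (rule restrict_mem_cong) simp
      qed
    qed
    then have "good2 (insert j B2, \<sigma>(j := i), insert j B, G(j := g), D', E', \<delta>')" by (simp add: good2_def)
    from max2[OF this] show False using card_ins[OF fr j(2)] by (simp add: crd_def)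
  qed
qed

end

section \<open>Meager images\<close>

text \<open>The parameter is appended as coordinate \<open>m\<close>, so the predicate reads it from
  variable \<open>m\<close>.\<close>

lemma definable_family_iff:
  fixes A :: "'a::linordered_field \<Rightarrow> (nat \<Rightarrow> 'a) set"
  assumes A: "\<And>t. A t \<subseteq> kspace m"
  shows "definable_family S m A \<longleftrightarrow> definable_pred S (\<lambda>e. restrict e {..<m} \<in> A (e m))"
proof -
  let ?G = "{x(m := t) | x t. x \<in> A t}"
  have "?G \<subseteq> kspace (Suc m)"
  proof
    fix y assume "y \<in> ?G"
    then obtain x t where "y = x(m := t)" "x \<in> A t" by blast
    moreover from this(2) A have "x \<in> kspace m" by blast
    ultimately show "y \<in> kspace (Suc m)" by (auto simp: PiE_def extensional_def)
  qed
  moreover have "restrict e {..<Suc m} \<in> ?G \<longleftrightarrow> restrict e {..<m} \<in> A (e m)" for e :: "nat \<Rightarrow> 'a"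
  proof -
    have eq: "restrict e {..<Suc m} = (restrict e {..<m})(m := e m)" by (auto simp: fun_eq_iff)
    have k: "restrict e {..<m} \<in> kspace m" by simp
    show ?thesis
    proof
      assume "restrict e {..<Suc m} \<in> ?G"
      then obtain x t where xt: "(restrict e {..<m})(m := e m) = x(m := t)" "x \<in> A t"
        unfolding eq by blast
      with kspace_upd_inj[OF xt(1) k] A show "restrict e {..<m} \<in> A (e m)" by blast
    next
      assume "restrict e {..<m} \<in> A (e m)"
      then show "restrict e {..<Suc m} \<in> ?G" unfolding eq by blast
    qed
  qed
  ultimately show ?thesis
    using A unfolding definable_family_def definable_iff_definable_pred by simp
qed

lemma definably_meager_mono:
  "definably_meager S m Y X' \<Longrightarrow> X \<subseteq> X' \<Longrightarrow> definably_meager S m Y X"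
  unfolding definably_meager_def by (meson order_trans)

lemma nowhere_dense_in_Un:
  assumes "nowhere_dense_in m Y A" "nowhere_dense_in m Y B" shows "nowhere_dense_in m Y (A \<union> B)"
  using assms unfolding nowhere_dense_in_def
  by (simp add: closure_of_Un interior_of_union_eq_empty)

lemma definably_meager_empty: "definably_meager S m Y {}"
proof -
  have "definable_family S m (\<lambda>t. {})" by (simp add: definable_family_iff definable_pred_const)
  then show ?thesis unfolding definably_meager_def
    by (intro exI[of _ "\<lambda>t. {}"]) (simp add: nowhere_dense_in_def)
qed

lemma definably_meager_Un:
  fixes S :: "('f, 'r, 'a::{linordered_field, linorder_topology}) expansion"
  assumes "definably_meager S m Y X1" "definably_meager S m Y X2"
  shows "definably_meager S m Y (X1 \<union> X2)"
proof -
  obtain A1 where A1: "definable_family S m A1" "\<forall>t. nowhere_dense_in m Y (A1 t)"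
      "\<forall>s t. s \<le> t \<longrightarrow> A1 s \<subseteq> A1 t" "X1 \<subseteq> (\<Union>t. A1 t)"
    using assms(1) unfolding definably_meager_def by blast
  obtain A2 where A2: "definable_family S m A2" "\<forall>t. nowhere_dense_in m Y (A2 t)"
      "\<forall>s t. s \<le> t \<longrightarrow> A2 s \<subseteq> A2 t" "X2 \<subseteq> (\<Union>t. A2 t)"
    using assms(2) unfolding definably_meager_def by blast
  have sub: "A1 t \<subseteq> kspace m" "A2 t \<subseteq> kspace m" for t
    using A1(1) A2(1) unfolding definable_family_def by blast+
  have "definable_pred S (\<lambda>e. restrict e {..<m} \<in> A1 (e m) \<or> restrict e {..<m} \<in> A2 (e m))"
    using A1(1) A2(1) by (intro definable_pred_disj) (simp_all only: definable_family_iff[OF sub(1)] definable_family_iff[OF sub(2)])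
  then have "definable_family S m (\<lambda>t. A1 t \<union> A2 t)"
    using sub by (subst definable_family_iff) auto
  moreover have "\<forall>t. nowhere_dense_in m Y (A1 t \<union> A2 t)" using A1(2) A2(2) nowhere_dense_in_Un by blast
  moreover have "\<forall>s t. s \<le> t \<longrightarrow> A1 s \<union> A2 s \<subseteq> A1 t \<union> A2 t" using A1(3) A2(3) by blast
  moreover have "X1 \<union> X2 \<subseteq> (\<Union>t. A1 t \<union> A2 t)" using A1(4) A2(4) by blast
  ultimately show ?thesis unfolding definably_meager_def by (intro exI[of _ "\<lambda>t. A1 t \<union> A2 t"] conjI)
qed

section \<open>Exhaustion by definably compact pieces\<close>

context definable_differential_ring
begin

lemma M_eq_limit:
  assumes f: "f \<in> M" and x: "x \<in> U" and "\<And>\<epsilon>. 0 < \<epsilon> \<Longrightarrow> \<exists>y\<in>kspace n. l1dist n y x < \<epsilon> \<and> \<bar>f y - c\<bar> \<le> \<epsilon>"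
  shows "f x = c"
proof -
  have "\<bar>f x - c\<bar> \<le> 0 + \<epsilon>" if \<epsilon>: "0 < \<epsilon>" for \<epsilon>
  proof -
    have "0 < \<epsilon> / 2" using \<epsilon> by simp
    then obtain d where d: "0 < d" "\<And>y. y \<in> kspace n \<Longrightarrow> l1dist n y x < d \<Longrightarrow> y \<in> U \<and> \<bar>f y - f x\<bar> < \<epsilon> / 2"
      using M_continuous[OF f x, of "\<epsilon> / 2"] by blast
    obtain y where y: "y \<in> kspace n" "l1dist n y x < min d (\<epsilon> / 2)" "\<bar>f y - c\<bar> \<le> min d (\<epsilon> / 2)"
      using assms(3)[of "min d (\<epsilon> / 2)"] d(1) \<epsilon> by auto
    have "\<bar>f y - f x\<bar> < \<epsilon> / 2" using d(2)[OF y(1)] y(2) by simp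
    moreover have "\<bar>f y - c\<bar> \<le> \<epsilon> / 2" using y(3) by simp
    moreover have "\<epsilon> = \<epsilon> / 2 + \<epsilon> / 2" by simp
    ultimately show ?thesis by linarith
  qed
  then have "\<bar>f x - c\<bar> \<le> 0" by (rule field_le_epsilon)
  then show ?thesis by simp
qed

text \<open>Closed bounded pieces exhausting the common zeros of \<open>A\<close> where
  \<open>\<delta>\<close> is nonzero: coordinates bounded by \<open>t\<close>, distance at least
  \<open>1 / t\<close> from the complement of \<open>U\<close>, and absolute value of
  \<open>\<delta>\<close> at least \<open>1 / t\<close>, all multiplied out. A finite set
  \<open>A\<close> of generators will stand for the ideal, so that the condition is
  first-order.\<close>

definition compact_part :: "((nat \<Rightarrow> 'a) \<Rightarrow> 'a) set \<Rightarrow> ((nat \<Rightarrow> 'a) \<Rightarrow> 'a) \<Rightarrow> 'a \<Rightarrow> (nat \<Rightarrow> 'a) set" where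
  "compact_part A \<delta> t = {x \<in> kspace n. x \<in> U \<and> 0 < t \<and> (\<forall>i<n. \<bar>x i\<bar> \<le> t) \<and>
     (\<forall>y\<in>kspace n. t * l1dist n y x < 1 \<longrightarrow> y \<in> U) \<and> (\<forall>a\<in>A. a x = 0) \<and> 1 \<le> t * \<bar>\<delta> x\<bar>}"

lemma compact_part_definable:
  assumes "definable S n U" "finite A" "A \<subseteq> M" "\<delta> \<in> M" and X: "definable_point S n X" and t: "definable_term S t"
  shows "definable_pred S (\<lambda>e. X e \<in> compact_part A \<delta> (t e))"
proof -
  have Xk: "X e \<in> kspace n" for e using X by (simp add: definable_point_def)
  have Xs: "definable_point S n (\<lambda>e. X (\<lambda>i. e (i + n)))"
    using X definable_term_shift[of S _ "\<lambda>i. i + n"] by (auto simp: definable_point_def)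
  have "definable_pred S (\<lambda>e. X e \<in> U \<and> 0 < t e \<and> (\<forall>i<n. \<bar>X e i\<bar> \<le> t e) \<and>
     (\<forall>y\<in>kspace n. t e * l1dist n y (X e) < 1 \<longrightarrow> y \<in> U) \<and> (\<forall>a\<in>A. a (X e) = 0) \<and> 1 \<le> t e * \<bar>\<delta> (X e)\<bar>)"
    by (intro definability definable_pred_mem[OF assms(1)] X Xs t definable_term_shift[OF t]
        definable_point_nth[OF X] M_definable[OF assms(4) X]
        definable_pred_ball_finite[OF assms(2)] M_definable[OF subsetD[OF assms(3)] X])
  then show ?thesis using Xk by (simp add: compact_part_def)
qed

lemma compact_part_mono:
  assumes "s \<le> t" shows "compact_part A \<delta> s \<subseteq> compact_part A \<delta> t"
proof
  fix x assume x: "x \<in> compact_part A \<delta> s"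
  have le: "s * p \<le> t * p" if "0 \<le> p" for p using assms that by (rule mult_right_mono)
  show "x \<in> compact_part A \<delta> t"
    unfolding compact_part_def
  proof (intro CollectI conjI allI impI ballI)
    show "x \<in> kspace n" "x \<in> U" "0 < t" using x assms by (auto simp: compact_part_def)
    show "\<bar>x i\<bar> \<le> t" if "i < n" for i using x assms that by (auto simp: compact_part_def intro: order_trans)
    show "y \<in> U" if "y \<in> kspace n" "t * l1dist n y x < 1" for y
      using x that le[of "l1dist n y x"] by (auto simp: compact_part_def intro: le_less_trans)
    show "a x = 0" if "a \<in> A" for a using x that by (auto simp: compact_part_def)
    show "1 \<le> t * \<bar>\<delta> x\<bar>" using x le[of "\<bar>\<delta> x\<bar>"] by (auto simp: compact_part_def intro: order_trans)
  qed
qed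

text \<open>A limit point stays in \<open>U\<close> because all points of the part keep the same
  distance from the complement; after that, continuity on \<open>U\<close> yields the other
  conditions.\<close>

lemma compact_part_closed:
  assumes A: "A \<subseteq> M" and \<delta>: "\<delta> \<in> M" and z: "z \<in> kspace n" and t: "0 < t"
    and lim: "\<And>\<epsilon>. 0 < \<epsilon> \<Longrightarrow> \<exists>x\<in>compact_part A \<delta> t. l1dist n x z < \<epsilon>"
  shows "z \<in> compact_part A \<delta> t"
proof -
  have near: "y \<in> U" if y: "y \<in> kspace n" "t * l1dist n y z < 1" for y
  proof -
    have "0 < (1 - t * l1dist n y z) / t" using t y(2) by simp
    then obtain x where x: "x \<in> compact_part A \<delta> t" "l1dist n x z < (1 - t * l1dist n y z) / t"
      using lim by blast
    have "t * l1dist n x z < 1 - t * l1dist n y z" using x(2) t by (simp add: pos_less_divide_eq mult.commute)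
    moreover have "t * l1dist n y x \<le> t * (l1dist n y z + l1dist n z x)"
      using t l1dist_triangle[of n y x z] by (intro mult_left_mono) auto
    ultimately have "t * l1dist n y x < 1" by (simp add: distrib_left l1dist_commute[of n z x])
    then show ?thesis using x(1) y(1) by (simp add: compact_part_def)
  qed
  have zU: "z \<in> U" using near[OF z] by simp
  show ?thesis
    unfolding compact_part_def
  proof (intro CollectI conjI allI impI ballI z zU t)
    show "\<bar>z i\<bar> \<le> t" if i: "i < n" for i
    proof (rule field_le_epsilon)
      fix \<epsilon> :: 'a assume "0 < \<epsilon>"
      then obtain x where x: "x \<in> compact_part A \<delta> t" "l1dist n x z < \<epsilon>" using lim by blast
      have "\<bar>x i\<bar> \<le> t" using x(1) i by (simp add: compact_part_def)
      moreover have "\<bar>x i - z i\<bar> < \<epsilon>" using abs_le_l1dist[OF i, of x z] x(2) by simp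
      ultimately show "\<bar>z i\<bar> \<le> t + \<epsilon>" by linarith
    qed
    show "y \<in> U" if "y \<in> kspace n" "t * l1dist n y z < 1" for y using near that .
    show "a z = 0" if a: "a \<in> A" for a
    proof (rule M_eq_limit[OF subsetD[OF A a] zU])
      fix \<epsilon> :: 'a assume "0 < \<epsilon>"
      then obtain x where "x \<in> compact_part A \<delta> t" "l1dist n x z < \<epsilon>" using lim by blast
      then show "\<exists>y\<in>kspace n. l1dist n y z < \<epsilon> \<and> \<bar>a y - 0\<bar> \<le> \<epsilon>"
        using a \<open>0 < \<epsilon>\<close> by (intro bexI[of _ x]) (auto simp: compact_part_def)
    qed
    show "1 \<le> t * \<bar>\<delta> z\<bar>"
    proof (rule field_le_epsilon)
      fix \<epsilon> :: 'a assume "0 < \<epsilon>"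
      then have "0 < \<epsilon> / t" using t by simp
      then obtain d where d: "0 < d" "\<And>y. y \<in> kspace n \<Longrightarrow> l1dist n y z < d \<Longrightarrow> y \<in> U \<and> \<bar>\<delta> y - \<delta> z\<bar> < \<epsilon> / t"
        using M_continuous[OF \<delta> zU, of "\<epsilon> / t"] by blast
      obtain x where x: "x \<in> compact_part A \<delta> t" "l1dist n x z < d" using lim[OF d(1)] by blast
      have "\<bar>\<delta> x\<bar> \<le> \<bar>\<delta> z\<bar> + \<bar>\<delta> x - \<delta> z\<bar>" by linarith
      also have "\<dots> \<le> \<bar>\<delta> z\<bar> + \<epsilon> / t" using d(2)[of x] x by (simp add: compact_part_def less_imp_le)
      finally have "t * \<bar>\<delta> x\<bar> \<le> t * (\<bar>\<delta> z\<bar> + \<epsilon> / t)" using t by (intro mult_left_mono) auto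
      also have "\<dots> = t * \<bar>\<delta> z\<bar> + \<epsilon>" using t by (simp add: distrib_left)
      finally show "1 \<le> t * \<bar>\<delta> z\<bar> + \<epsilon>" using x(1) by (simp add: compact_part_def)
    qed
  qed
qed

lemma compact_part_exhausts:
  assumes x: "x \<in> U" and "\<And>a. a \<in> A \<Longrightarrow> a x = 0" and \<delta>: "\<delta> x \<noteq> 0"
  shows "\<exists>t. x \<in> compact_part A \<delta> t"
proof -
  obtain \<epsilon> where \<epsilon>: "0 < \<epsilon>" "\<And>y. y \<in> kspace n \<Longrightarrow> l1dist n y x < \<epsilon> \<Longrightarrow> y \<in> U"
    by (rule openin_ptop_l1dist[OF U_open x]) (rule that)
  define t where "t = (\<Sum>i<n. \<bar>x i\<bar>) + 1 / \<epsilon> + 1 / \<bar>\<delta> x\<bar>"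
  have nn: "0 \<le> (\<Sum>i<n. \<bar>x i\<bar>)" "0 < 1 / \<epsilon>" "0 < 1 / \<bar>\<delta> x\<bar>" using \<epsilon>(1) \<delta> by (simp_all add: sum_nonneg)
  have t: "1 / \<epsilon> \<le> t" "1 / \<bar>\<delta> x\<bar> \<le> t" "0 < t" "(\<Sum>i<n. \<bar>x i\<bar>) \<le> t" unfolding t_def using nn by linarith+
  have "x \<in> compact_part A \<delta> t"
    unfolding compact_part_def
  proof (intro CollectI conjI allI impI ballI x t(3))
    show "x \<in> kspace n" using x U_kspace by blast
    show "\<bar>x i\<bar> \<le> t" if "i < n" for i
      using member_le_sum[of i "{..<n}" "\<lambda>i. \<bar>x i\<bar>"] that t(4) by (auto intro: order_trans)
    show "y \<in> U" if y: "y \<in> kspace n" "t * l1dist n y x < 1" for y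
    proof (rule \<epsilon>(2)[OF y(1)])
      have "1 / \<epsilon> * l1dist n y x \<le> t * l1dist n y x" using t(1) by (rule mult_right_mono) simp
      then have "1 / \<epsilon> * l1dist n y x < 1" using y(2) by simp
      then show "l1dist n y x < \<epsilon>" using \<epsilon>(1) by (simp add: pos_divide_less_eq)
    qed
    show "a x = 0" if "a \<in> A" for a using assms(2) that .
    have "1 / \<bar>\<delta> x\<bar> * \<bar>\<delta> x\<bar> \<le> t * \<bar>\<delta> x\<bar>" using t(2) by (rule mult_right_mono) simp
    then show "1 \<le> t * \<bar>\<delta> x\<bar>" using \<delta> by simp
  qed
  then show ?thesis ..
qed

text \<open>
  The image of a compact part is closed. If it contained a box, then fixing all coordinates except
  \<open>i0\<close> would give points with \<open>F i0\<close> different from, and arbitrarily close to, its value at a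
  limit point, where \<open>F i0\<close> is locally constant.
\<close>

lemma piece_meager:
  assumes Udef: "definable S n U" and I: "fun_ideal I"
    and ad: "adapted I m F B2 \<sigma> B G D E \<delta>"
    and F: "\<And>i. i < m \<Longrightarrow> F i \<in> M"
    and DF: "\<And>i j. i < m \<Longrightarrow> j < n \<Longrightarrow> j \<notin> B \<Longrightarrow> der (D j) (F i) \<in> I"
    and i0: "i0 < m" "i0 \<notin> \<sigma> ` B2"
  shows "definably_meager S m (kspace m) ((\<lambda>x. \<lambda>i\<in>{..<m}. F i x) ` {x \<in> zeros I. \<delta> x \<noteq> 0})"
proof -
  have fr: "frame B G D E \<delta>" and B2: "B2 \<subseteq> B" and GI: "\<forall>b\<in>B - B2. G b \<in> I"
    and GF: "\<forall>b\<in>B2. \<sigma> b < m \<and> G b = F (\<sigma> b)"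
    and DI: "\<And>h j. h \<in> I \<Longrightarrow> j < n \<Longrightarrow> j \<notin> B \<Longrightarrow> der (D j) h \<in> I"
    using ad unfolding adapted_def by blast+
  have \<delta>M: "\<delta> \<in> M" using fr unfolding frame_def by blast
  obtain A where A: "finite A" "A \<subseteq> I"
    and gen: "\<And>h. h \<in> I \<Longrightarrow> \<exists>c. (\<forall>a\<in>A. c a \<in> M) \<and> (\<forall>x\<in>U. h x = (\<Sum>a\<in>A. c a x * a x))"
    by (rule fun_ideal_generators[OF I]) (rule that)
  have AM: "A \<subseteq> M" using A(2) I unfolding fun_ideal_def by blast
  have I0: "h x = 0" if h: "h \<in> I" and x: "x \<in> U" "\<forall>a\<in>A. a x = 0" for h x
  proof -
    obtain c where "\<forall>x\<in>U. h x = (\<Sum>a\<in>A. c a x * a x)" using gen[OF h] by blast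
    then show ?thesis using x by simp
  qed
  define img where "img x = restrict (\<lambda>i. F i x) {..<m}" for x
  have imgk: "img x \<in> kspace m" for x by (simp add: img_def)
  define X where "X t = compact_part A \<delta> t" for t
  have XU: "x \<in> U" "x \<in> kspace n" "0 < t" "\<forall>a\<in>A. a x = 0" "\<delta> x \<noteq> 0" "\<And>i. i < n \<Longrightarrow> \<bar>x i\<bar> \<le> t"
    if "x \<in> X t" for x t
    using that unfolding X_def compact_part_def by auto
  have imgdef: "definable_point S m (\<lambda>e. img (Y e))" if "definable_point S n Y" for Y
    unfolding img_def using that by (intro definable_point_restrict M_definable F)
  have Xdef: "definable_pred S (\<lambda>e. Y e \<in> X (t e))" if "definable_point S n Y" "definable_term S t" for Y t
    unfolding X_def by (rule compact_part_definable[OF Udef A(1) AM \<delta>M that])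
  have Xlim: "z \<in> X t" if "z \<in> kspace n" "0 < t" "\<And>\<epsilon>. 0 < \<epsilon> \<Longrightarrow> \<exists>x\<in>X t. l1dist n x z < \<epsilon>" for z t
    unfolding X_def using that by (intro compact_part_closed[OF AM \<delta>M]) (auto simp: X_def)
  have lc: "\<exists>\<rho>>0. \<forall>x1\<in>kspace n. l1dist n x1 x0 < \<rho> \<longrightarrow> (\<forall>b\<in>B. G b x1 = G b x0) \<longrightarrow> F i0 x1 = F i0 x0"
    if x0: "x0 \<in> X t" for x0 t
  proof -
    \<comment> \<open>Membership of \<open>der (D j) h\<close> in \<open>I\<close> supplies
      coefficients with respect to the generators; choosing them for all \<open>h\<close> and
      \<open>j\<close> at once gives the matrix of the linear system.\<close>
    define c where "c h j = (SOME c. (\<forall>a\<in>A. c a \<in> M) \<and> (\<forall>x\<in>U. der (D j) h x = (\<Sum>a\<in>A. c a x * a x)))" for h j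
    have c: "(\<forall>a\<in>A. c h j a \<in> M) \<and> (\<forall>x\<in>U. der (D j) h x = (\<Sum>a\<in>A. c h j a x * a x))"
      if "h \<in> insert (F i0) A" "j < n" "j \<notin> B" for h j
    proof -
      have "der (D j) h \<in> I" using that DF[OF i0(1)] DI A(2) by auto
      from gen[OF this] show ?thesis unfolding c_def by (rule someI_ex)
    qed
    obtain \<rho> where "0 < \<rho>"
      "\<And>x1. x1 \<in> kspace n \<Longrightarrow> l1dist n x1 x0 < \<rho> \<Longrightarrow> (\<forall>b\<in>B. G b x1 = G b x0) \<Longrightarrow> F i0 x1 = F i0 x0"
    proof (rule locally_constant_on_level[OF fr XU(1)[OF x0] XU(5)[OF x0] A(1) AM _ F[OF i0(1)], where c = c])
      show "h x0 = 0" if "h \<in> A" for h using XU(4)[OF x0] that by blast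
      show "c h j a \<in> M" if "h \<in> insert (F i0) A" "j < n" "j \<notin> B" "a \<in> A" for h j a
        using c[OF that(1-3)] that(4) by blast
      show "der (D j) h x = (\<Sum>a\<in>A. c h j a x * a x)"
        if "h \<in> insert (F i0) A" "j < n" "j \<notin> B" "x \<in> U" for h j x
        using c[OF that(1-3)] that(4) by blast
    qed (rule that)
    then show ?thesis by blast
  qed
  have closed: "z \<in> img ` X t"
    if z: "z \<in> kspace m" and lim: "\<And>\<epsilon>. 0 < \<epsilon> \<Longrightarrow> \<exists>y\<in>img ` X t. l1dist m y z < \<epsilon>" for z t
  proof -
    have lim': "\<exists>x\<in>X t. l1dist m (img x) z < \<epsilon>" if "0 < \<epsilon>" for \<epsilon> using lim[OF that] by blast
    obtain x' where "x' \<in> X t" using lim'[of 1] by auto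
    then have t: "0 < t" by (rule XU(3))
    \<comment> \<open>Points of \<open>X t\<close> whose image is close to \<open>z\<close>; a
      cluster point of them is a preimage of \<open>z\<close>.\<close>
    define Y where "Y s = {x \<in> kspace n. x \<in> X t \<and> l1dist m (img x) z < s}" for s
    obtain x where x: "x \<in> kspace n" "\<And>s \<epsilon>. 0 < s \<Longrightarrow> 0 < \<epsilon> \<Longrightarrow> \<exists>y\<in>Y s. l1dist n y x < \<epsilon>"
    proof (rule definable_compactness[OF dc, of n Y])
      have "definable_pred S (\<lambda>e. restrict e {..<n} \<in> X t \<and> l1dist m (img (restrict e {..<n})) z < e n)"
        by (intro definability Xdef imgdef z)
      then show "definable_pred S (\<lambda>e. restrict e {..<n} \<in> Y (e n))" by (simp add: Y_def)
      show "Y s \<subseteq> kspace n" for s by (auto simp: Y_def)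
      show "Y s \<noteq> {}" if "0 < s" for s using lim'[OF that] XU(2) unfolding Y_def by blast
      show "Y s \<subseteq> Y s'" if "s \<le> s'" for s s' unfolding Y_def using less_le_trans[OF _ that] by blast
      show "\<bar>x i\<bar> \<le> t" if "x \<in> Y s" "i < n" for s x i using that XU(6) unfolding Y_def by blast
    qed (rule that)
    have xX: "x \<in> X t"
    proof (rule Xlim[OF x(1) t])
      show "\<exists>y\<in>X t. l1dist n y x < \<epsilon>" if "0 < \<epsilon>" for \<epsilon> using x(2)[of 1 \<epsilon>] that unfolding Y_def by auto
    qed
    have "img x = z"
    proof (rule kspace_extI[OF imgk z])
      fix i assume i: "i < m"
      have "F i x = z i"
      proof (rule M_eq_limit[OF F[OF i] XU(1)[OF xX]])
        fix \<epsilon> :: 'a assume \<epsilon>: "0 < \<epsilon>"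
        obtain y where y: "y \<in> Y \<epsilon>" "l1dist n y x < \<epsilon>" using x(2)[OF \<epsilon> \<epsilon>] by blast
        have "\<bar>img y i - z i\<bar> \<le> l1dist m (img y) z" by (rule abs_le_l1dist[OF i])
        also have "\<dots> \<le> \<epsilon>" using y(1) by (simp add: Y_def less_imp_le)
        finally have "\<bar>F i y - z i\<bar> \<le> \<epsilon>" using i by (simp add: img_def)
        then show "\<exists>y\<in>kspace n. l1dist n y x < \<epsilon> \<and> \<bar>F i y - z i\<bar> \<le> \<epsilon>"
          using y unfolding Y_def by blast
      qed
      then show "img x i = z i" using i by (simp add: img_def)
    qed
    then show ?thesis using xX by blast
  qed
  have thin: "\<exists>y\<in>kspace m. l1dist m y z < \<epsilon> \<and> y \<notin> img ` X t"
    if z: "z \<in> img ` X t" and \<epsilon>: "0 < \<epsilon>" for z t \<epsilon>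
  proof (rule ccontr)
    assume none: "\<not> (\<exists>y\<in>kspace m. l1dist m y z < \<epsilon> \<and> y \<notin> img ` X t)"
    have zk: "z \<in> kspace m" and t: "0 < t" using z imgk XU(3) by auto
    \<comment> \<open>Points lying over the line through \<open>z\<close> in direction
      \<open>i0\<close>, with \<open>F i0\<close> slightly larger than \<open>z i0\<close>. There
      are such points because the image is supposed to contain a whole ball around
      \<open>z\<close>.\<close>
    define Y where "Y s = {x \<in> kspace n. x \<in> X t \<and> (\<forall>i<m. i \<noteq> i0 \<longrightarrow> F i x = z i) \<and>
      z i0 < F i0 x \<and> F i0 x < z i0 + s}" for s
    have ne: "Y s \<noteq> {}" if s: "0 < s" for s
    proof -
      define u where "u = min s \<epsilon> / 2"
      have u: "0 < u" "u < s" "u < \<epsilon>" using s \<epsilon> by (auto simp: u_def min_def)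
      define y where "y = z(i0 := z i0 + u)"
      have "y \<in> kspace m" using zk i0(1) by (auto simp: y_def PiE_def extensional_def)
      moreover have "l1dist m y z < \<epsilon>"
        using l1dist_upd[OF i0(1), of z "z i0 + u" z] u by (simp add: y_def)
      ultimately have "y \<in> img ` X t" using none by blast
      then obtain x where x: "x \<in> X t" "img x = y" by blast
      have "F i x = y i" if "i < m" for i using fun_cong[OF x(2), of i] that by (simp add: img_def)
      then have "x \<in> Y s" using x(1) XU(2)[OF x(1)] i0(1) u by (simp add: Y_def y_def)
      then show ?thesis by blast
    qed
    obtain x where x: "x \<in> kspace n" "\<And>s \<epsilon>. 0 < s \<Longrightarrow> 0 < \<epsilon> \<Longrightarrow> \<exists>y\<in>Y s. l1dist n y x < \<epsilon>"
    proof (rule definable_compactness[OF dc, of n Y])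
      have Fd: "definable_term S (\<lambda>e. F i (restrict e {..<n}))" if "i < m" for i
        by (intro M_definable[OF F[OF that]] definability)
      have "definable_pred S (\<lambda>e. restrict e {..<n} \<in> X t \<and> (\<forall>i<m. i \<noteq> i0 \<longrightarrow> F i (restrict e {..<n}) = z i) \<and>
          z i0 < F i0 (restrict e {..<n}) \<and> F i0 (restrict e {..<n}) < z i0 + e n)"
        by (intro definable_pred_conj definable_pred_all_less definable_pred_imp definable_pred_const
            definable_pred_eq definable_pred_less definable_term_const definable_term_add definable_term_var
            Xdef definable_point_restrict Fd i0(1))
      then show "definable_pred S (\<lambda>e. restrict e {..<n} \<in> Y (e n))" by (simp add: Y_def)
      show "Y s \<subseteq> kspace n" for s by (auto simp: Y_def)
      show "Y s \<noteq> {}" if "0 < s" for s using that by (rule ne)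
      show "Y s \<subseteq> Y s'" if "s \<le> s'" for s s'
        unfolding Y_def using less_le_trans[OF _ add_left_mono[OF that]] by blast
      show "\<bar>x i\<bar> \<le> t" if "x \<in> Y s" "i < n" for s x i using that XU(6) unfolding Y_def by blast
    qed (rule that)
    have xX: "x \<in> X t"
    proof (rule Xlim[OF x(1) t])
      show "\<exists>y\<in>X t. l1dist n y x < \<epsilon>" if "0 < \<epsilon>" for \<epsilon> using x(2)[of 1 \<epsilon>] that unfolding Y_def by auto
    qed
    have Fx: "F i x = z i" if i: "i < m" for i
    proof (rule M_eq_limit[OF F[OF i] XU(1)[OF xX]])
      fix \<epsilon> :: 'a assume \<epsilon>: "0 < \<epsilon>"
      obtain y where y: "y \<in> Y \<epsilon>" "l1dist n y x < \<epsilon>" using x(2)[OF \<epsilon> \<epsilon>] by blast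
      have "\<bar>F i y - z i\<bar> \<le> \<epsilon>" using y(1) i \<epsilon> by (cases "i = i0") (auto simp: Y_def abs_le_iff)
      then show "\<exists>y\<in>kspace n. l1dist n y x < \<epsilon> \<and> \<bar>F i y - z i\<bar> \<le> \<epsilon>"
        using y unfolding Y_def by blast
    qed
    obtain \<rho> where \<rho>: "0 < \<rho>" "\<forall>x1\<in>kspace n. l1dist n x1 x < \<rho> \<longrightarrow> (\<forall>b\<in>B. G b x1 = G b x) \<longrightarrow> F i0 x1 = F i0 x"
      using lc[OF xX] by blast
    obtain y where y: "y \<in> Y 1" "l1dist n y x < \<rho>" using x(2)[of 1 \<rho>] \<rho>(1) by auto
    have yX: "y \<in> X t" "y \<in> kspace n" and yF: "\<And>i. i < m \<Longrightarrow> i \<noteq> i0 \<Longrightarrow> F i y = z i" and yi: "z i0 < F i0 y"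
      using y(1) unfolding Y_def by blast+
    \<comment> \<open>A pivot from \<open>F\<close> is some \<open>F i\<close> with \<open>i\<close>
      different from \<open>i0\<close>, whose value is fixed to \<open>z i\<close>; a pivot from
      \<open>I\<close> vanishes at both points.\<close>
    have "G b y = G b x" if b: "b \<in> B" for b
    proof (cases "b \<in> B2")
      case True
      then have "\<sigma> b \<noteq> i0" "\<sigma> b < m" "G b = F (\<sigma> b)" using i0(2) GF by auto
      then show ?thesis using yF[of "\<sigma> b"] Fx[of "\<sigma> b"] by simp
    next
      case False
      then have Gb: "G b \<in> I" using b GI by blast
      from I0[OF Gb XU(1)[OF yX(1)] XU(4)[OF yX(1)]] I0[OF Gb XU(1)[OF xX] XU(4)[OF xX]]
      show ?thesis by (simp only:)
    qed
    then have "F i0 y = F i0 x" using \<rho>(2) yX(2) y(2) by blast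
    with yi Fx[OF i0(1)] show False by simp
  qed
  have sub: "img ` X t \<subseteq> kspace m" for t using imgk by blast
  have "definable_pred S (\<lambda>e. \<exists>x\<in>kspace n. x \<in> X (e m) \<and> (\<forall>i<m. e i = F i x))"
    using F by (intro definability Xdef M_definable)
  moreover have "restrict e {..<m} \<in> img ` X (e m) \<longleftrightarrow> (\<exists>x\<in>kspace n. x \<in> X (e m) \<and> (\<forall>i<m. e i = F i x))" for e
  proof
    assume "restrict e {..<m} \<in> img ` X (e m)"
    then obtain x where x: "x \<in> X (e m)" "restrict e {..<m} = img x" by blast
    have "e i = F i x" if "i < m" for i using fun_cong[OF x(2), of i] that by (simp add: img_def)
    then show "\<exists>x\<in>kspace n. x \<in> X (e m) \<and> (\<forall>i<m. e i = F i x)" using x(1) XU(2) by blast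
  next
    assume "\<exists>x\<in>kspace n. x \<in> X (e m) \<and> (\<forall>i<m. e i = F i x)"
    then obtain x where x: "x \<in> X (e m)" "\<forall>i<m. e i = F i x" by blast
    have "restrict e {..<m} = img x" unfolding img_def by (rule restrict_ext) (use x(2) in simp)
    then show "restrict e {..<m} \<in> img ` X (e m)" using x(1) by blast
  qed
  ultimately have "definable_family S m (\<lambda>t. img ` X t)" unfolding definable_family_iff[OF sub] by (simp only:)
  moreover have "\<forall>t. nowhere_dense_in m (kspace m) (img ` X t)"
    using nowhere_dense_inI[OF sub closed thin] by blast
  moreover have "\<forall>s t. s \<le> t \<longrightarrow> img ` X s \<subseteq> img ` X t"
    unfolding X_def using compact_part_mono by (intro allI impI image_mono)
  moreover have "img ` {x \<in> zeros I. \<delta> x \<noteq> 0} \<subseteq> (\<Union>t. img ` X t)"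
  proof
    fix y assume "y \<in> img ` {x \<in> zeros I. \<delta> x \<noteq> 0}"
    then obtain x where x: "y = img x" "x \<in> zeros I" "\<delta> x \<noteq> 0" by blast
    have "\<exists>t. x \<in> X t"
      unfolding X_def by (rule compact_part_exhausts) (use x A(2) in \<open>auto simp: zeros_def\<close>)
    then show "y \<in> (\<Union>t. img ` X t)" using x(1) by blast
  qed
  ultimately have "definably_meager S m (kspace m) (img ` {x \<in> zeros I. \<delta> x \<noteq> 0})"
    unfolding definably_meager_def by (intro exI[of _ "\<lambda>t. img ` X t"] conjI)
  then show ?thesis unfolding img_def .
qed

text \<open>If all \<open>F i\<close> are pivots then the fields \<open>E b\<close> with \<open>b \<in> B2\<close> are tangent to \<open>H = 0\<close> and show
  that \<open>F\<close> is a submersion there.\<close>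

lemma submersive_on_piece:
  assumes ad: "adapted I m F B2 \<sigma> B G D E \<delta>" and all: "{..<m} \<subseteq> \<sigma> ` B2"
    and H: "\<And>i. i < l \<Longrightarrow> H i \<in> I" and x: "x \<in> zeros I" "\<delta> x \<noteq> 0"
  shows "(\<lambda>v. jacobian n U m F x *\<^sub>v v) ` tangent_space n U l H x = carrier_vec m"
proof
  show "(\<lambda>v. jacobian n U m F x *\<^sub>v v) ` tangent_space n U l H x \<subseteq> carrier_vec m"
    by (auto simp: jacobian_def tangent_space_def intro!: mult_mat_vec_carrier[of _ m n])
  have fr: "frame B G D E \<delta>" and B2: "B2 \<subseteq> B"
    and GF: "\<forall>b\<in>B2. \<sigma> b < m \<and> G b = F (\<sigma> b)"
    and EI: "\<And>h b. h \<in> I \<Longrightarrow> b \<in> B2 \<Longrightarrow> der (E b) h \<in> I"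
    using ad unfolding adapted_def by blast+
  have xU: "x \<in> U" using x(1) by (simp add: zeros_def)
  have fa: "frame_at n B (\<lambda>b k. partial U k (G b) x) (\<lambda>j i. D j i x) (\<lambda>b i. E b i x) (\<delta> x)"
    using fr xU unfolding frame_def by blast
  define \<beta> where "\<beta> = inv_into B2 \<sigma>"
  have \<beta>: "\<beta> i \<in> B2 \<and> \<sigma> (\<beta> i) = i" if "i < m" for i
  proof -
    have "i \<in> \<sigma> ` B2" using all that by blast
    then show ?thesis unfolding \<beta>_def by (intro conjI inv_into_into f_inv_into_f)
  qed
  show "carrier_vec m \<subseteq> (\<lambda>v. jacobian n U m F x *\<^sub>v v) ` tangent_space n U l H x"
  proof
    fix w :: "'a vec" assume w: "w \<in> carrier_vec m"
    define c where "c i = w $ i / \<delta> x" for i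
    \<comment> \<open>By duality the differential of \<open>F\<close> sends the field
      \<open>E (\<beta> i)\<close> to \<open>\<delta> x\<close> times the unit vector number
      \<open>i\<close>, so these coefficients produce \<open>w\<close>.\<close>
    define v where "v = vec n (\<lambda>k. \<Sum>i<m. c i * E (\<beta> i) k x)"
    have jac: "(jacobian n U p K x *\<^sub>v v) $ q = (\<Sum>i<m. c i * (\<Sum>k<n. E (\<beta> i) k x * partial U k (K q) x))"
      if "q < p" for p q and K :: "nat \<Rightarrow> (nat \<Rightarrow> 'a) \<Rightarrow> 'a"
    proof -
      have "(jacobian n U p K x *\<^sub>v v) $ q = (\<Sum>k<n. partial U k (K q) x * (\<Sum>i<m. c i * E (\<beta> i) k x))"
        using that by (simp add: jacobian_def scalar_prod_def v_def lessThan_atLeast0)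
      also have "\<dots> = (\<Sum>k<n. \<Sum>i<m. c i * (E (\<beta> i) k x * partial U k (K q) x))"
        by (simp add: sum_distrib_left mult_ac)
      also have "\<dots> = (\<Sum>i<m. c i * (\<Sum>k<n. E (\<beta> i) k x * partial U k (K q) x))"
        unfolding sum_distrib_left by (rule sum.swap)
      finally show ?thesis .
    qed
    have "jacobian n U l H x *\<^sub>v v = 0\<^sub>v l"
    proof (rule eq_vecI)
      fix q assume "q < dim_vec (0\<^sub>v l :: 'a vec)"
      then have q: "q < l" by simp
      have "(\<Sum>k<n. E (\<beta> i) k x * partial U k (H q) x) = 0" if "i < m" for i
      proof -
        have "der (E (\<beta> i)) (H q) x = 0"
          using EI[OF H[OF q]] \<beta>[OF that] x(1) unfolding zeros_def by blast
        then show ?thesis using xU by (simp add: der_def)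
      qed
      then show "(jacobian n U l H x *\<^sub>v v) $ q = (0\<^sub>v l) $ q" using q by (simp add: jac)
    qed (simp add: jacobian_def)
    then have "v \<in> tangent_space n U l H x" by (simp add: tangent_space_def v_def)
    moreover have "jacobian n U m F x *\<^sub>v v = w"
    proof (rule eq_vecI)
      fix q assume "q < dim_vec w"
      then have q: "q < m" using w by simp
      have "(\<Sum>k<n. E (\<beta> i) k x * partial U k (F q) x) = (if i = q then \<delta> x else 0)" if i: "i < m" for i
      proof -
        have b: "\<beta> i \<in> B" "\<beta> q \<in> B" using \<beta>[OF i] \<beta>[OF q] B2 by auto
        have "G (\<beta> q) = F q" using GF \<beta>[OF q] by auto
        moreover have "(\<Sum>k<n. E (\<beta> i) k x * partial U k (G (\<beta> q)) x) = (if \<beta> i = \<beta> q then \<delta> x else 0)"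
          using fa b unfolding frame_at_def by blast
        moreover have "\<beta> i = \<beta> q \<longleftrightarrow> i = q" using \<beta>[OF i] \<beta>[OF q] by metis
        ultimately show ?thesis by simp
      qed
      then have "(jacobian n U m F x *\<^sub>v v) $ q = (\<Sum>i<m. c i * (if i = q then \<delta> x else 0))"
        unfolding jac[OF q] by (intro sum.cong) auto
      also have "\<dots> = (\<Sum>i<m. if i = q then c i * \<delta> x else 0)" by (rule sum.cong) auto
      also have "\<dots> = w $ q" using q x(2) by (simp add: c_def)
      finally show "(jacobian n U m F x *\<^sub>v v) $ q = w $ q" .
    qed (use w in \<open>simp add: jacobian_def\<close>)
    ultimately show "w \<in> (\<lambda>v. jacobian n U m F x *\<^sub>v v) ` tangent_space n U l H x" by blast
  qed
qed

text \<open>\<open>Sing\<close> speaks only of the kernel of the differential of \<open>H\<close>;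
  the equations enter through \<open>zeros I\<close>. Inside the proof the condition on
  \<open>H\<close> becomes part of the induction statement, since it has to be handed on to the
  larger ideals.\<close>

lemma singular_image_meager:
  assumes Udef: "definable S n U" and F: "\<And>i. i < m \<Longrightarrow> F i \<in> M"
    and Sing: "Sing = {x \<in> U. (\<lambda>v. jacobian n U m F x *\<^sub>v v) ` tangent_space n U l H x \<noteq> carrier_vec m}"
    and img: "img = (\<lambda>x. \<lambda>i\<in>{..<m}. F i x)"
    and I: "fun_ideal I" and H: "\<And>i. i < l \<Longrightarrow> H i \<in> I"
  shows "definably_meager S m (kspace m) (img ` (zeros I \<inter> Sing))"
proof -
  have "(\<forall>i<l. H i \<in> I) \<longrightarrow> definably_meager S m (kspace m) (img ` (zeros I \<inter> Sing))"
    using I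
  proof (rule fun_ideal_induct[rotated], intro impI)
    fix I assume I: "fun_ideal I" and H: "\<forall>i<l. H i \<in> I"
      and IH: "\<And>J. fun_ideal J \<Longrightarrow> I \<subset> J \<Longrightarrow>
        (\<forall>i<l. H i \<in> J) \<longrightarrow> definably_meager S m (kspace m) (img ` (zeros J \<inter> Sing))"
    have adj: "definably_meager S m (kspace m) (img ` ({x \<in> zeros I. a x = 0} \<inter> Sing))"
      if a: "a \<in> M" "a \<notin> I" for a
    proof -
      obtain J where J: "fun_ideal J" "I \<subset> J" "\<And>x. x \<in> zeros I \<Longrightarrow> a x = 0 \<Longrightarrow> x \<in> zeros J"
        by (rule fun_ideal_adjoin[OF I a]) (rule that)
      have "definably_meager S m (kspace m) (img ` (zeros J \<inter> Sing))" using IH[OF J(1,2)] J(2) H by blast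
      then show ?thesis by (rule definably_meager_mono) (use J(3) in blast)
    qed
    show "definably_meager S m (kspace m) (img ` (zeros I \<inter> Sing))"
    proof (cases "(\<lambda>x\<in>U. 1) \<in> I")
      case True
      have False if "x \<in> zeros I" for x
      proof -
        have "(\<lambda>x\<in>U. 1) x = (0::'a)" "x \<in> U" using that True unfolding zeros_def by blast+
        then show False by simp
      qed
      then have "zeros I = {}" by blast
      then show ?thesis by (simp add: definably_meager_empty)
    next
      case one: False
      show ?thesis
      proof (cases "\<forall>a b. a \<in> M \<longrightarrow> b \<in> M \<longrightarrow> (\<lambda>x\<in>U. a x * b x) \<in> I \<longrightarrow> a \<in> I \<or> b \<in> I")
        case False
        then obtain a b where ab: "a \<in> M" "b \<in> M" "(\<lambda>x\<in>U. a x * b x) \<in> I" "a \<notin> I" "b \<notin> I" by blast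
        have "a x = 0 \<or> b x = 0" if "x \<in> zeros I" for x
        proof -
          have "(\<lambda>x\<in>U. a x * b x) x = 0" "x \<in> U" using that ab(3) unfolding zeros_def by blast+
          then show ?thesis by simp
        qed
        then have "img ` (zeros I \<inter> Sing) \<subseteq>
            img ` ({x \<in> zeros I. a x = 0} \<inter> Sing) \<union> img ` ({x \<in> zeros I. b x = 0} \<inter> Sing)" by blast
        then show ?thesis
          by (rule definably_meager_mono[OF definably_meager_Un[OF adj[OF ab(1,4)] adj[OF ab(2,5)]]])
      next
        case True
        then have prime: "a \<in> I \<or> b \<in> I" if "a \<in> M" "b \<in> M" "(\<lambda>x\<in>U. a x * b x) \<in> I" for a b
          using that by blast
        obtain B2 \<sigma> B G D E \<delta> where ad: "adapted I m F B2 \<sigma> B G D E \<delta>"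
          and DF: "\<And>i j. i < m \<Longrightarrow> j < n \<Longrightarrow> j \<notin> B \<Longrightarrow> der (D j) (F i) \<in> I"
          by (rule adapted_exists[OF I one prime F]) (assumption+, rule that)
        have \<delta>: "\<delta> \<in> M" "\<delta> \<notin> I" using ad unfolding adapted_def frame_def by blast+
        have piece: "definably_meager S m (kspace m) (img ` ({x \<in> zeros I. \<delta> x \<noteq> 0} \<inter> Sing))"
        proof (cases "{..<m} \<subseteq> \<sigma> ` B2")
          case True
          have "x \<notin> Sing" if "x \<in> zeros I" "\<delta> x \<noteq> 0" for x
            using submersive_on_piece[OF ad True, of l H x] H that unfolding Sing by blast
          then have "{x \<in> zeros I. \<delta> x \<noteq> 0} \<inter> Sing = {}" by blast
          then show ?thesis by (simp only: image_empty definably_meager_empty)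
        next
          case False
          then obtain i0 where i0: "i0 < m" "i0 \<notin> \<sigma> ` B2" by blast
          have "definably_meager S m (kspace m) (img ` {x \<in> zeros I. \<delta> x \<noteq> 0})"
            unfolding img by (rule piece_meager[OF Udef I ad F DF i0])
          then show ?thesis by (rule definably_meager_mono) blast
        qed
        have "img ` (zeros I \<inter> Sing) \<subseteq>
            img ` ({x \<in> zeros I. \<delta> x = 0} \<inter> Sing) \<union> img ` ({x \<in> zeros I. \<delta> x \<noteq> 0} \<inter> Sing)" by blast
        then show ?thesis by (rule definably_meager_mono[OF definably_meager_Un[OF adj[OF \<delta>] piece]])
      qed
    qed
  qed
  then show ?thesis using H by blast
qed

lemma vanishing_ideal: "fun_ideal {h \<in> M. \<forall>x\<in>U. P x \<longrightarrow> h x = 0}"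
  unfolding fun_ideal_def by (auto intro: M_add M_mult M_const)

end

theorem theorem8p9:
  fixes S :: "('f, 'r, 'a::{linordered_field, linorder_topology}) expansion"
    and n k m :: nat
    and U :: "(nat \<Rightarrow> 'a) set"
    and M :: "((nat \<Rightarrow> 'a) \<Rightarrow> 'a) set"
    and H F :: "nat \<Rightarrow> (nat \<Rightarrow> 'a) \<Rightarrow> 'a"
  assumes "definably_complete_Baire S"
    and "n \<ge> 1"
    and "definable S n U" and "definably_connected S n U" and "openin (ptop n) U"
    and "noetherian_differential_ring S n U M"
    and "k \<le> n"
    and "\<forall>i < n - k. H i \<in> M"
    and "regular_zeroes n U (n - k) H \<noteq> {}"
    and "\<forall>i < m. F i \<in> M"
  shows "definably_meager S m (kspace m) (singular_values n U (n - k) H m F)"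
proof -
  interpret definable_differential_ring S n U M
    using assms(1,5,6) by unfold_locales (simp_all add: definably_complete_Baire_def)
  define Sing where "Sing = {x \<in> U. (\<lambda>v. jacobian n U m F x *\<^sub>v v) ` tangent_space n U (n - k) H x \<noteq> carrier_vec m}"
  \<comment> \<open>The induction starts at the ideal of all functions in \<open>M\<close> that
    vanish on the common zeros of \<open>H\<close>. It contains every \<open>H i\<close>, and all
    regular zeroes lie in its zero set.\<close>
  define I where "I = {h \<in> M. \<forall>x\<in>U. (\<forall>i<n - k. H i x = 0) \<longrightarrow> h x = 0}"
  have "definably_meager S m (kspace m) ((\<lambda>x. \<lambda>i\<in>{..<m}. F i x) ` (zeros I \<inter> Sing))"
  proof (rule singular_image_meager[OF assms(3) _ Sing_def refl])
    show "F i \<in> M" if "i < m" for i using assms(10) that by blast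
    show "fun_ideal I" unfolding I_def by (rule vanishing_ideal)
    show "H i \<in> I" if "i < n - k" for i using assms(8) that unfolding I_def by blast
  qed
  moreover have "singular_points n U (n - k) H m F \<subseteq> zeros I \<inter> Sing"
    unfolding singular_points_def regular_zeroes_def zeros_def I_def Sing_def by blast
  ultimately show ?thesis
    unfolding singular_values_def by (rule definably_meager_mono[OF _ image_mono])
qed

end
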